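(* Let $\mathcal{F}$ be a germ of a singular holomorphic foliation at $(\mathbb{C}^2,0)$ defined by the holomorphic 1-form $\omega$, and let $X$ be a germ of a reduced curve at $(\mathbb{C}^2,0)$ defined by $\phi:(\mathbb{C}^2,0)\to(\mathbb{C},0)$. Suppose that $X$ is irreducible and not invariant by $\mathcal{F}$. Then \[\operatorname{tang}(\mathcal{F},X,0)=\operatorname{ord}_{t=0}\varphi^*\omega+\mu_0(X),\] where $\varphi$ is a Puiseux parametrization of $X$.
   Context: $\mathcal{O}_2$ is the ring of germs of holomorphic functions at $0\in\mathbb{C}^2$. $\mathcal{F}$ is given by $\omega=A\,dx+B\,dy$ with $A,B\in\mathcal{O}_2$ relatively prime, or by the dual vector field $v=-B\frac{\partial}{\partial x}+A\frac{\partial}{\partial y}$; it is singular at $0$ if $A(0)=B(0)=0$. $X=\{\phi=0\}$ is invariant by $\mathcal{F}$ if $\phi$ divides the coefficient of $dx\wedge dy$ in $\omega\wedge d\phi$. The tangency order is $\operatorname{tang}(\mathcal{F},X,0)=\dim_{\mathbb{C}}\mathcal{O}_2/\langle\phi,v(\phi)\rangle$ with $\phi$ a reduced equation of $X$, and $\mu_0(X)=\dim_{\mathbb{C}}\mathcal{O}_2/\langle\phi_x,\phi_y\rangle$. If $\varphi(t)=(x(t),y(t))$ is a (primitive) Puiseux parametrization of the branch $X$, then $\varphi^*\omega=(A(\varphi(t))x'(t)+B(\varphi(t))y'(t))\,dt$ and $\operatorname{ord}_{t=0}\varphi^*\omega$ is the vanishing order at $t=0$ of the coefficient of $dt$. 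*)

theory Defs
  imports
    "HOL-Complex_Analysis.Complex_Analysis"
    "HOL-Library.Extended_Nat"
    "HOL-Computational_Algebra.Squarefree"
    "HOL-Algebra.Embedded_Algebras"
    "HOL-Algebra.QuotRing"
    "HOL-Algebra.Algebraic_Closure_Type"
begin

section \<open>Holomorphic functions near the origin of the plane\<close>

text \<open>
  Holomorphic on a neighbourhood of the origin: at every nearby point the function has a
  (Frechet) derivative that is linear over the complex numbers.
\<close>

definition holo_near0 :: "(complex \<times> complex \<Rightarrow> complex) \<Rightarrow> bool" where
  "holo_near0 f \<longleftrightarrow>
     (\<forall>\<^sub>F p in nhds 0. \<exists>a b. (f has_derivative (\<lambda>(h, k). a * h + b * k)) (at p))"

definition partial_x :: "(complex \<times> complex \<Rightarrow> complex) \<Rightarrow> complex \<times> complex \<Rightarrow> complex" where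
  "partial_x f = (\<lambda>(x, y). deriv (\<lambda>s. f (s, y)) x)"

definition partial_y :: "(complex \<times> complex \<Rightarrow> complex) \<Rightarrow> complex \<times> complex \<Rightarrow> complex" where
  "partial_y f = (\<lambda>(x, y). deriv (\<lambda>s. f (x, s)) y)"

definition germ_eq ::
    "(complex \<times> complex \<Rightarrow> complex) \<Rightarrow> (complex \<times> complex \<Rightarrow> complex) \<Rightarrow> bool" where
  "germ_eq f g \<longleftrightarrow> holo_near0 f \<and> holo_near0 g \<and> (\<forall>\<^sub>F p in nhds 0. f p = g p)"

lemma holo_near0_const [simp]: "holo_near0 (\<lambda>p. c)"
  unfolding holo_near0_def
  by (rule always_eventually, rule allI, rule exI[of _ 0], rule exI[of _ 0])
     (simp add: case_prod_unfold)

lemma holo_near0_add: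
  assumes "holo_near0 f" "holo_near0 g" shows "holo_near0 (\<lambda>p. f p + g p)"
  using assms unfolding holo_near0_def
proof eventually_elim
  case (elim p)
  then obtain a b c d where
    f: "(f has_derivative (\<lambda>(h, k). a * h + b * k)) (at p)" and
    g: "(g has_derivative (\<lambda>(h, k). c * h + d * k)) (at p)" by blast
  have "((\<lambda>p. f p + g p) has_derivative (\<lambda>(h, k). (a + c) * h + (b + d) * k)) (at p)"
    by (rule has_derivative_eq_rhs[OF has_derivative_add[OF f g]])
       (auto simp: fun_eq_iff algebra_simps)
  then show ?case by blast
qed

lemma holo_near0_mult:
  assumes "holo_near0 f" "holo_near0 g" shows "holo_near0 (\<lambda>p. f p * g p)"
  using assms unfolding holo_near0_def
proof eventually_elim
  case (elim p)
  then obtain a b c d where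
    f: "(f has_derivative (\<lambda>(h, k). a * h + b * k)) (at p)" and
    g: "(g has_derivative (\<lambda>(h, k). c * h + d * k)) (at p)" by blast
  have "((\<lambda>p. f p * g p) has_derivative
           (\<lambda>(h, k). (f p * c + a * g p) * h + (f p * d + b * g p) * k)) (at p)"
    by (rule has_derivative_eq_rhs[OF has_derivative_mult[OF f g]])
       (auto simp: fun_eq_iff algebra_simps)
  then show ?case by blast
qed

lemma holo_near0_uminus:
  assumes "holo_near0 f" shows "holo_near0 (\<lambda>p. - f p)"
  using holo_near0_mult[OF holo_near0_const[of "-1"] assms] by simp

lemma holo_near0_diff:
  assumes "holo_near0 f" "holo_near0 g" shows "holo_near0 (\<lambda>p. f p - g p)"
  using holo_near0_add[OF assms(1) holo_near0_uminus[OF assms(2)]] by simp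


text \<open>Partial derivatives of a holomorphic function are holomorphic.\<close>

definition sep_holo :: "real \<Rightarrow> (complex \<times> complex \<Rightarrow> complex) \<Rightarrow> bool" where
  "sep_holo R f \<longleftrightarrow> continuous_on (ball 0 R \<times> ball 0 R) f \<and>
     (\<forall>y\<in>ball 0 R. (\<lambda>x. f (x, y)) holomorphic_on ball 0 R) \<and>
     (\<forall>x\<in>ball 0 R. (\<lambda>y. f (x, y)) holomorphic_on ball 0 R)"

lemma sep_holo_swap:
  assumes "sep_holo R f" shows "sep_holo R (f \<circ> prod.swap)"
proof -
  have "continuous_on (ball 0 R \<times> ball 0 R) (f \<circ> prod.swap)"
    using assms unfolding sep_holo_def
    by (intro continuous_on_compose continuous_on_swap) (auto simp: product_swap)
  then show ?thesis using assms unfolding sep_holo_def by auto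
qed

lemma sep_holo_mono: "sep_holo R f \<Longrightarrow> r \<le> R \<Longrightarrow> sep_holo r f"
  unfolding sep_holo_def
  by (meson continuous_on_subset holomorphic_on_subset subset_ball Sigma_mono in_mono)

lemma partial_y_swap: "partial_y f = partial_x (f \<circ> prod.swap) \<circ> prod.swap"
  by (auto simp: partial_x_def partial_y_def)

lemma partial_x_swap: "partial_x f = partial_y (f \<circ> prod.swap) \<circ> prod.swap"
  by (auto simp: partial_x_def partial_y_def)

lemma partial_x_integral:
  assumes "sep_holo R f" "0 < r" "r < R" "x \<in> ball 0 r" "y \<in> ball 0 R"
  shows "partial_x f (x, y) = 1 / (2 * of_real pi * \<i>) * integral {0..1}
           (\<lambda>t. f (circlepath 0 r t, y) / (circlepath 0 r t - x)^2 *
                (2 * pi * \<i> * r * exp (2 * of_real pi * \<i> * t)))"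
proof -
  have hol: "(\<lambda>x. f (x, y)) holomorphic_on ball 0 R"
    using assms unfolding sep_holo_def by auto
  have "continuous_on (cball 0 r) (\<lambda>x. f (x, y))"
    by (rule holomorphic_on_imp_continuous_on, rule holomorphic_on_subset[OF hol])
       (use assms in auto)
  moreover have "(\<lambda>x. f (x, y)) holomorphic_on ball 0 r"
    by (rule holomorphic_on_subset[OF hol]) (use assms in auto)
  ultimately have "((\<lambda>x. f (x, y)) has_field_derivative (1 / (2 * of_real pi * \<i>) *
      contour_integral (circlepath 0 r) (\<lambda>u. f (u, y) / (u - x)^2))) (at x)"
    by (rule Cauchy_derivative_integral_circlepath) (use assms in auto)
  then show ?thesis
    by (simp add: partial_x_def DERIV_imp_deriv contour_integral_integral
        vector_derivative_circlepath)
qed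

lemma circlepath_ne: "0 < r \<Longrightarrow> x \<in> ball 0 r \<Longrightarrow> circlepath 0 r t \<noteq> x"
  by (auto simp: circlepath norm_mult)

lemma circlepath_in: "0 < r \<Longrightarrow> r < R \<Longrightarrow> circlepath 0 r t \<in> ball 0 R"
  by (auto simp: circlepath norm_mult)

lemma continuous_on_circlepath [continuous_intros]:
  "continuous_on A g \<Longrightarrow> continuous_on A (\<lambda>x. circlepath 0 r (g x))"
  unfolding circlepath by (intro continuous_intros)

lemma continuous_partial_x:
  assumes f: "sep_holo R f"
  shows "continuous_on (ball 0 R \<times> ball 0 R) (partial_x f)"
proof -
  have main: "continuous_on (ball 0 r \<times> ball 0 R) (partial_x f)" if r: "0 < r" "r < R" for r
  proof -
    have cf: "continuous_on (ball 0 R \<times> ball 0 R) f" using f by (auto simp: sep_holo_def)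
    have "continuous_on ((ball 0 r \<times> ball 0 R) \<times> cbox 0 1)
       (\<lambda>((x, y), t::real). f (circlepath 0 r t, y) / (circlepath 0 r t - x)^2 *
                (2 * pi * \<i> * r * exp (2 * of_real pi * \<i> * t)))"
      unfolding case_prod_unfold
      by (intro continuous_intros continuous_on_compose2[OF cf])
         (use circlepath_in[OF r] circlepath_ne[OF r(1)] in auto)
    then have "continuous_on (ball 0 r \<times> ball 0 R)
       (\<lambda>p. integral (cbox 0 1) (\<lambda>t::real. f (circlepath 0 r t, snd p) / (circlepath 0 r t - fst p)^2 *
                (2 * pi * \<i> * r * exp (2 * of_real pi * \<i> * t))))"
      by (intro integral_continuous_on_param) (auto simp: case_prod_unfold)
    then have "continuous_on (ball 0 r \<times> ball 0 R)
       (\<lambda>p. 1 / (2 * of_real pi * \<i>) * integral {0..1} (\<lambda>t::real. f (circlepath 0 r t, snd p) / (circlepath 0 r t - fst p)^2 *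
                (2 * pi * \<i> * r * exp (2 * of_real pi * \<i> * t))))"
      by (intro continuous_intros) (simp add: cbox_interval)
    then show ?thesis
      by (rule continuous_on_eq) (auto simp: partial_x_integral[OF f r])
  qed
  show ?thesis
  proof (rule continuous_at_imp_continuous_on, safe)
    fix x y :: complex assume xy: "x \<in> ball 0 R" "y \<in> ball 0 R"
    then obtain r where r: "norm x < r" "r < R" by (auto dest: dense)
    then have "0 < r" using norm_ge_zero[of x] by linarith
    from main[OF this r(2)] show "isCont (partial_x f) (x, y)"
      by (rule continuous_on_interior) (use r xy in \<open>auto simp: interior_open open_Times\<close>)
  qed
qed

lemma continuous_partial_y:
  assumes f: "sep_holo R f"
  shows "continuous_on (ball 0 R \<times> ball 0 R) (partial_y f)"
  unfolding partial_y_swap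
  by (intro continuous_on_compose continuous_on_swap)
     (use continuous_partial_x[OF sep_holo_swap[OF f]] in \<open>auto simp: product_swap\<close>)

lemma sep_holo_partial_x:
  assumes f: "sep_holo R f" and r: "0 < r" "r < R"
  shows "sep_holo r (partial_x f)"
  unfolding sep_holo_def
proof (intro conjI ballI)
  show "continuous_on (ball 0 r \<times> ball 0 r) (partial_x f)"
    by (rule continuous_on_subset[OF continuous_partial_x[OF f]]) (use r in auto)
next
  fix y :: complex assume "y \<in> ball 0 r"
  then have "(\<lambda>x. f (x, y)) holomorphic_on ball 0 r"
    using sep_holo_mono[OF f, of r] r by (auto simp: sep_holo_def)
  then show "(\<lambda>x. partial_x f (x, y)) holomorphic_on ball 0 r"
    unfolding partial_x_def by (auto intro: holomorphic_deriv)
next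
  fix x :: complex assume x: "x \<in> ball 0 r"
  let ?k = "\<lambda>t::real. 1 / (circlepath 0 r t - x)^2 *
                (2 * pi * \<i> * r * exp (2 * of_real pi * \<i> * t))"
  have cf: "continuous_on (ball 0 R \<times> ball 0 R) f" using f by (auto simp: sep_holo_def)
  have "(\<lambda>y. integral (cbox 0 1) (\<lambda>t. f (circlepath 0 r t, y) * ?k t)) holomorphic_on ball 0 R"
  proof (rule leibniz_rule_holomorphic)
    fix y :: complex and t :: real assume y: "y \<in> ball 0 R" and "t \<in> cbox 0 1"
    have "(\<lambda>y. f (circlepath 0 r t, y)) holomorphic_on ball 0 R"
      using f circlepath_in[OF r] by (auto simp: sep_holo_def)
    then have "((\<lambda>y. f (circlepath 0 r t, y)) has_field_derivative
                  partial_y f (circlepath 0 r t, y)) (at y within ball 0 R)"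
      using y by (auto simp: partial_y_def intro!: DERIV_subset[OF holomorphic_derivI])
    then show "((\<lambda>y. f (circlepath 0 r t, y) * ?k t) has_field_derivative
                  partial_y f (circlepath 0 r t, y) * ?k t) (at y within ball 0 R)"
      by (rule DERIV_cmult_right)
  next
    fix y :: complex assume y: "y \<in> ball 0 R"
    show "(\<lambda>t. f (circlepath 0 r t, y) * ?k t) integrable_on cbox 0 1"
      by (intro integrable_continuous continuous_intros continuous_on_compose2[OF cf])
         (use y circlepath_in[OF r] circlepath_ne[OF r(1) x] in auto)
  next
    show "continuous_on (ball 0 R \<times> cbox 0 1) (\<lambda>(y, t). partial_y f (circlepath 0 r t, y) * ?k t)"
      unfolding case_prod_unfold
      by (intro continuous_intros continuous_on_compose2[OF continuous_partial_y[OF f]])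
         (use circlepath_in[OF r] circlepath_ne[OF r(1) x] in auto)
  qed auto
  then have "(\<lambda>y. 1 / (2 * of_real pi * \<i>) *
      integral (cbox 0 1) (\<lambda>t. f (circlepath 0 r t, y) * ?k t)) holomorphic_on ball 0 r"
    by (intro holomorphic_intros) (use r in \<open>auto elim!: holomorphic_on_subset\<close>)
  then show "(\<lambda>y. partial_x f (x, y)) holomorphic_on ball 0 r"
    by (rule holomorphic_transform)
       (use r x in \<open>simp add: partial_x_integral[OF f r x] cbox_interval\<close>)
qed

lemma sep_holo_partial_y:
  assumes f: "sep_holo R f" and r: "0 < r" "r < R"
  shows "sep_holo r (partial_y f)"
  unfolding partial_y_swap
  by (intro sep_holo_swap sep_holo_partial_x[OF _ r] f)

lemma sep_holo_imp_has_derivative: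
  assumes f: "sep_holo R f" and p: "p \<in> ball 0 R \<times> ball 0 R"
  shows "(f has_derivative (\<lambda>(h, k). partial_x f p * h + partial_y f p * k)) (at p)"
proof -
  obtain x y where [simp]: "p = (x, y)" and xy: "x \<in> ball 0 R" "y \<in> ball 0 R"
    using p by (cases p) auto
  define fy where "fy = (\<lambda>x y. blinfun_mult_right (partial_y f (x, y)))"
  have "((\<lambda>(x, y). f (x, y)) has_derivative (\<lambda>(h, k). partial_x f p * h + fy x y k))
          (at (x, y) within ball 0 R \<times> ball 0 R)"
  proof (rule has_derivative_partialsI[where f = "\<lambda>x y. f (x, y)"])
    have "(\<lambda>x. f (x, y)) holomorphic_on ball 0 R" using f xy by (auto simp: sep_holo_def)
    then have "((\<lambda>x. f (x, y)) has_field_derivative partial_x f p) (at x within ball 0 R)"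
      using xy by (auto simp: partial_x_def intro!: DERIV_subset[OF holomorphic_derivI])
    then show "((\<lambda>x. f (x, y)) has_derivative (\<lambda>h. partial_x f p * h)) (at x within ball 0 R)"
      by (simp add: has_field_derivative_def)
  next
    fix u v :: complex assume uv: "u \<in> ball 0 R" "v \<in> ball 0 R"
    have "(\<lambda>y. f (u, y)) holomorphic_on ball 0 R" using f uv by (auto simp: sep_holo_def)
    then have "((\<lambda>y. f (u, y)) has_field_derivative partial_y f (u, v)) (at v within ball 0 R)"
      using uv by (auto simp: partial_y_def intro!: DERIV_subset[OF holomorphic_derivI])
    then show "((\<lambda>y. f (u, y)) has_derivative blinfun_apply (fy u v)) (at v within ball 0 R)"
      by (simp add: has_field_derivative_def fy_def)
  next
    have "continuous_on (ball 0 R \<times> ball 0 R) (\<lambda>(x, y). fy x y)"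
      unfolding fy_def case_prod_unfold
      using continuous_partial_y[OF f]
      by (auto intro!: bounded_linear.continuous_on[OF bounded_linear_blinfun_mult_right])
    then show "continuous (at (x, y) within ball 0 R \<times> ball 0 R) (\<lambda>(x, y). fy x y)"
      using xy by (simp add: continuous_on_eq_continuous_within)
  qed (use xy in auto)
  then show ?thesis
    using at_within_open[of "(x, y)" "ball 0 R \<times> ball 0 R"] xy
    by (simp add: fy_def open_Times case_prod_unfold)
qed

lemma sep_holo_imp_holo_near0:
  assumes "sep_holo R f" "R > 0" shows "holo_near0 f"
  unfolding holo_near0_def eventually_nhds
  by (rule exI[of _ "ball 0 R \<times> ball 0 R"])
     (use assms sep_holo_imp_has_derivative in \<open>fastforce simp: open_Times zero_prod_def\<close>)

lemma holo_near0_imp_sep_holo: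
  assumes "holo_near0 f" obtains R where "R > 0" "sep_holo R f"
proof -
  obtain U where U: "open U" "0 \<in> U"
    and d: "\<And>p. p \<in> U \<Longrightarrow> \<exists>a b. (f has_derivative (\<lambda>(h, k). a * h + b * k)) (at p)"
    using assms unfolding holo_near0_def eventually_nhds by blast
  obtain A B where AB: "open A" "open B" "0 \<in> A" "0 \<in> B" "A \<times> B \<subseteq> U"
    using open_prod_elim[OF U] by (metis mem_Sigma_iff zero_prod_def)
  obtain r1 where r1: "r1 > 0" "ball 0 r1 \<subseteq> A" using AB open_contains_ball by blast
  obtain r2 where r2: "r2 > 0" "ball 0 r2 \<subseteq> B" using AB open_contains_ball by blast
  define R where "R = min r1 r2"
  have R: "R > 0" "ball 0 R \<times> ball 0 R \<subseteq> U"
    using r1 r2 AB unfolding R_def by (auto simp: subset_iff)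
  have "sep_holo R f"
    unfolding sep_holo_def
  proof (intro conjI ballI)
    show "continuous_on (ball 0 R \<times> ball 0 R) f"
      using R(2) d by (intro continuous_at_imp_continuous_on) (blast intro: has_derivative_continuous)
  next
    fix y :: complex assume y: "y \<in> ball 0 R"
    show "(\<lambda>x. f (x, y)) holomorphic_on ball 0 R"
    proof (subst holomorphic_on_open, simp, safe)
      fix x :: complex assume "x \<in> ball 0 R"
      with y R(2) d obtain a b where
        D: "(f has_derivative (\<lambda>(h, k). a * h + b * k)) (at (x, y))" by blast
      have "((\<lambda>x. f (x, y)) has_derivative (\<lambda>h. a * h)) (at x)"
        by (rule has_derivative_eq_rhs[OF has_derivative_compose[of "\<lambda>x. (x, y)" "\<lambda>h. (h, 0)"]])
           (auto intro!: derivative_eq_intros D)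
      then show "\<exists>f'. ((\<lambda>x. f (x, y)) has_field_derivative f') (at x)"
        by (auto simp: has_field_derivative_def)
    qed
  next
    fix x :: complex assume x: "x \<in> ball 0 R"
    show "(\<lambda>y. f (x, y)) holomorphic_on ball 0 R"
    proof (subst holomorphic_on_open, simp, safe)
      fix y :: complex assume "y \<in> ball 0 R"
      with x R(2) d obtain a b where
        D: "(f has_derivative (\<lambda>(h, k). a * h + b * k)) (at (x, y))" by blast
      have "((\<lambda>y. f (x, y)) has_derivative (\<lambda>h. b * h)) (at y)"
        by (rule has_derivative_eq_rhs[OF has_derivative_compose[of "\<lambda>y. (x, y)" "\<lambda>h. (0, h)"]])
           (auto intro!: derivative_eq_intros D)
      then show "\<exists>f'. ((\<lambda>y. f (x, y)) has_field_derivative f') (at y)"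
        by (auto simp: has_field_derivative_def)
    qed
  qed
  with R(1) show ?thesis by (rule that)
qed

lemma holo_near0_partial_x:
  assumes "holo_near0 f" shows "holo_near0 (partial_x f)"
proof -
  obtain R where R: "R > 0" "sep_holo R f" by (rule holo_near0_imp_sep_holo[OF assms])
  show ?thesis
    by (rule sep_holo_imp_holo_near0[OF sep_holo_partial_x[OF R(2), of "R/2"]]) (use R in auto)
qed

lemma holo_near0_partial_y:
  assumes "holo_near0 f" shows "holo_near0 (partial_y f)"
proof -
  obtain R where R: "R > 0" "sep_holo R f" by (rule holo_near0_imp_sep_holo[OF assms])
  show ?thesis
    by (rule sep_holo_imp_holo_near0[OF sep_holo_partial_y[OF R(2), of "R/2"]]) (use R in auto)
qed

lemma eventually_eq_nhds_eventually:
  "(\<forall>\<^sub>F p in nhds 0. f p = g p) \<Longrightarrow> \<forall>\<^sub>F p in nhds 0. \<forall>\<^sub>F q in nhds p. f q = g q"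
  by (simp add: eventually_eventually)

lemma partial_x_cong:
  assumes "\<forall>\<^sub>F p in nhds 0. f p = g p"
  shows "\<forall>\<^sub>F p in nhds 0. partial_x f p = partial_x g p"
  using eventually_eq_nhds_eventually[OF assms]
proof eventually_elim
  case (elim p)
  obtain x y where [simp]: "p = (x, y)" by (cases p)
  have "filterlim (\<lambda>s. (s, y)) (nhds (x, y)) (nhds x)"
    by (intro tendsto_intros) (auto simp: filterlim_ident)
  with elim have "\<forall>\<^sub>F s in nhds x. f (s, y) = g (s, y)"
    by (auto simp: filterlim_iff)
  then show ?case by (simp add: partial_x_def deriv_cong_ev)
qed

lemma partial_y_cong:
  assumes "\<forall>\<^sub>F p in nhds 0. f p = g p"
  shows "\<forall>\<^sub>F p in nhds 0. partial_y f p = partial_y g p"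
  using eventually_eq_nhds_eventually[OF assms]
proof eventually_elim
  case (elim p)
  obtain x y where [simp]: "p = (x, y)" by (cases p)
  have "filterlim (\<lambda>s. (x, s)) (nhds (x, y)) (nhds y)"
    by (intro tendsto_intros) (auto simp: filterlim_ident)
  with elim have "\<forall>\<^sub>F s in nhds y. f (x, s) = g (x, s)"
    by (auto simp: filterlim_iff)
  then show ?case by (simp add: partial_y_def deriv_cong_ev)
qed


section \<open>The ring of germs\<close>

quotient_type germ = "complex \<times> complex \<Rightarrow> complex" / partial: germ_eq
proof (rule part_equivpI)
  show "\<exists>f. germ_eq f f"
    by (rule exI[of _ "\<lambda>_. 0"]) (simp add: germ_eq_def)
  show "symp germ_eq"
    by (auto simp: symp_def germ_eq_def eq_commute)
  show "transp germ_eq"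
    unfolding transp_def germ_eq_def by (auto elim: eventually_elim2)
qed

instantiation germ :: comm_ring_1
begin

lift_definition zero_germ :: germ is "\<lambda>_. 0" by (simp add: germ_eq_def)
lift_definition one_germ :: germ is "\<lambda>_. 1" by (simp add: germ_eq_def)
lift_definition plus_germ :: "germ \<Rightarrow> germ \<Rightarrow> germ" is "\<lambda>f g p. f p + g p"
  unfolding germ_eq_def by (auto intro: holo_near0_add elim: eventually_elim2)
lift_definition times_germ :: "germ \<Rightarrow> germ \<Rightarrow> germ" is "\<lambda>f g p. f p * g p"
  unfolding germ_eq_def by (auto intro: holo_near0_mult elim: eventually_elim2)
lift_definition uminus_germ :: "germ \<Rightarrow> germ" is "\<lambda>f p. - f p"
  unfolding germ_eq_def by (auto intro: holo_near0_uminus elim: eventually_mono)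
lift_definition minus_germ :: "germ \<Rightarrow> germ \<Rightarrow> germ" is "\<lambda>f g p. f p - g p"
  unfolding germ_eq_def by (auto intro: holo_near0_diff elim: eventually_elim2)

instance
proof
  show "(0::germ) \<noteq> 1"
    by transfer (auto simp: germ_eq_def dest: eventually_nhds_x_imp_x)
qed (transfer; auto simp: germ_eq_def algebra_simps
      intro!: holo_near0_add holo_near0_mult holo_near0_uminus holo_near0_diff)+

end

lift_definition germ_const :: "complex \<Rightarrow> germ" is "\<lambda>c _. c"
  by (simp add: germ_eq_def)

lift_definition germ_at0 :: "germ \<Rightarrow> complex" is "\<lambda>f. f 0"
  by (auto simp: germ_eq_def dest: eventually_nhds_x_imp_x)

lift_definition germ_dx :: "germ \<Rightarrow> germ" is partial_x
  by (auto simp: germ_eq_def intro: holo_near0_partial_x partial_x_cong)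

lift_definition germ_dy :: "germ \<Rightarrow> germ" is partial_y
  by (auto simp: germ_eq_def intro: holo_near0_partial_y partial_y_cong)

section \<open>Foliations, curves and their invariants\<close>

text \<open>\<open>(A, B)\<close> stands for the 1-form \<open>A dx + B dy\<close>, and \<open>(P, Q)\<close> for the vector field
  \<open>P \<partial>/\<partial>x + Q \<partial>/\<partial>y\<close>.\<close>

type_synonym one_form = "germ \<times> germ"
type_synonym vector_field = "germ \<times> germ"

text \<open>Coprimality is spelled out because \<open>coprime\<close> of the library needs a class with division.\<close>

definition foliation_form :: "one_form \<Rightarrow> bool" where
  "foliation_form \<omega> \<longleftrightarrow> (\<forall>c. c dvd fst \<omega> \<longrightarrow> c dvd snd \<omega> \<longrightarrow> c dvd 1)"

definition singular_at0 :: "one_form \<Rightarrow> bool" where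
  "singular_at0 \<omega> \<longleftrightarrow> germ_at0 (fst \<omega>) = 0 \<and> germ_at0 (snd \<omega>) = 0"

definition differential :: "germ \<Rightarrow> one_form" where
  "differential f = (germ_dx f, germ_dy f)"

definition wedge_coeff :: "one_form \<Rightarrow> one_form \<Rightarrow> germ" where
  "wedge_coeff = (\<lambda>(A, B) (C, D). A * D - B * C)"

definition dual_field :: "one_form \<Rightarrow> vector_field" where
  "dual_field = (\<lambda>(A, B). (- B, A))"

definition apply_field :: "vector_field \<Rightarrow> germ \<Rightarrow> germ" where
  "apply_field = (\<lambda>(P, Q) f. P * germ_dx f + Q * germ_dy f)"

definition invariant_curve :: "one_form \<Rightarrow> germ \<Rightarrow> bool" where
  "invariant_curve \<omega> \<phi> \<longleftrightarrow> \<phi> dvd wedge_coeff \<omega> (differential \<phi>)"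

definition reduced_equation :: "germ \<Rightarrow> bool" where
  "reduced_equation \<phi> \<longleftrightarrow> \<phi> \<noteq> 0 \<and> germ_at0 \<phi> = 0 \<and> squarefree \<phi>"

text \<open>
  The dimension over \<open>K\<close> of a subspace \<open>E\<close> of the ring \<open>R\<close>, with value \<open>\<infinity>\<close> for infinite
  dimension (where the library's \<open>ring.dim\<close> is unspecified).
\<close>

definition edim :: "('a, 'b) ring_scheme \<Rightarrow> 'a set \<Rightarrow> 'a set \<Rightarrow> enat" where
  "edim R K E = (if ring.finite_dimension R K E then enat (ring.dim R K E) else \<infinity>)"

abbreviation germ_ring :: "germ ring" where
  "germ_ring \<equiv> ring_of_type_algebra"

text \<open>
  \<open>dim\<close> over the complex numbers of the quotient of the ring of germs by the ideal generated
  by \<open>f\<close> and \<open>g\<close>; the complex numbers act through the cosets of the constant germs.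
\<close>

definition quotient_dim :: "germ \<Rightarrow> germ \<Rightarrow> enat" where
  "quotient_dim f g =
     (let I = genideal germ_ring {f, g}
      in edim (germ_ring Quot I) (range (\<lambda>c. a_r_coset germ_ring I (germ_const c)))
           (carrier (germ_ring Quot I)))"

definition tang :: "one_form \<Rightarrow> germ \<Rightarrow> enat" where
  "tang \<omega> \<phi> = quotient_dim \<phi> (apply_field (dual_field \<omega>) \<phi>)"

definition milnor_number :: "germ \<Rightarrow> enat" where
  "milnor_number \<phi> = quotient_dim (germ_dx \<phi>) (germ_dy \<phi>)"

text \<open>
  The parametrization \<open>\<gamma>\<close> is only meaningful near \<open>0\<close>, and \<open>rep_germ \<phi>\<close> is an arbitrary
  representative; since \<open>\<gamma>\<close> is continuous with \<open>\<gamma> 0 = 0\<close>, the composition \<open>rep_germ \<phi> \<circ> \<gamma>\<close>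
  near \<open>0\<close> does not depend on the choice. The last conjunct says that the parametrization is
  primitive: it does not factor through a map germ \<open>\<tau>\<close> of the line with order at least 2. In
  particular \<open>\<gamma>\<close> is not constant.
\<close>

definition puiseux_parametrization :: "germ \<Rightarrow> (complex \<Rightarrow> complex \<times> complex) \<Rightarrow> bool" where
  "puiseux_parametrization \<phi> \<gamma> \<longleftrightarrow>
     (fst \<circ> \<gamma>) analytic_on {0} \<and> (snd \<circ> \<gamma>) analytic_on {0} \<and> \<gamma> 0 = 0 \<and>
     (\<forall>\<^sub>F t in nhds 0. rep_germ \<phi> (\<gamma> t) = 0) \<and>
     (\<nexists>\<sigma> \<tau>. (fst \<circ> \<sigma>) analytic_on {0} \<and> (snd \<circ> \<sigma>) analytic_on {0} \<and>
            \<tau> analytic_on {0} \<and> \<tau> 0 = 0 \<and> deriv \<tau> 0 = 0 \<and>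
            (\<forall>\<^sub>F t in nhds 0. \<gamma> t = \<sigma> (\<tau> t)))"

definition pullback_coeff :: "(complex \<Rightarrow> complex \<times> complex) \<Rightarrow> one_form \<Rightarrow> complex \<Rightarrow> complex" where
  "pullback_coeff \<gamma> \<omega> t =
     rep_germ (fst \<omega>) (\<gamma> t) * deriv (fst \<circ> \<gamma>) t + rep_germ (snd \<omega>) (\<gamma> t) * deriv (snd \<circ> \<gamma>) t"

definition vanishing_order :: "(complex \<Rightarrow> complex) \<Rightarrow> enat" where
  "vanishing_order h =
     (if \<forall>\<^sub>F t in nhds 0. h t = 0 then \<infinity> else enat (nat (zorder h 0)))"

end

theory Submission
  imports Defs
begin

text \<open>
  Write \<open>i(f, g)\<close> for the colength of the ideal \<open>(f, g)\<close>. If \<open>f(x\<^sup>N, y)\<close> is a unit times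
  \<open>\<Prod>\<^sub>j (y - \<alpha>\<^sub>j(x))\<close>, then \<open>N i(f, g) = \<Sum>\<^sub>j ord g(x\<^sup>N, \<alpha>\<^sub>j(x))\<close>, because the ring of germs is
  free of rank \<open>N\<close> over its subring of germs in \<open>(x\<^sup>N, y)\<close> and colengths are additive in products.
  For the irreducible \<open>\<phi>\<close> such a factorization is given by the conjugates of the primitive
  parametrization \<open>\<gamma>\<close>, so \<open>i(\<phi>, g) = ord g(\<gamma>(t))\<close>; for the polar curve \<open>\<phi>\<^sub>y = 0\<close> it is given by
  Puiseux's theorem. Differentiating \<open>\<phi>\<close> along the branches of the polar curve yields Teissier's
  formula \<open>i(\<phi>\<^sub>y, \<phi>) = i(\<phi>\<^sub>y, \<phi>\<^sub>x) + i(x, \<phi>) - 1\<close>. Finally \<open>\<phi>\<^sub>x x' + \<phi>\<^sub>y y' = 0\<close> along \<open>\<gamma>\<close> gives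
  \<open>x' v(\<phi>) = \<phi>\<^sub>y (A x' + B y')\<close>, and comparing orders proves the claim. The case \<open>x(t) = 0\<close>, where
  \<open>\<phi>\<close> is a unit times \<open>x\<close>, is treated directly.
\<close>

section \<open>Codimension of subspaces\<close>

text \<open>Why pass to \<open>x^N\<close>: a curve such as the polar curve does not split into
  linear factors over the germs in \<open>(x, y)\<close>. After \<open>x \<mapsto> x^N\<close> each
  relevant curve is a unit times factors \<open>y - \<alpha>(x)\<close>. These are visibly prime and
  cancellable, with quotient the germs in \<open>x\<close>, so additivity of colength has to be
  established for them only. The price is a factor \<open>N\<close> that cancels at the end, and all
  exponents stay natural numbers. Colengths live in \<open>enat\<close>; only finite quantities
  (\<open>N\<close> and the order of \<open>x'(t)\<close>) are ever cancelled, so finite and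
  infinite values obey the same equations. Since everything is projected to the
  \<open>x\<close>-axis, the argument needs \<open>\<phi>(0, y)\<close> to be nonzero, which is why
  \<open>x(t) = 0\<close> is a case of its own. The number \<open>ord x(t) = i(x, \<phi>)\<close>,
  diminished by one, is both the order of \<open>x'(t)\<close> and the number of polar branches over
  the ramified \<open>x\<close>-axis; this coincidence removes it from the final formula.\<close>

locale chain_dimension = vector_space scale for scale :: "'a::field \<Rightarrow> 'b::ab_group_add \<Rightarrow> 'b"
begin

definition adjoin :: "'b set \<Rightarrow> 'b \<Rightarrow> 'b set" where
  "adjoin U v = {u + scale c v | u c. u \<in> U}"

lemma adjoinI: "x = u + scale c v \<Longrightarrow> u \<in> U \<Longrightarrow> x \<in> adjoin U v"
  and adjoinE: "x \<in> adjoin U v \<Longrightarrow> (\<And>u c. x = u + scale c v \<Longrightarrow> u \<in> U \<Longrightarrow> P) \<Longrightarrow> P"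
  unfolding adjoin_def by blast+

text \<open>A chain of one-dimensional extensions from \<open>I\<close> to \<open>U\<close>. The
  shape copies the inductive \<open>dimension\<close> with \<open>line_extension\<close> for
  embedded algebras, so that the two notions can be matched rule by rule in the end; until then
  codimensions are handled without any quotient space.\<close>

inductive qdim :: "'b set \<Rightarrow> nat \<Rightarrow> 'b set \<Rightarrow> bool" for I where
  qdim_0: "qdim I 0 I"
| qdim_Suc: "qdim I n U \<Longrightarrow> v \<notin> U \<Longrightarrow> qdim I (Suc n) (adjoin U v)"

lemma subspace_adjoin:
  assumes "subspace U" shows "subspace (adjoin U v)"
proof (rule subspaceI)
  show "0 \<in> adjoin U v"
    using subspace_0[OF assms] by (intro adjoinI[of _ 0 0]) auto
next
  fix x y assume "x \<in> adjoin U v" "y \<in> adjoin U v"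
  then obtain u c u' c' where "x = u + scale c v" "y = u' + scale c' v" "u \<in> U" "u' \<in> U"
    by (elim adjoinE) blast
  then show "x + y \<in> adjoin U v"
    using subspace_add[OF assms]
    by (intro adjoinI[of _ "u + u'" "c + c'"]) (auto simp: algebra_simps)
next
  fix a x assume "x \<in> adjoin U v"
  then obtain u c where "x = u + scale c v" "u \<in> U" by (blast elim: adjoinE)
  then show "scale a x \<in> adjoin U v"
    using subspace_scale[OF assms]
    by (intro adjoinI[of _ "scale a u" "a * c"]) (auto simp: algebra_simps)
qed

lemma adjoin_superset: "U \<subseteq> adjoin U v"
  by (auto intro!: adjoinI[of _ _ 0])

lemma adjoin_self: "0 \<in> U \<Longrightarrow> v \<in> adjoin U v"
  by (auto intro!: adjoinI[of _ 0 1])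

lemma qdim_subset: "qdim I n U \<Longrightarrow> I \<subseteq> U"
  by (induction rule: qdim.induct) (use adjoin_superset in blast)+

lemma qdim_subspace: "qdim I n U \<Longrightarrow> subspace I \<Longrightarrow> subspace U"
  by (induction rule: qdim.induct) (auto intro: subspace_adjoin)

lemma qdim_trans: "qdim J b U \<Longrightarrow> qdim I a J \<Longrightarrow> qdim I (a + b) U"
  by (induction rule: qdim.induct) (auto intro: qdim.intros)

lemma adjoin_exchange:
  assumes U: "subspace U" and w: "w = u0 + scale c0 v" "u0 \<in> U" "w \<notin> U"
  shows "adjoin U v = adjoin U w"
proof -
  have c0: "c0 \<noteq> 0" using w by auto
  show ?thesis
  proof (intro equalityI subsetI; elim adjoinE)
    fix x u c assume "x = u + scale c v" "u \<in> U"
    then show "x \<in> adjoin U w"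
      by (intro adjoinI[of _ "u - scale (c * inverse c0) u0" "c * inverse c0"])
        (use U w c0 in \<open>auto simp: algebra_simps intro!: subspace_diff subspace_scale\<close>)
  next
    fix x u c assume "x = u + scale c w" "u \<in> U"
    then show "x \<in> adjoin U v"
      by (intro adjoinI[of _ "u + scale c u0" "c * c0"])
        (use U w in \<open>auto simp: algebra_simps intro!: subspace_add subspace_scale\<close>)
  qed
qed

text \<open>Adjoin \<open>w\<close> to every member of the chain. The steps stay proper: if
  \<open>v\<close> fell into \<open>adjoin U w\<close>, exchange would put \<open>w\<close> into
  \<open>adjoin U v\<close>.\<close>

lemma qdim_shift:
  assumes "qdim A b B" "subspace A" "w \<notin> B"
  shows "qdim (adjoin A w) b (adjoin B w)"
  using assms
proof (induction arbitrary: w rule: qdim.induct)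
  case qdim_0 then show ?case by (auto intro: qdim.intros)
next
  case (qdim_Suc n U v)
  have U: "subspace U" using qdim_Suc qdim_subspace by blast
  have w: "w \<notin> U" using qdim_Suc.prems(2) adjoin_superset by blast
  have v: "v \<notin> (adjoin U w)"
  proof
    assume "v \<in> adjoin U w"
    then obtain u c where vu: "v = u + scale c w" "u \<in> U" by (blast elim: adjoinE)
    from adjoin_exchange[OF U vu] qdim_Suc.hyps have "w \<in> adjoin U v"
      using adjoin_self[OF subspace_0[OF U], of w] by auto
    with qdim_Suc.prems show False by blast
  qed
  have "adjoin (adjoin U v) w = adjoin (adjoin U w) v"
    (is "?A = ?B")
  proof (intro equalityI subsetI)
    fix x assume "x \<in> ?A"
    then obtain u c d where "x = (u + scale c v) + scale d w" "u \<in> U" by (blast elim: adjoinE)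
    then show "x \<in> ?B"
      by (intro adjoinI[of x "u + scale d w" c] adjoinI[of "u + scale d w" u d]) (auto simp: add_ac)
  next
    fix x assume "x \<in> ?B"
    then obtain u c d where "x = (u + scale c w) + scale d v" "u \<in> U" by (blast elim: adjoinE)
    then show "x \<in> ?A"
      by (intro adjoinI[of x "u + scale d v" c] adjoinI[of "u + scale d v" u d]) (auto simp: add_ac)
  qed
  with qdim.qdim_Suc[OF qdim_Suc.IH[OF qdim_Suc.prems(1) w] v] show ?case by simp
qed

text \<open>Intersect \<open>J\<close> with the members of the chain. At a step from
  \<open>U\<close> to \<open>adjoin U v\<close>, either \<open>J\<close> lies in \<open>U\<close>
  and the step is counted above \<open>J\<close>, or \<open>J\<close> contains some \<open>w\<close>
  outside \<open>U\<close>. Then exchange lets \<open>w\<close> replace \<open>v\<close>, the step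
  is counted below \<open>J\<close>, and \<open>qdim_shift\<close> carries the chain from
  \<open>J \<inter> U\<close> to \<open>U\<close> along with \<open>w\<close>.\<close>

lemma qdim_split:
  assumes "qdim I n U" "subspace I" "subspace J" "I \<subseteq> J" "J \<subseteq> U"
  shows "\<exists>a b. qdim I a J \<and> qdim J b U \<and> a + b = n"
  using assms
proof (induction arbitrary: J rule: qdim.induct)
  case qdim_0 then show ?case by (auto intro: qdim.intros)
next
  case (qdim_Suc n U v)
  have U: "subspace U" using qdim_Suc qdim_subspace by blast
  have JU: "subspace (J \<inter> U)" using qdim_Suc U by (auto intro: subspace_inter)
  have IU: "I \<subseteq> U" using qdim_subset qdim_Suc by blast
  obtain a b where ab: "qdim I a (J \<inter> U)" "qdim (J \<inter> U) b U" "a + b = n"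
    using qdim_Suc.IH[of "J \<inter> U"] qdim_Suc.prems IU JU by blast
  show ?case
  proof (cases "J \<subseteq> U")
    case True
    then have "J \<inter> U = J" by auto
    then have "qdim I a J \<and> qdim J (Suc b) (adjoin U v) \<and> a + Suc b = Suc n"
      using ab qdim.qdim_Suc[OF _ qdim_Suc.hyps(2), of J b] by simp
    then show ?thesis by blast
  next
    case False
    then obtain w where w: "w \<in> J" "w \<notin> U" by (blast elim: adjoinE)
    obtain u0 c0 where w0: "w = u0 + scale c0 v" "u0 \<in> U" using w qdim_Suc.prems(4) by (blast elim: adjoinE)
    note eq = adjoin_exchange[OF U w0 w(2)]
    have J: "J = adjoin (J \<inter> U) w"
    proof (intro equalityI subsetI)
      fix x assume x: "x \<in> J"
      then obtain u c where "x = u + scale c w" "u \<in> U" using qdim_Suc.prems(4) eq by (blast elim: adjoinE)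
      moreover from this have "u \<in> J"
        using x w subspace_diff[OF qdim_Suc.prems(2) x subspace_scale[OF qdim_Suc.prems(2) w(1), of c]]
        by auto
      ultimately show "x \<in> adjoin (J \<inter> U) w" by (auto intro!: adjoinI)
    qed (use w qdim_Suc.prems in \<open>auto elim!: adjoinE intro!: subspace_add subspace_scale\<close>)
    have "qdim I (Suc a) J"
      using qdim.qdim_Suc[OF ab(1), of w] w J by auto
    moreover have "qdim J b (adjoin U v)"
      unfolding eq by (subst J) (use qdim_shift[OF ab(2) JU w(2)] in simp)
    ultimately have "qdim I (Suc a) J \<and> qdim J b (adjoin U v) \<and> Suc a + b = Suc n" using ab(3) by simp
    then show ?thesis by blast
  qed
qed

lemma qdim_refl:
  assumes I: "subspace I" and q: "qdim I n I"
  shows "n = 0"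
  using q
proof cases
  case (qdim_Suc m U v)
  have U: "subspace U" using qdim_subspace[OF qdim_Suc(3) I] .
  have "v \<in> adjoin U v" using adjoin_self[OF subspace_0[OF U]] .
  then have "v \<in> I" using qdim_Suc(2) by simp
  then have "v \<in> U" using qdim_subset[OF qdim_Suc(3)] by blast
  then show ?thesis using qdim_Suc(4) by simp
qed

lemma qdim_refl_iff: "subspace I \<Longrightarrow> qdim I n I \<longleftrightarrow> n = 0"
  using qdim_refl[of I n] qdim_0[of I] by auto

lemma qdim_line:
  assumes I: "subspace I" and v: "v \<notin> I" and q: "qdim I b (adjoin I v)"
  shows "b = 1"
  using q
proof cases
  case qdim_0
  then have "v \<in> I" using adjoin_self[OF subspace_0[OF I], of v] by simp
  then show ?thesis using v by simp
next
  case (qdim_Suc n U w)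
  have U: "subspace U" "I \<subseteq> U" using qdim_subspace[OF qdim_Suc(3) I] qdim_subset[OF qdim_Suc(3)] by auto
  have "U \<subseteq> I"
  proof
    fix x assume x: "x \<in> U"
    show "x \<in> I"
    proof (rule ccontr)
      assume nx: "x \<notin> I"
      have "x \<in> adjoin I v" using x adjoin_superset[of U w] qdim_Suc(2) by blast
      then obtain u c where "x = u + scale c v" "u \<in> I" by (elim adjoinE)
      from adjoin_exchange[OF I this nx] have eq: "adjoin I v = adjoin I x" .
      have "adjoin I v \<subseteq> U"
      proof
        fix z assume "z \<in> adjoin I v"
        then obtain u c where "z = u + scale c x" "u \<in> I" unfolding eq by (elim adjoinE)
        then show "z \<in> U" using x U subspace_add[OF U(1)] subspace_scale[OF U(1)] by blast
      qed
      moreover have "w \<in> adjoin I v"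
        using adjoin_self[OF subspace_0[OF U(1)], of w] qdim_Suc(2) by simp
      ultimately show False using qdim_Suc(4) by blast
    qed
  qed
  then have "U = I" using U by auto
  then have "n = 0" using qdim_Suc(3) qdim_refl[OF I] by blast
  then show ?thesis using qdim_Suc(1) by simp
qed

text \<open>Splitting the second chain at the last but one member of the first leaves a single
  extension by a line, for which \<open>qdim_line\<close> gives length one.\<close>

lemma qdim_unique: "qdim I n U \<Longrightarrow> subspace I \<Longrightarrow> qdim I m U \<Longrightarrow> n = m"
proof (induction arbitrary: m rule: qdim.induct)
  case qdim_0 then show ?case by (simp add: qdim_refl_iff)
next
  case (qdim_Suc n U v)
  have U: "subspace U" "I \<subseteq> U" using qdim_Suc qdim_subspace qdim_subset by blast+
  obtain a b where ab: "qdim I a U" "qdim U b (adjoin U v)" "a + b = m"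
    using qdim_split[OF qdim_Suc.prems(2,1) U(1) U(2) adjoin_superset] by blast
  have "n = a" by (rule qdim_Suc.IH[OF qdim_Suc.prems(1) ab(1)])
  moreover have "b = 1" by (rule qdim_line[OF U(1) qdim_Suc.hyps(2) ab(2)])
  ultimately show ?case using ab(3) by simp
qed

definition rdim :: "'b set \<Rightarrow> 'b set \<Rightarrow> enat" where
  "rdim I U = (if \<exists>n. qdim I n U then enat (THE n. qdim I n U) else \<infinity>)"

lemma rdim_eq_enat:
  assumes I: "subspace I"
  shows "rdim I U = enat n \<longleftrightarrow> qdim I n U"
proof (cases "\<exists>k. qdim I k U")
  case True
  then obtain k where k: "qdim I k U" by blast
  have "(THE m. qdim I m U) = k"
  proof (rule the_equality)
    show "m = k" if "qdim I m U" for m using qdim_unique[OF that I k] .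
  qed (rule k)
  then have "rdim I U = enat k" using True by (simp add: rdim_def)
  then have "rdim I U = enat n \<longleftrightarrow> k = n" by simp
  also have "\<dots> \<longleftrightarrow> qdim I n U"
    using k qdim_unique[OF k I, of n] by blast
  finally show ?thesis .
next
  case False
  then show ?thesis unfolding rdim_def by simp
qed

lemma rdim_refl [simp]: "subspace I \<Longrightarrow> rdim I I = 0"
  by (simp add: rdim_eq_enat zero_enat_def qdim_refl_iff)

lemma rdim_add:
  assumes "subspace I" "subspace J" "I \<subseteq> J" "J \<subseteq> U"
  shows "rdim I U = rdim I J + rdim J U"
proof (cases "rdim I U")
  case (enat n)
  then obtain a b where "qdim I a J" "qdim J b U" "a + b = n"
    using assms qdim_split[of I n U J] by (fastforce simp: rdim_eq_enat)
  then have "rdim I J = enat a" "rdim J U = enat b" using assms by (simp_all add: rdim_eq_enat)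
  then show ?thesis using enat \<open>a + b = n\<close> by simp
next
  case infinity
  show ?thesis
  proof (rule ccontr)
    assume "rdim I U \<noteq> rdim I J + rdim J U"
    then obtain a b where "rdim I J = enat a" "rdim J U = enat b" using infinity by (cases "rdim I J"; cases "rdim J U") auto
    then have "qdim I (a + b) U" using assms qdim_trans by (simp add: rdim_eq_enat)
    then have "rdim I U = enat (a + b)" using assms by (simp add: rdim_eq_enat)
    then show False using infinity by simp
  qed
qed

section \<open>Codimension under linear maps\<close>

lemma qdim_image:
  assumes q: "qdim I n V" and T: "Vector_Spaces.linear scale scale T" and I': "subspace I'"
    and I: "I = T -` I'"
  shows "qdim I' n {T u + i | u i. u \<in> V \<and> i \<in> I'}"
  using q
proof (induction rule: qdim.induct)
  interpret T: Vector_Spaces.linear scale scale T by fact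
  {
    case qdim_0
    have "{T u + i | u i. u \<in> I \<and> i \<in> I'} = I'"
    proof (intro equalityI subsetI)
      fix x assume "x \<in> I'"
      moreover have "x = T 0 + x" "0 \<in> I" using I subspace_0[OF I'] by (auto simp: T.zero)
      ultimately show "x \<in> {T u + i | u i. u \<in> I \<and> i \<in> I'}" by blast
    qed (use I in \<open>auto intro: subspace_add[OF I']\<close>)
    then show ?case by (simp add: qdim.qdim_0)
  next
    case (qdim_Suc n U v)
    have IU: "I \<subseteq> U" using qdim_subset qdim_Suc by blast
    have sI: "subspace I" unfolding I using T.subspace_vimage[OF I'] .
    have U: "subspace U" using qdim_subspace[OF qdim_Suc.hyps(1) sI] .
    have "T v \<notin> {T u + i | u i. u \<in> U \<and> i \<in> I'}"
    proof
      assume "T v \<in> {T u + i | u i. u \<in> U \<and> i \<in> I'}"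
      then obtain u i where "T v = T u + i" "u \<in> U" "i \<in> I'" by (blast elim: adjoinE)
      then have "T (v - u) \<in> I'" by (auto simp: T.diff)
      then have "v - u \<in> U" using I IU by auto
      then have "v \<in> U" using subspace_add[OF U \<open>u \<in> U\<close>, of "v - u"] by simp
      with qdim_Suc show False by simp
    qed
    from qdim.qdim_Suc[OF qdim_Suc.IH this]
    have "qdim I' (Suc n) (adjoin {T u + i | u i. u \<in> U \<and> i \<in> I'} (T v))" .
    also have "(adjoin {T u + i | u i. u \<in> U \<and> i \<in> I'} (T v)) =
      {T u + i |u i. u \<in> adjoin U v \<and> i \<in> I'}" (is "?A = ?B")
    proof (intro equalityI subsetI)
      fix x assume "x \<in> ?A"
      then obtain u i c where "x = T u + i + scale c (T v)" "u \<in> U" "i \<in> I'" by (blast elim: adjoinE)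
      then have "x = T (u + scale c v) + i" "u + scale c v \<in> adjoin U v" "i \<in> I'"
        by (auto simp: T.add T.scale add_ac intro: adjoinI)
      then show "x \<in> ?B" by blast
    next
      fix x assume "x \<in> ?B"
      then obtain u i c where "x = T (u + scale c v) + i" "u \<in> U" "i \<in> I'" by (blast elim: adjoinE)
      then have "x = (T u + i) + scale c (T v)" "T u + i \<in> {T u + i | u i. u \<in> U \<and> i \<in> I'}"
        by (auto simp: T.add T.scale add_ac)
      then show "x \<in> ?A" by (rule adjoinI)
    qed
    finally show ?case .
  }
qed

text \<open>The bound on \<open>V'\<close> makes every adjoined vector congruent modulo
  \<open>I'\<close> to some \<open>T w\<close>. By exchange \<open>T w\<close> can be adjoined
  instead, and the preimage then grows by \<open>w\<close>.\<close>

lemma qdim_vimage: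
  assumes q: "qdim I' n V'" and T: "Vector_Spaces.linear scale scale T" and I': "subspace I'"
    and V': "V' \<subseteq> {T u + i | u i. i \<in> I'}"
  shows "qdim (T -` I') n (T -` V')"
  using q V'
proof (induction rule: qdim.induct)
  interpret T: Vector_Spaces.linear scale scale T by fact
  {
    case qdim_0
    show ?case by (rule qdim.qdim_0)
  next
    case (qdim_Suc n U v)
    have U: "subspace U" "I' \<subseteq> U" using qdim_subspace qdim_subset qdim_Suc.hyps I' by blast+
    have "v \<in> adjoin U v" using adjoin_self subspace_0[OF U(1)] by blast
    then obtain w i where w: "v = T w + i" "i \<in> I'" using qdim_Suc.prems by blast
    have v: "T w = - i + scale 1 v" "- i \<in> U" using w U(2) subspace_neg[OF I'] by auto
    have TU: "T w \<notin> U" using qdim_Suc.hyps(2) w U subspace_add[OF U(1)] by blast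
    from adjoin_exchange[OF U(1) v TU]
    have eq: "adjoin U v = adjoin U (T w)" .
    have "T -` (adjoin U (T w)) = adjoin (T -` U) w"
    proof (intro equalityI subsetI)
      fix x assume "x \<in> T -` (adjoin U (T w))"
      then obtain u c where "T x = u + scale c (T w)" "u \<in> U" by (blast elim: adjoinE)
      then show "x \<in> adjoin (T -` U) w"
        by (intro adjoinI[of _ "x - scale c w" c]) (auto simp: T.diff T.scale)
    next
      fix x assume "x \<in> adjoin (T -` U) w"
      then obtain u c where "x = u + scale c w" "T u \<in> U" by (blast elim: adjoinE)
      then show "x \<in> T -` adjoin U (T w)"
        by (intro vimageI2 adjoinI[of _ "T u" c]) (auto simp: T.add T.scale)
    qed
    moreover have "w \<notin> T -` U" using TU by simp
    moreover have "qdim (T -` I') n (T -` U)"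
      using qdim_Suc.IH subset_trans[OF adjoin_superset qdim_Suc.prems] by blast
    ultimately show ?case unfolding eq by (simp add: qdim.qdim_Suc)
  }
qed

text \<open>The isomorphism of \<open>V / T^{-1}(I')\<close> with \<open>(T V + I') / I'\<close>. It
  is applied to multiplication by a germ, to the exchange of coordinates and to the maps
  \<open>h \<mapsto> x^j h(x^N, y)\<close>.\<close>

lemma rdim_transport:
  assumes T: "Vector_Spaces.linear scale scale T" and I': "subspace I'"
  shows "rdim (T -` I') UNIV = rdim I' {T u + i | u i. i \<in> I'}"
proof -
  interpret T: Vector_Spaces.linear scale scale T by fact
  have 1: "qdim I' n {T u + i | u i. i \<in> I'}" if "qdim (T -` I') n UNIV" for n
    using qdim_image[OF that T I' refl] by simp
  have "T -` {T u + i | u i. i \<in> I'} = UNIV" using subspace_0[OF I'] by force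
  then have 2: "qdim (T -` I') n UNIV" if "qdim I' n {T u + i | u i. i \<in> I'}" for n
    using qdim_vimage[OF that T I' order_refl] by simp
  have "qdim I' n {T u + i | u i. i \<in> I'} = qdim (T -` I') n UNIV" for n using 1 2 by blast
  then show ?thesis unfolding rdim_def by simp
qed

end

section \<open>Substitution, differentiation and evaluation of germs\<close>

lemma holo_near0_eventually_has_derivative:
  assumes "holo_near0 f"
  shows "\<forall>\<^sub>F p in nhds 0. (f has_derivative (\<lambda>(h, k). partial_x f p * h + partial_y f p * k)) (at p)"
proof -
  obtain R where R: "R > 0" "sep_holo R f" using holo_near0_imp_sep_holo[OF assms] .
  show ?thesis unfolding eventually_nhds
    by (rule exI[of _ "ball 0 R \<times> ball 0 R"])
       (use R sep_holo_imp_has_derivative[OF R(2)] in \<open>auto simp: open_Times zero_prod_def\<close>)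
qed

lemma partials_eqI:
  assumes D: "(f has_derivative (\<lambda>(h, k). a * h + b * k)) (at p)"
  shows "partial_x f p = a" "partial_y f p = b"
proof -
  obtain x y where p: "p = (x, y)" by (cases p)
  have "((\<lambda>x. f (x, y)) has_derivative (\<lambda>h. a * h)) (at x)"
    by (rule has_derivative_eq_rhs[OF has_derivative_compose[of "\<lambda>x. (x, y)" "\<lambda>h. (h, 0)"]])
       (use D p in \<open>auto intro!: derivative_eq_intros\<close>)
  then show "partial_x f p = a"
    by (simp add: p partial_x_def DERIV_imp_deriv has_field_derivative_def)
  have "((\<lambda>y. f (x, y)) has_derivative (\<lambda>h. b * h)) (at y)"
    by (rule has_derivative_eq_rhs[OF has_derivative_compose[of "\<lambda>y. (x, y)" "\<lambda>h. (0, h)"]])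
       (use D p in \<open>auto intro!: derivative_eq_intros\<close>)
  then show "partial_y f p = b"
    by (simp add: p partial_y_def DERIV_imp_deriv has_field_derivative_def)
qed

lemma holo_near0_imp_isCont: "holo_near0 f \<Longrightarrow> isCont f 0"
  unfolding holo_near0_def by (drule eventually_nhds_x_imp_x) (auto intro: has_derivative_continuous)

lemma holo_near0_imp_tendsto: "holo_near0 f \<Longrightarrow> (f \<longlongrightarrow> f 0) (nhds 0)"
  using holo_near0_imp_isCont tendsto_at_iff_tendsto_nhds by (auto simp: isCont_def)

lemma eventually_nhds_0_Pair:
  assumes "holo_near0 u" "holo_near0 v" "u 0 = 0" "v 0 = 0" "\<forall>\<^sub>F q in nhds 0. P q"
  shows "\<forall>\<^sub>F p in nhds 0. P (u p, v p)"
proof -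
  have "((\<lambda>p. (u p, v p)) \<longlongrightarrow> (u 0, v 0)) (nhds 0)"
    using assms by (intro tendsto_Pair holo_near0_imp_tendsto)
  then have "filterlim (\<lambda>p. (u p, v p)) (nhds 0) (nhds 0)"
    using assms by (simp add: zero_prod_def)
  from eventually_compose_filterlim[OF assms(5) this] show ?thesis .
qed

lemma has_derivative_Pair_compose:
  fixes f u v :: "complex \<times> complex \<Rightarrow> complex"
  assumes "(f has_derivative (\<lambda>(h, k). a * h + b * k)) (at (u p, v p))"
    "(u has_derivative (\<lambda>(h, k). c * h + d * k)) (at p)"
    "(v has_derivative (\<lambda>(h, k). c' * h + d' * k)) (at p)"
  shows "((\<lambda>p. f (u p, v p)) has_derivative
    (\<lambda>(h, k). (a * c + b * c') * h + (a * d + b * d') * k)) (at p)"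
  by (rule has_derivative_eq_rhs[OF has_derivative_compose[of "\<lambda>p. (u p, v p)", OF has_derivative_Pair[OF assms(2,3)] assms(1)]])
     (auto simp: algebra_simps)

lemma holo_near0_compose:
  assumes u: "holo_near0 u" "holo_near0 v" "u 0 = 0" "v 0 = 0" and f: "holo_near0 f"
  shows "holo_near0 (\<lambda>p. f (u p, v p))"
  using eventually_nhds_0_Pair[OF u f[unfolded holo_near0_def]] u(1,2)
  unfolding holo_near0_def
proof eventually_elim
  case (elim p)
  then show ?case using has_derivative_Pair_compose by blast
qed

lemma holo_near0_fst: "holo_near0 fst" and holo_near0_snd: "holo_near0 snd"
proof -
  have "(fst has_derivative (\<lambda>(h, k). 1 * h + 0 * k)) (at p)" for p :: "complex \<times> complex"
    by (rule has_derivative_eq_rhs[OF has_derivative_fst[OF has_derivative_ident]]) auto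
  then show "holo_near0 fst" unfolding holo_near0_def by (intro always_eventually) blast
  have "(snd has_derivative (\<lambda>(h, k). 0 * h + 1 * k)) (at p)" for p :: "complex \<times> complex"
    by (rule has_derivative_eq_rhs[OF has_derivative_snd[OF has_derivative_ident]]) auto
  then show "holo_near0 snd" unfolding holo_near0_def by (intro always_eventually) blast
qed

lemma holo_near0_analytic_compose:
  assumes f: "holo_near0 f" and h: "h analytic_on {f 0}"
  shows "holo_near0 (\<lambda>p. h (f p))"
proof -
  obtain e where e: "e > 0" "h holomorphic_on ball (f 0) e" using h by (auto simp: analytic_on_def)
  have "\<forall>\<^sub>F p in nhds 0. f p \<in> ball (f 0) e"
    using holo_near0_imp_tendsto[OF f] e by (intro topological_tendstoD) auto
  then show ?thesis using f unfolding holo_near0_def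
  proof eventually_elim
    case (elim p)
    then obtain a b where ab: "(f has_derivative (\<lambda>(h, k). a * h + b * k)) (at p)" by blast
    have "(h has_field_derivative deriv h (f p)) (at (f p))"
      using holomorphic_derivI[OF e(2) open_ball elim(1)] .
    then have "(h has_derivative (\<lambda>x. deriv h (f p) * x)) (at (f p))"
      by (simp add: has_field_derivative_def)
    from has_derivative_compose[OF ab this]
    have "((\<lambda>p. h (f p)) has_derivative (\<lambda>(x, k). (deriv h (f p) * a) * x + (deriv h (f p) * b) * k)) (at p)"
      by (rule has_derivative_eq_rhs) (auto simp: algebra_simps)
    then show ?case by blast
  qed
qed

text \<open>The germ of \<open>f(u, v)\<close>. The composite is determined by the germs only if
  \<open>u\<close> and \<open>v\<close> vanish at the origin, whence the default 0 otherwise; the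
  calculation rules therefore assume \<open>germ_at0 u = 0\<close> and
  \<open>germ_at0 v = 0\<close>.\<close>

lift_definition gsubst :: "germ \<Rightarrow> germ \<Rightarrow> germ \<Rightarrow> germ" is
  "\<lambda>u v f p. if u 0 = 0 \<and> v 0 = 0 then f (u p, v p) else 0"
proof -
  fix u u' v v' f f' assume *: "germ_eq u u'" "germ_eq v v'" "germ_eq f f'"
  then have 0: "u 0 = u' 0" "v 0 = v' 0" by (auto simp: germ_eq_def dest: eventually_nhds_x_imp_x)
  show "germ_eq (\<lambda>p. if u 0 = 0 \<and> v 0 = 0 then f (u p, v p) else 0)
                (\<lambda>p. if u' 0 = 0 \<and> v' 0 = 0 then f' (u' p, v' p) else 0)"
  proof (cases "u 0 = 0 \<and> v 0 = 0")
    case True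
    then have "\<forall>\<^sub>F p in nhds 0. f (u p, v p) = f' (u p, v p)"
      using * by (intro eventually_nhds_0_Pair) (auto simp: germ_eq_def)
    moreover have "\<forall>\<^sub>F p in nhds 0. u p = u' p" "\<forall>\<^sub>F p in nhds 0. v p = v' p"
      using * by (auto simp: germ_eq_def)
    ultimately have "\<forall>\<^sub>F p in nhds 0. f (u p, v p) = f' (u' p, v' p)"
      by eventually_elim simp
    then show ?thesis using True * 0 by (auto simp: germ_eq_def intro: holo_near0_compose)
  qed (use 0 in \<open>auto simp: germ_eq_def\<close>)
qed

lift_definition germ_X :: germ is fst by (simp add: germ_eq_def holo_near0_fst)
lift_definition germ_Y :: germ is snd by (simp add: germ_eq_def holo_near0_snd)

lemma germ_at0_simps [simp]:
  "germ_at0 0 = 0" "germ_at0 1 = 1" "germ_at0 germ_X = 0" "germ_at0 germ_Y = 0"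
  "germ_at0 (f + g) = germ_at0 f + germ_at0 g" "germ_at0 (f - g) = germ_at0 f - germ_at0 g"
  "germ_at0 (f * g) = germ_at0 f * germ_at0 g" "germ_at0 (- f) = - germ_at0 f"
  "germ_at0 (germ_const c) = c"
  by (transfer; simp)+

lemma germ_at0_power [simp]: "germ_at0 (f ^ n) = germ_at0 f ^ n"
  by (induction n) auto

lemma germ_at0_subst [simp]:
  "germ_at0 u = 0 \<Longrightarrow> germ_at0 v = 0 \<Longrightarrow> germ_at0 (gsubst u v f) = germ_at0 f"
  by transfer (simp add: zero_prod_def)

lemma germ_const_simps:
  "germ_const 0 = 0" "germ_const 1 = 1"
  "germ_const (a + b) = germ_const a + germ_const b"
  "germ_const (a - b) = germ_const a - germ_const b"
  "germ_const (a * b) = germ_const a * germ_const b"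
  "germ_const (- a) = - germ_const a"
  by (transfer; simp add: germ_eq_def)+

lemma germ_const_power: "germ_const (a ^ n) = germ_const a ^ n"
  by (induction n) (auto simp: germ_const_simps)

lemma germ_const_of_nat: "germ_const (of_nat n) = of_nat n"
  by (induction n) (auto simp: germ_const_simps)

context
  fixes u v assumes uv: "germ_at0 u = 0" "germ_at0 v = 0"
begin

lemma gsubst_zero: "gsubst u v 0 = 0"
  and gsubst_one: "gsubst u v 1 = 1"
  and gsubst_const: "gsubst u v (germ_const c) = germ_const c"
  and gsubst_X: "gsubst u v germ_X = u"
  and gsubst_Y: "gsubst u v germ_Y = v"
  and gsubst_add: "gsubst u v (f + g) = gsubst u v f + gsubst u v g"
  and gsubst_diff: "gsubst u v (f - g) = gsubst u v f - gsubst u v g"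
  and gsubst_uminus: "gsubst u v (- f) = - gsubst u v f"
  and gsubst_mult: "gsubst u v (f * g) = gsubst u v f * gsubst u v g"
  using uv
  by (transfer; auto simp: germ_eq_def intro!: holo_near0_compose holo_near0_add holo_near0_mult
       holo_near0_uminus holo_near0_diff)+

lemma gsubst_power: "gsubst u v (f ^ n) = gsubst u v f ^ n"
  by (induction n) (auto simp: gsubst_one gsubst_mult)

lemma gsubst_sum: "gsubst u v (sum f A) = (\<Sum>i\<in>A. gsubst u v (f i))"
  by (induction A rule: infinite_finite_induct) (auto simp: gsubst_zero gsubst_add)

lemma gsubst_prod: "gsubst u v (prod f A) = (\<Prod>i\<in>A. gsubst u v (f i))"
  by (induction A rule: infinite_finite_induct) (auto simp: gsubst_one gsubst_mult)

lemma gsubst_subst: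
  assumes "germ_at0 a = 0" "germ_at0 b = 0"
  shows "gsubst u v (gsubst a b f) = gsubst (gsubst u v a) (gsubst u v b) f"
  using uv assms
  by transfer (auto simp: germ_eq_def zero_prod_def[symmetric] intro!: holo_near0_compose)

lemmas gsubst_simps = gsubst_zero gsubst_one gsubst_const gsubst_X gsubst_Y
  gsubst_add gsubst_diff gsubst_uminus gsubst_mult gsubst_power gsubst_subst

end

lemma gsubst_id [simp]: "gsubst germ_X germ_Y f = f"
  by transfer (auto simp: germ_eq_def)

section \<open>Partial derivatives of germs and the chain rule\<close>

lemma germ_dx_eqI:
  assumes "germ_eq f f" "holo_near0 a" "holo_near0 b"
   "\<forall>\<^sub>F p in nhds 0. (f has_derivative (\<lambda>(h, k). a p * h + b p * k)) (at p)"
  shows "germ_eq (partial_x f) a" "germ_eq (partial_y f) b"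
proof -
  have "\<forall>\<^sub>F p in nhds 0. partial_x f p = a p" "\<forall>\<^sub>F p in nhds 0. partial_y f p = b p"
    using assms(4) by (auto elim!: eventually_mono dest: partials_eqI)
  then show "germ_eq (partial_x f) a" "germ_eq (partial_y f) b"
    using assms by (auto simp: germ_eq_def intro: holo_near0_partial_x holo_near0_partial_y)
qed

lemma germ_dx_const: "germ_dx (germ_const c) = 0" and germ_dy_const: "germ_dy (germ_const c) = 0"
proof -
  have *: "\<forall>\<^sub>F p in nhds 0. ((\<lambda>p. c :: complex) has_derivative (\<lambda>(h, k). 0 * h + 0 * k)) (at (p :: complex \<times> complex))" for c
    by (intro always_eventually allI has_derivative_eq_rhs[OF has_derivative_const]) auto
  show "germ_dx (germ_const c) = 0"
    by transfer (rule germ_dx_eqI(1)[OF _ _ _ *], auto simp: germ_eq_def )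
  show "germ_dy (germ_const c) = 0"
    by transfer (rule germ_dx_eqI(2)[OF _ _ _ *], auto simp: germ_eq_def )
qed

lemma germ_dx_X: "germ_dx germ_X = 1" and germ_dy_X: "germ_dy germ_X = 0"
proof -
  have *: "\<forall>\<^sub>F p in nhds 0. (fst has_derivative (\<lambda>(h, k). 1 * h + 0 * k)) (at (p :: complex \<times> complex))"
    by (intro always_eventually allI has_derivative_eq_rhs[OF has_derivative_fst[OF has_derivative_ident]]) auto
  show "germ_dx germ_X = 1"
    by transfer (rule germ_dx_eqI(1)[OF _ _ _ *], auto simp: germ_eq_def holo_near0_fst)
  show "germ_dy germ_X = 0"
    by transfer (rule germ_dx_eqI(2)[OF _ _ _ *], auto simp: germ_eq_def holo_near0_fst)
qed

lemma germ_dx_Y: "germ_dx germ_Y = 0" and germ_dy_Y: "germ_dy germ_Y = 1"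
proof -
  have *: "\<forall>\<^sub>F p in nhds 0. (snd has_derivative (\<lambda>(h, k). 0 * h + 1 * k)) (at (p :: complex \<times> complex))"
    by (intro always_eventually allI has_derivative_eq_rhs[OF has_derivative_snd[OF has_derivative_ident]]) auto
  show "germ_dx germ_Y = 0"
    by transfer (rule germ_dx_eqI(1)[OF _ _ _ *], auto simp: germ_eq_def holo_near0_snd)
  show "germ_dy germ_Y = 1"
    by transfer (rule germ_dx_eqI(2)[OF _ _ _ *], auto simp: germ_eq_def holo_near0_snd)
qed

lemma germ_dx_add: "germ_dx (f + g) = germ_dx f + germ_dx g"
  and germ_dy_add: "germ_dy (f + g) = germ_dy f + germ_dy g"
proof -
  have *: "((\<lambda>p. f p + g p) has_derivative (\<lambda>(h, k). (a + c) * h + (b + d) * k)) (at p)"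
    if "(f has_derivative (\<lambda>(h, k). a * h + b * k)) (at p)"
       "(g has_derivative (\<lambda>(h, k). c * h + d * k)) (at p)"
      for f g :: "complex \<times> complex \<Rightarrow> complex" and a b c d p
    by (rule has_derivative_eq_rhs[OF has_derivative_add[OF that]])
       (auto simp: fun_eq_iff algebra_simps)
  have **: "\<forall>\<^sub>F p in nhds 0. ((\<lambda>p. f p + g p) has_derivative (\<lambda>(h, k). (partial_x f p + partial_x g p) * h +
        (partial_y f p + partial_y g p) * k)) (at p)" if "germ_eq f f" "germ_eq g g" for f g
    using holo_near0_eventually_has_derivative[of f] holo_near0_eventually_has_derivative[of g] that
    unfolding germ_eq_def by (auto elim: eventually_elim2 intro: *)
  show "germ_dx (f + g) = germ_dx f + germ_dx g" "germ_dy (f + g) = germ_dy f + germ_dy g"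
    by (transfer; rule germ_dx_eqI[OF _ _ _ **];
       auto simp: germ_eq_def intro!: holo_near0_add holo_near0_partial_x holo_near0_partial_y)+
qed

lemma germ_dx_mult: "germ_dx (f * g) = f * germ_dx g + germ_dx f * g"
  and germ_dy_mult: "germ_dy (f * g) = f * germ_dy g + germ_dy f * g"
proof -
  have *: "((\<lambda>p. f p * g p) has_derivative (\<lambda>(h, k). (f p * c + a * g p) * h + (f p * d + b * g p) * k)) (at p)"
    if "(f has_derivative (\<lambda>(h, k). a * h + b * k)) (at p)"
       "(g has_derivative (\<lambda>(h, k). c * h + d * k)) (at p)"
      for f g :: "complex \<times> complex \<Rightarrow> complex" and a b c d p
    by (rule has_derivative_eq_rhs[OF has_derivative_mult[OF that]])
       (auto simp: fun_eq_iff algebra_simps)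
  have **: "\<forall>\<^sub>F p in nhds 0. ((\<lambda>p. f p * g p) has_derivative
        (\<lambda>(h, k). (f p * partial_x g p + partial_x f p * g p) * h +
        (f p * partial_y g p + partial_y f p * g p) * k)) (at p)" if "germ_eq f f" "germ_eq g g" for f g
    using holo_near0_eventually_has_derivative[of f] holo_near0_eventually_has_derivative[of g] that
    unfolding germ_eq_def by (auto elim: eventually_elim2 intro: *)
  show "germ_dx (f * g) = f * germ_dx g + germ_dx f * g" "germ_dy (f * g) = f * germ_dy g + germ_dy f * g"
    by (transfer; rule germ_dx_eqI[OF _ _ _ **];
       auto simp: germ_eq_def intro!: holo_near0_add holo_near0_mult holo_near0_partial_x holo_near0_partial_y)+
qed

lemma germ_dx_subst:
  assumes uv: "germ_at0 u = 0" "germ_at0 v = 0"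
  shows "germ_dx (gsubst u v f) = gsubst u v (germ_dx f) * germ_dx u + gsubst u v (germ_dy f) * germ_dx v"
    and "germ_dy (gsubst u v f) = gsubst u v (germ_dx f) * germ_dy u + gsubst u v (germ_dy f) * germ_dy v"
proof -
  have **: "\<forall>\<^sub>F p in nhds 0. ((\<lambda>p. f (u p, v p)) has_derivative
        (\<lambda>(h, k). (partial_x f (u p, v p) * partial_x u p + partial_y f (u p, v p) * partial_x v p) * h +
        (partial_x f (u p, v p) * partial_y u p + partial_y f (u p, v p) * partial_y v p) * k)) (at p)"
    if "germ_eq f f" "germ_eq u u" "germ_eq v v" "u 0 = 0" "v 0 = 0" for f u v
  proof -
    have h: "holo_near0 f" "holo_near0 u" "holo_near0 v" using that by (auto simp: germ_eq_def)
    show ?thesis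
      using eventually_nhds_0_Pair[OF h(2,3) that(4,5) holo_near0_eventually_has_derivative[OF h(1)]]
        holo_near0_eventually_has_derivative[OF h(2)] holo_near0_eventually_has_derivative[OF h(3)]
      by eventually_elim (rule has_derivative_Pair_compose)
  qed
  show "germ_dx (gsubst u v f) = gsubst u v (germ_dx f) * germ_dx u + gsubst u v (germ_dy f) * germ_dx v"
    "germ_dy (gsubst u v f) = gsubst u v (germ_dx f) * germ_dy u + gsubst u v (germ_dy f) * germ_dy v"
    using uv
    by (transfer; simp; intro germ_dx_eqI[OF _ _ _ **];
       auto simp: germ_eq_def intro!: holo_near0_add holo_near0_mult holo_near0_compose holo_near0_partial_x holo_near0_partial_y)+
qed

lemma germ_dx_zero [simp]: "germ_dx 0 = 0" and germ_dy_zero [simp]: "germ_dy 0 = 0"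
  using germ_dx_const[of 0] germ_dy_const[of 0] by (simp_all add: germ_const_simps)

lemma germ_dx_power: "germ_dx (f ^ Suc n) = of_nat (Suc n) * f ^ n * germ_dx f"
  and germ_dy_power: "germ_dy (f ^ Suc n) = of_nat (Suc n) * f ^ n * germ_dy f"
  by (induction n) (auto simp: germ_dx_mult germ_dy_mult algebra_simps)

lemma germ_unit_iff: "f dvd 1 \<longleftrightarrow> germ_at0 f \<noteq> 0"
proof
  assume "f dvd 1" then obtain g where "1 = f * g" by (auto simp: dvd_def)
  then have "germ_at0 f * germ_at0 g = 1" by (metis germ_at0_simps(2,7))
  then show "germ_at0 f \<noteq> 0" by auto
next
  assume f: "germ_at0 f \<noteq> 0"
  have "\<exists>g. f * g = 1" using f
  proof transfer
    fix f assume f: "germ_eq f f" "f 0 \<noteq> 0"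
    then have h: "holo_near0 f" by (simp add: germ_eq_def)
    have "holo_near0 (\<lambda>p. inverse (f p))"
      by (rule holo_near0_analytic_compose[OF h]) (use f in \<open>auto intro!: analytic_intros\<close>)
    moreover have "\<forall>\<^sub>F p in nhds 0. f p \<noteq> 0"
      using holo_near0_imp_tendsto[OF h] f by (metis t1_space_nhds tendsto_imp_eventually_ne)
    ultimately show "\<exists>g\<in>{x. germ_eq x x}. germ_eq (\<lambda>p. f p * g p) (\<lambda>_. 1)"
      using h by (intro bexI[of _ "\<lambda>p. inverse (f p)"])
        (auto simp: germ_eq_def holo_near0_mult elim!: eventually_mono)
  qed
  then show "f dvd 1" by (metis dvd_def)
qed

subsection \<open>Representatives\<close>

text \<open>The transfer relation \<open>pcr_germ\<close> in explicit form. It serves to read off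
  identities of germs from concrete functions, in particular from functions that come out of an
  existence theorem or from \<open>rep_germ\<close>.\<close>

definition represents :: "(complex \<times> complex \<Rightarrow> complex) \<Rightarrow> germ \<Rightarrow> bool" where
  "represents F f \<longleftrightarrow> holo_near0 F \<and> abs_germ F = f"

lemma represents_eq_cr: "represents = pcr_germ"
  unfolding germ.pcr_cr_eq by (auto simp: represents_def cr_germ_def germ_eq_def fun_eq_iff)

lemma represents_rep_germ: "represents (rep_germ f) f"
  using Quotient_rep_reflp[OF Quotient_germ, of f] Quotient_abs_rep[OF Quotient_germ, of f]
  by (auto simp: represents_def germ_eq_def)

lemma represents_holo: "represents F f \<Longrightarrow> holo_near0 F"
  by (simp add: represents_def)

lemma represents_abs_germ: "holo_near0 F \<Longrightarrow> represents F (abs_germ F)"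
  by (simp add: represents_def)

lemma represents_eq_iff:
  assumes "represents F f" "represents G g"
  shows "f = g \<longleftrightarrow> (\<forall>\<^sub>F p in nhds 0. F p = G p)"
  using assms Quotient_rel[OF Quotient_germ, of F G]
  by (auto simp: represents_def germ_eq_def)

lemma represents_at0: "represents F f \<Longrightarrow> germ_at0 f = F 0"
  using rel_funD[OF germ_at0.transfer, of F f] by (simp add: represents_eq_cr)

lemma represents_intros:
  "represents (\<lambda>_. 0) 0" "represents (\<lambda>_. 1) 1" "represents (\<lambda>_. c) (germ_const c)"
  "represents fst germ_X" "represents snd germ_Y"
  "represents F f \<Longrightarrow> represents G g \<Longrightarrow> represents (\<lambda>p. F p + G p) (f + g)"
  "represents F f \<Longrightarrow> represents G g \<Longrightarrow> represents (\<lambda>p. F p - G p) (f - g)"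
  "represents F f \<Longrightarrow> represents G g \<Longrightarrow> represents (\<lambda>p. F p * G p) (f * g)"
  "represents F f \<Longrightarrow> represents (\<lambda>p. - F p) (- f)"
  "represents F f \<Longrightarrow> represents (partial_x F) (germ_dx f)"
  "represents F f \<Longrightarrow> represents (partial_y F) (germ_dy f)"
  unfolding represents_eq_cr
  by (assumption | rule refl zero_germ.transfer one_germ.transfer rel_funD[OF germ_const.transfer]
    germ_X.transfer germ_Y.transfer rel_funD[OF rel_funD[OF plus_germ.transfer]]
    rel_funD[OF rel_funD[OF minus_germ.transfer]] rel_funD[OF rel_funD[OF times_germ.transfer]]
    rel_funD[OF uminus_germ.transfer] rel_funD[OF germ_dx.transfer] rel_funD[OF germ_dy.transfer])+

lemma represents_subst:
  assumes "represents U u" "represents V v" "represents F f" "U 0 = 0" "V 0 = 0"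
  shows "represents (\<lambda>p. F (U p, V p)) (gsubst u v f)"
  using rel_funD[OF rel_funD[OF rel_funD[OF gsubst.transfer]], of U u V v F f] assms
  by (simp add: represents_eq_cr)

lemma represents_power: "represents F f \<Longrightarrow> represents (\<lambda>p. F p ^ n) (f ^ n)"
  by (induction n) (auto intro: represents_intros)

lemma represents_sum:
  "(\<And>i. i \<in> A \<Longrightarrow> represents (F i) (f i)) \<Longrightarrow> represents (\<lambda>p. \<Sum>i\<in>A. F i p) (\<Sum>i\<in>A. f i)"
  by (induction A rule: infinite_finite_induct) (auto intro: represents_intros)

lemma represents_eqI:
  "represents F f \<Longrightarrow> represents G g \<Longrightarrow> (\<forall>\<^sub>F p in nhds 0. F p = G p) \<Longrightarrow> f = g"
  by (simp add: represents_eq_iff)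

lemma represents_analytic: "h analytic_on {0} \<Longrightarrow> represents (\<lambda>p. h (fst p)) (abs_germ (\<lambda>p. h (fst p)))"
  by (rule represents_abs_germ, rule holo_near0_analytic_compose[OF holo_near0_fst]) simp

subsection \<open>The implicit function theorem\<close>

text \<open>Invert \<open>G(x, y) = (x, f(x, y))\<close> by the real inverse function theorem and
  take for \<open>c(x)\<close> the second coordinate of the inverse at \<open>(x, 0)\<close>. Its
  real derivative turns out to be multiplication by the complex number \<open>- f_x / f_y\<close>,
  which is holomorphy.\<close>

lemma implicit_function:
  assumes f: "sep_holo R f" "R > 0" and f0: "f 0 = 0" and fy: "partial_y f 0 \<noteq> 0"
  obtains c where "c analytic_on {0}" "c 0 = 0" "\<forall>\<^sub>F x in nhds 0. f (x, c x) = 0"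
proof -
  define U where "U = ball (0::complex) R \<times> ball (0::complex) R"
  define G where "G = (\<lambda>p. (fst p, f p))"
  define G' where "G' p = Blinfun (\<lambda>q. (fst q, partial_x f p * fst q + partial_y f p * snd q))" for p
  have G'_apply: "blinfun_apply (G' p) q = (fst q, partial_x f p * fst q + partial_y f p * snd q)" for p q
    unfolding G'_def
    by (subst bounded_linear_Blinfun_apply) (intro bounded_linear_Pair bounded_linear_fst bounded_linear_add bounded_linear_const_mult
         bounded_linear_snd, rule refl)
  have U: "open U" "(0, 0) \<in> U" using f by (auto simp: U_def intro: open_Times)
  have der: "(G has_derivative blinfun_apply (G' p)) (at p)" if "p \<in> U" for p
    unfolding G_def
    by (rule has_derivative_eq_rhs[OF has_derivative_Pair[OF has_derivative_fst[OF has_derivative_ident]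
        sep_holo_imp_has_derivative[OF f(1)]]]) (use that in \<open>auto simp: U_def G'_apply fun_eq_iff\<close>)
  have cont: "continuous_on U G'"
    by (rule continuous_on_blinfun_componentwise, unfold G'_apply U_def)
       (intro continuous_intros continuous_partial_x[OF f(1)] continuous_partial_y[OF f(1)])
  define d where "d = partial_y f 0"
  define iT where "iT = Blinfun (\<lambda>q. (fst q, inverse d * (snd q - partial_x f 0 * fst q)))"
  have iT_apply: "blinfun_apply iT q = (fst q, inverse d * (snd q - partial_x f 0 * fst q))" for q
    unfolding iT_def
    by (subst bounded_linear_Blinfun_apply)
       (intro bounded_linear_Pair bounded_linear_fst bounded_linear_sub bounded_linear_const_mult
         bounded_linear_snd, rule refl)
  have iT: "iT o\<^sub>L G' (0, 0) = id_blinfun"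
    using fy by (intro blinfun_eqI) (auto simp: iT_apply G'_apply d_def zero_prod_def)
  obtain U' V g g' where g: "open U'" "U' \<subseteq> U" "(0, 0) \<in> U'" "open V" "G (0, 0) \<in> V"
    "homeomorphism U' V G g" "\<And>y. y \<in> V \<Longrightarrow> (g has_derivative (g' y)) (at y)"
    "\<And>y. y \<in> V \<Longrightarrow> g' y = inv_into UNIV (blinfun_apply (G'(g y)))"
    "\<And>y. y \<in> V \<Longrightarrow> bij (blinfun_apply (G'(g y)))"
    using inverse_function_theorem[OF U(1) der cont U(2) iT] by metis
  have G0: "G (0, 0) = (0, 0)" using f0 by (simp add: G_def zero_prod_def)
  define c where "c = (\<lambda>x. snd (g (x, 0)))"
  have gx: "g (x, 0) = (x, c x)" "f (x, c x) = 0" if "(x, 0) \<in> V" for x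
  proof -
    have "G (g (x, 0)) = (x, 0)" using that g(6) by (auto simp: homeomorphism_def)
    then show "g (x, 0) = (x, c x)" "f (x, c x) = 0"
      by (auto simp: G_def c_def prod_eq_iff)
       (metis prod.collapse)
  qed
  have "((\<lambda>x. (x, 0)) \<longlongrightarrow> (0, 0)) (nhds (0 :: complex))"
    by (intro tendsto_intros) (auto simp: filterlim_ident)
  then have ev: "\<forall>\<^sub>F x in nhds 0. (x, 0) \<in> V"
    using g(4,5) G0 topological_tendstoD by fastforce
  then obtain r where r: "r > 0" "\<And>x. x \<in> ball 0 r \<Longrightarrow> (x, 0) \<in> V"
    by (auto simp: eventually_nhds_metric dist_commute)
  have "c holomorphic_on ball 0 r"
  proof (subst holomorphic_on_open, simp, safe)
    fix x :: complex assume "x \<in> ball 0 r"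
    then have x: "(x, 0) \<in> V" by (rule r(2))
    define p where "p = g (x, 0)"
    have b: "bij (blinfun_apply (G' p))" using g(9)[OF x] by (simp add: p_def)
    have y: "partial_y f p \<noteq> 0"
    proof
      assume "partial_y f p = 0"
      then have "blinfun_apply (G' p) (0, 1) = blinfun_apply (G' p) (0, 0)" by (simp add: G'_apply)
      then show False using b by (auto dest!: bij_is_inj injD)
    qed
    have "inv_into UNIV (blinfun_apply (G' p)) (h, 0) = (h, - partial_x f p / partial_y f p * h)" for h
      by (rule inv_f_eq[OF bij_is_inj[OF b]]) (use y in \<open>simp add: G'_apply\<close>)
    then have "snd (g' (x, 0) (h, 0)) = - partial_x f p / partial_y f p * h" for h
      using g(8)[OF x] by (simp add: p_def)
    moreover have "(c has_derivative (\<lambda>h. snd (g' (x, 0) (h, 0)))) (at x)"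
      unfolding c_def
      by (rule has_derivative_eq_rhs[OF has_derivative_snd[OF has_derivative_compose[of "\<lambda>x. (x, 0)" "\<lambda>h. (h, 0)", OF _ g(7)[OF x]]]])
         (auto intro!: derivative_eq_intros)
    ultimately have "(c has_derivative (\<lambda>h. - partial_x f p / partial_y f p * h)) (at x)" by simp
    then show "\<exists>f'. (c has_field_derivative f') (at x)" unfolding has_field_derivative_def by blast
  qed
  then have an: "c analytic_on {0}" using r(1) by (auto simp: analytic_on_def)
  have "g (0, 0) = (0, 0)" using g(3,6) G0 by (metis homeomorphism_apply1)
  then have "c 0 = 0" by (simp add: c_def)
  moreover have "\<forall>\<^sub>F x in nhds 0. f (x, c x) = 0" using ev by eventually_elim (rule gx)
  ultimately show ?thesis using an that by blast
qed

lemma nhds_0_prod: "nhds (0 :: complex \<times> complex) = nhds 0 \<times>\<^sub>F nhds 0"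
  by (simp add: zero_prod_def nhds_prod)

lemma eventually_nhds_0_fst: "\<forall>\<^sub>F x in nhds (0 :: complex). P x \<Longrightarrow> \<forall>\<^sub>F p in nhds (0 :: complex \<times> complex). P (fst p)"
  unfolding nhds_0_prod by (auto simp: case_prod_unfold eventually_prod_filter)

text \<open>Germs in \<open>x\<close> alone are kept inside the ring of germs in two variables, as
  those unchanged by setting \<open>y = 0\<close>. Thus \<open>gsubst\<close> also serves as
  composition in one variable, and \<open>y - \<alpha>(x)\<close> needs no embedding of
  rings.\<close>

definition univariate :: "germ \<Rightarrow> bool" where
  "univariate h \<longleftrightarrow> gsubst germ_X 0 h = h"

lemma univariate_abs_germ:
  assumes "h analytic_on {0}"
  shows "univariate (abs_germ (\<lambda>p. h (fst p)))"
  unfolding univariate_def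
  by (rule represents_eqI[OF represents_subst[OF represents_intros(4,1) represents_analytic[OF assms]] represents_analytic[OF assms]])
     auto

lemma germ_implicit:
  assumes "germ_at0 f = 0" "germ_at0 (germ_dy f) \<noteq> 0"
  shows "\<exists>c. univariate c \<and> germ_at0 c = 0 \<and> gsubst germ_X c f = 0"
proof -
  define F where "F = rep_germ f"
  have F: "represents F f" unfolding F_def by (rule represents_rep_germ)
  obtain R where R: "R > 0" "sep_holo R F" using holo_near0_imp_sep_holo[OF represents_holo[OF F]] .
  have "F 0 = 0" using represents_at0[OF F] assms by simp
  moreover have "partial_y F 0 \<noteq> 0" using represents_at0[OF represents_intros(11)[OF F]] assms by simp
  ultimately obtain c where c: "c analytic_on {0}" "c 0 = 0" "\<forall>\<^sub>F x in nhds 0. F (x, c x) = 0"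
    using implicit_function[OF R(2,1)] by blast
  let ?c = "abs_germ (\<lambda>p. c (fst p))"
  have "germ_at0 ?c = 0" using represents_at0[OF represents_analytic[OF c(1)]] c by simp
  moreover have "gsubst germ_X ?c f = 0"
    by (rule represents_eqI[OF represents_subst[OF represents_intros(4) represents_analytic[OF c(1)] F] represents_intros(1)])
       (use c in \<open>auto intro: eventually_nhds_0_fst\<close>)
  ultimately show ?thesis using univariate_abs_germ[OF c(1)] by blast
qed

subsection \<open>Power series in the first variable\<close>

lemma sep_holo_higher_partial_x:
  assumes "sep_holo R f"
  shows "0 < r \<Longrightarrow> r < R \<Longrightarrow> sep_holo r ((partial_x ^^ n) f)"
proof (induction n arbitrary: r)
  case 0 then show ?case using sep_holo_mono[OF assms] by simp
next
  case (Suc n)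
  obtain s where "r < s" "s < R" using Suc.prems dense by blast
  then show ?case using Suc.IH[of s] Suc.prems sep_holo_partial_x[of s _ r] by simp
qed

lemma higher_partial_x: "(partial_x ^^ n) f (x, y) = (deriv ^^ n) (\<lambda>s. f (s, y)) x"
proof (induction n arbitrary: x)
  case (Suc n)
  have "(\<lambda>s. (partial_x ^^ n) f (s, y)) = (deriv ^^ n) (\<lambda>s. f (s, y))" using Suc.IH by auto
  then show ?case by (simp add: partial_x_def[of "(partial_x ^^ n) f"])
qed simp

text \<open>Cauchy estimates on a closed bidisc bound the coefficients of the powers of
  \<open>x\<close> uniformly in \<open>y\<close>. The radius is kept at most 1 so that
  \<open>1 / r\<close> is at least 1, as \<open>reindexed_series\<close> requires.\<close>

lemma holo_near0_expansion:
  assumes "holo_near0 f"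
  obtains r B a where "0 < r" "r \<le> (1::real)" "B \<ge> (0::real)" "\<And>n::nat. a n holomorphic_on ball 0 r"
    "\<And>n y. y \<in> ball 0 r \<Longrightarrow> norm (a n y) \<le> B * (1 / r) ^ n"
    "\<And>x y. x \<in> ball 0 r \<Longrightarrow> y \<in> ball 0 r \<Longrightarrow> (\<lambda>n. a n y * x ^ n) sums f (x, y)"
proof -
  obtain R where R: "R > 0" "sep_holo R f" using holo_near0_imp_sep_holo[OF assms] .
  define r where "r = min 1 (R / 2)"
  have r: "0 < r" "r \<le> 1" "r < R" using R by (auto simp: r_def)
  define a where "a = (\<lambda>n y. (partial_x ^^ n) f (0, y) / fact n)"
  have cf: "continuous_on (ball 0 R \<times> ball 0 R) f" using R(2) by (auto simp: sep_holo_def)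
  have "compact (cball (0::complex) r \<times> cball (0::complex) r)" by (intro compact_Times) auto
  moreover have "continuous_on (cball 0 r \<times> cball 0 r) f"
    by (rule continuous_on_subset[OF cf]) (use r in auto)
  ultimately have "bounded (f ` (cball 0 r \<times> cball 0 r))"
    by (intro compact_imp_bounded compact_continuous_image)
  then obtain B where B: "B > 0" "\<And>p. p \<in> cball 0 r \<times> cball 0 r \<Longrightarrow> norm (f p) \<le> B"
    unfolding bounded_pos by blast
  have hol: "(\<lambda>s. f (s, y)) holomorphic_on ball 0 R" if "y \<in> ball 0 r" for y
    using R(2) that r by (auto simp: sep_holo_def)
  show ?thesis
  proof (rule that[of r B a])
    fix n
    have "sep_holo r ((partial_x ^^ n) f)" by (rule sep_holo_higher_partial_x[OF R(2) r(1,3)])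
    then show "a n holomorphic_on ball 0 r" unfolding a_def
      using r by (intro holomorphic_intros) (auto simp: sep_holo_def)
    fix y :: complex assume y: "y \<in> ball 0 r"
    have "norm ((deriv ^^ n) (\<lambda>s. f (s, y)) 0) \<le> fact n * B / r ^ n"
    proof (rule Cauchy_inequality)
      show "(\<lambda>s. f (s, y)) holomorphic_on ball 0 r"
        by (rule holomorphic_on_subset[OF hol[OF y]]) (use r in auto)
      show "continuous_on (cball 0 r) (\<lambda>s. f (s, y))"
        by (rule holomorphic_on_imp_continuous_on, rule holomorphic_on_subset[OF hol[OF y]]) (use r in auto)
    qed (use r y in \<open>auto intro!: B\<close>)
    then show "norm (a n y) \<le> B * (1 / r) ^ n"
      using r by (simp add: a_def higher_partial_x norm_divide field_simps)
  next
    fix x y :: complex assume xy: "x \<in> ball 0 r" "y \<in> ball 0 r"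
    have "(\<lambda>n. (deriv ^^ n) (\<lambda>s. f (s, y)) 0 / fact n * (x - 0) ^ n) sums f (x, y)"
      by (rule holomorphic_power_series[OF hol[OF xy(2)]]) (use xy r in auto)
    then show "(\<lambda>n. a n y * x ^ n) sums f (x, y)" by (simp add: a_def higher_partial_x)
  qed (use r B in auto)
qed

lemma power_series_holo_near0:
  fixes a :: "nat \<Rightarrow> complex \<Rightarrow> complex"
  assumes r: "0 < r" and C: "C \<ge> 0" and M: "M \<ge> 0" and a: "\<And>n. a n holomorphic_on ball 0 r"
    and bound: "\<And>n y. y \<in> ball 0 r \<Longrightarrow> norm (a n y) \<le> C * M ^ n"
  obtains h where "holo_near0 h"
    "\<forall>\<^sub>F p in nhds 0. (\<lambda>n. a n (snd p) * fst p ^ n) sums h p"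
proof -
  \<comment> \<open>On this bidisc \<open>M |x|\<close> is at most 1/2, so a geometric series
    dominates; \<open>M + 1\<close> avoids a division by zero for \<open>M = 0\<close>.\<close>
  define \<rho> where "\<rho> = min r (1 / (2 * (M + 1)))"
  have \<rho>: "\<rho> > 0" "\<rho> \<le> r" using r M by (auto simp: \<rho>_def)
  define h where "h = (\<lambda>p. \<Sum>n. a n (snd p) * fst p ^ n)"
  define A where "A = ball (0::complex) \<rho> \<times> ball (0::complex) \<rho>"
  have M\<rho>: "M * norm x \<le> 1 / 2" if "x \<in> ball 0 \<rho>" for x :: complex
  proof -
    have "norm x \<le> 1 / (2 * (M + 1))" using that by (auto simp: \<rho>_def)
    then have "M * norm x \<le> M * (1 / (2 * (M + 1)))" using M by (intro mult_left_mono)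
    also have "\<dots> \<le> 1 / 2" using M by (simp add: field_simps)
    finally show ?thesis .
  qed
  have term_bound: "norm (a n (snd p) * fst p ^ n) \<le> C * (1 / 2) ^ n" if "p \<in> A" for p n
  proof -
    have "norm (a n (snd p) * fst p ^ n) \<le> (C * M ^ n) * norm (fst p) ^ n"
      unfolding norm_mult norm_power using that \<rho> bound[of "snd p" n]
      by (intro mult_right_mono) (auto simp: A_def)
    also have "\<dots> = C * (M * norm (fst p)) ^ n" by (simp add: power_mult_distrib)
    also have "\<dots> \<le> C * (1 / 2) ^ n"
      using C M M\<rho>[of "fst p"] that by (intro mult_left_mono power_mono) (auto simp: A_def)
    finally show ?thesis .
  qed
  have summ: "summable (\<lambda>n. C * (1 / 2 :: real) ^ n)" by (intro summable_mult summable_geometric) auto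
  have ul: "uniform_limit A (\<lambda>n p. \<Sum>i<n. a i (snd p) * fst p ^ i) h sequentially"
    unfolding h_def by (rule Weierstrass_m_test[OF term_bound summ])
  have sums: "(\<lambda>n. a n (snd p) * fst p ^ n) sums h p" if "p \<in> A" for p
    unfolding h_def by (rule summable_sums, rule summable_comparison_test'[OF summ, of 0]) (rule term_bound[OF that])
  have a': "a n holomorphic_on ball 0 \<rho>" for n using a \<rho> holomorphic_on_subset by (metis subset_ball)
  have "sep_holo \<rho> h" unfolding sep_holo_def A_def[symmetric]
  proof (intro conjI ballI)
    have "continuous_on A (\<lambda>p. a i (snd p))" for i
      by (rule continuous_on_compose2[OF holomorphic_on_imp_continuous_on[OF a'[of i]]])
        (auto simp: A_def intro!: continuous_intros)
    then show "continuous_on A h"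
      by (intro uniform_limit_theorem[OF _ ul] always_eventually allI continuous_intros) auto
  next
    fix y :: complex assume y: "y \<in> ball 0 \<rho>"
    show "(\<lambda>x. h (x, y)) holomorphic_on ball 0 \<rho>"
    proof (rule holomorphic_uniform_sequence)
      show "(\<lambda>x. \<Sum>i<n. a i y * x ^ i) holomorphic_on ball 0 \<rho>" for n by (intro holomorphic_intros)
      fix x :: complex assume "x \<in> ball 0 \<rho>"
      then obtain d where d: "d > 0" "cball x d \<subseteq> ball 0 \<rho>"
        using open_contains_cball[of "ball (0::complex) \<rho>"] open_ball by metis
      have "uniform_limit (cball x d) (\<lambda>n x. \<Sum>i<n. a i (snd (x, y)) * fst (x, y) ^ i) (\<lambda>x. h (x, y)) sequentially"
        by (rule uniform_limit_compose'[OF ul]) (use d y in \<open>auto simp: A_def\<close>)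
      then show "\<exists>d>0. cball x d \<subseteq> ball 0 \<rho> \<and> uniform_limit (cball x d) (\<lambda>n x. \<Sum>i<n. a i y * x ^ i) (\<lambda>x. h (x, y)) sequentially"
        using d by auto
    qed simp
  next
    fix x :: complex assume x: "x \<in> ball 0 \<rho>"
    show "(\<lambda>y. h (x, y)) holomorphic_on ball 0 \<rho>"
    proof (rule holomorphic_uniform_sequence)
      show "(\<lambda>y. \<Sum>i<n. a i y * x ^ i) holomorphic_on ball 0 \<rho>" for n by (intro holomorphic_intros a')
      fix y :: complex assume "y \<in> ball 0 \<rho>"
      then obtain d where d: "d > 0" "cball y d \<subseteq> ball 0 \<rho>"
        using open_contains_cball[of "ball (0::complex) \<rho>"] open_ball by metis
      have "uniform_limit (cball y d) (\<lambda>n y. \<Sum>i<n. a i (snd (x, y)) * fst (x, y) ^ i) (\<lambda>y. h (x, y)) sequentially"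
        by (rule uniform_limit_compose'[OF ul]) (use d x in \<open>auto simp: A_def\<close>)
      then show "\<exists>d>0. cball y d \<subseteq> ball 0 \<rho> \<and> uniform_limit (cball y d) (\<lambda>n y. \<Sum>i<n. a i y * x ^ i) (\<lambda>y. h (x, y)) sequentially"
        using d by auto
    qed simp
  qed
  then have "holo_near0 h" using \<rho>(1) by (rule sep_holo_imp_holo_near0)
  moreover have "\<forall>\<^sub>F p in nhds 0. (\<lambda>n. a n (snd p) * fst p ^ n) sums h p"
    unfolding eventually_nhds
    by (rule exI[of _ A]) (use \<rho> sums in \<open>auto simp: A_def open_Times zero_prod_def\<close>)
  ultimately show ?thesis by (rule that)
qed

text \<open>A selection of coefficients whose indices grow at most linearly still has geometric
  bounds, because \<open>1 / r\<close> is at least 1. With \<open>e = Suc\<close> it yields division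
  by \<open>x\<close>; with \<open>e m = m N + j\<close> it collects the exponents congruent to
  \<open>j\<close> modulo \<open>N\<close>.\<close>

lemma reindexed_series:
  fixes a :: "nat \<Rightarrow> complex \<Rightarrow> complex"
  assumes r: "0 < r" "r \<le> 1" and B: "B \<ge> 0" and a: "\<And>n. a n holomorphic_on ball 0 r"
    and bound: "\<And>n y. y \<in> ball 0 r \<Longrightarrow> norm (a n y) \<le> B * (1 / r) ^ n"
    and e: "\<And>m. e m \<le> N * m + j"
  obtains h where "holo_near0 h"
    "\<forall>\<^sub>F p in nhds 0. (\<lambda>m. a (e m) (snd p) * fst p ^ m) sums h p"
proof (rule power_series_holo_near0[of r "B * (1 / r) ^ j" "(1 / r) ^ N" "\<lambda>m. a (e m)"])
  fix m y assume y: "y \<in> ball (0::complex) r"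
  have "norm (a (e m) y) \<le> B * (1 / r) ^ e m" by (rule bound[OF y])
  also have "\<dots> \<le> B * (1 / r) ^ (N * m + j)"
    using r B e by (intro mult_left_mono power_increasing) auto
  also have "\<dots> = B * (1 / r) ^ j * ((1 / r) ^ N) ^ m" by (simp add: power_add power_mult)
  finally show "norm (a (e m) y) \<le> B * (1 / r) ^ j * ((1 / r) ^ N) ^ m" .
qed (use assms that in auto)

section \<open>Division by \<open>x\<close> and the decomposition over germs in
  \<open>(x^N, y)\<close>\<close>

abbreviation base_change :: "nat \<Rightarrow> germ \<Rightarrow> germ" where
  "base_change N \<equiv> gsubst (germ_X ^ N) germ_Y"

abbreviation germ_swap :: "germ \<Rightarrow> germ" where
  "germ_swap \<equiv> gsubst germ_Y germ_X"

lemma germ_X_dvd: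
  assumes "gsubst 0 germ_Y f = 0"
  shows "germ_X dvd f"
proof -
  define F where "F = rep_germ f"
  have F: "represents F f" unfolding F_def by (rule represents_rep_germ)
  obtain r B a where a: "0 < r" "r \<le> (1::real)" "B \<ge> (0::real)" "\<And>n::nat. a n holomorphic_on ball 0 r"
    "\<And>n y. y \<in> ball 0 r \<Longrightarrow> norm (a n y) \<le> B * (1 / r) ^ n"
    "\<And>x y. x \<in> ball 0 r \<Longrightarrow> y \<in> ball 0 r \<Longrightarrow> (\<lambda>n. a n y * x ^ n) sums F (x, y)"
    by (rule holo_near0_expansion[OF represents_holo[OF F]]) (rule that)
  obtain h where h: "holo_near0 h" "\<forall>\<^sub>F p in nhds 0. (\<lambda>m. a (Suc m) (snd p) * fst p ^ m) sums h p"
    using reindexed_series[OF a(1-5), of Suc 1 1] by auto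
  have "\<forall>\<^sub>F p in nhds (0 :: complex \<times> complex). F (0, snd p) = 0"
    using represents_eq_iff[OF represents_subst[OF represents_intros(1,5) F] represents_intros(1)] assms
    by auto
  moreover have "\<forall>\<^sub>F p in nhds (0 :: complex \<times> complex). p \<in> ball 0 r \<times> ball 0 r"
    by (rule eventually_nhds_in_open) (use a in \<open>auto simp: open_Times zero_prod_def\<close>)
  ultimately have "\<forall>\<^sub>F p in nhds (0 :: complex \<times> complex). F p = fst p * h p"
    using h(2)
  proof eventually_elim
    case (elim p)
    obtain x y where p: "p = (x, y)" by (cases p)
    have 0: "(\<lambda>n. a n y * 0 ^ n) sums F (0, y)" using a(6)[of 0 y] elim p a(1) by auto
    have "(\<lambda>n. a n y * 0 ^ n) sums a 0 y"
      using sums_If_finite[of "\<lambda>n. n = 0" "\<lambda>n. a n y"] by (simp add: power_0_left if_distrib cong: if_cong)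
    with 0 have "a 0 y = 0" using elim p sums_unique2 by fastforce
    moreover have "(\<lambda>n. a n y * x ^ n) sums F (x, y)" using a(6) elim p by auto
    ultimately have "(\<lambda>n. a (Suc n) y * x ^ Suc n) sums F (x, y)"
      by (subst sums_Suc_iff) auto
    moreover have "(\<lambda>n. x * (a (Suc n) y * x ^ n)) sums (x * h p)"
      using elim(3) p by (intro sums_mult) auto
    ultimately show ?case using p sums_unique2 by (fastforce simp: mult_ac)
  qed
  from represents_eqI[OF F represents_intros(8)[OF represents_intros(4) represents_abs_germ[OF h(1)]] this]
  show ?thesis by simp
qed

text \<open>Sort the power series in \<open>x\<close> by the residue of the exponent modulo
  \<open>N\<close>. Together with \<open>germ_split_unique\<close> this makes the ring of germs free
  over the image of \<open>base_change N\<close>, with basis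
  \<open>1, x, ..., x^(N-1)\<close>.\<close>

lemma germ_split_exists:
  assumes N: "N > 0"
  shows "\<exists>h. f = (\<Sum>j<N. germ_X ^ j * base_change N (h j))"
proof -
  define F where "F = rep_germ f"
  have F: "represents F f" unfolding F_def by (rule represents_rep_germ)
  obtain r B a where a: "0 < r" "r \<le> (1::real)" "B \<ge> (0::real)" "\<And>n::nat. a n holomorphic_on ball 0 r"
    "\<And>n y. y \<in> ball 0 r \<Longrightarrow> norm (a n y) \<le> B * (1 / r) ^ n"
    "\<And>x y. x \<in> ball 0 r \<Longrightarrow> y \<in> ball 0 r \<Longrightarrow> (\<lambda>n. a n y * x ^ n) sums F (x, y)"
    by (rule holo_near0_expansion[OF represents_holo[OF F]]) (rule that)
  have "\<exists>h. holo_near0 h \<and> (\<forall>\<^sub>F p in nhds 0. (\<lambda>m. a (m * N + j) (snd p) * fst p ^ m) sums h p)" for j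
    by (rule reindexed_series[OF a(1-5), of "\<lambda>m. m * N + j" N j]) (assumption, simp add: mult.commute, blast)
  then have "\<forall>j. \<exists>h. holo_near0 h \<and> (\<forall>\<^sub>F p in nhds 0. (\<lambda>m. a (m * N + j) (snd p) * fst p ^ m) sums h p)"
    by blast
  from choice[OF this] obtain H where H: "\<And>j. holo_near0 (H j)"
    "\<And>j. \<forall>\<^sub>F p in nhds 0. (\<lambda>m. a (m * N + j) (snd p) * fst p ^ m) sums H j p" by auto
  have rX: "represents (\<lambda>p. fst p ^ N) (germ_X ^ N)" by (intro represents_power represents_intros)
  have "\<forall>\<^sub>F p in nhds 0. \<forall>j\<in>{..<N}. (\<lambda>m. a (m * N + j) (snd p) * (fst p ^ N) ^ m) sums H j (fst p ^ N, snd p)"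
    using eventually_nhds_0_Pair[OF represents_holo[OF rX] holo_near0_snd _ _ H(2)] N
    by (subst eventually_ball_finite_distrib) auto
  moreover have "\<forall>\<^sub>F p in nhds (0 :: complex \<times> complex). p \<in> ball 0 r \<times> ball 0 r"
    by (rule eventually_nhds_in_open) (use a in \<open>auto simp: open_Times zero_prod_def\<close>)
  ultimately have "\<forall>\<^sub>F p in nhds 0. F p = (\<Sum>j<N. fst p ^ j * H j (fst p ^ N, snd p))"
  proof eventually_elim
    case (elim p)
    have *: "(\<lambda>n. \<Sum>j<N. fst p ^ j * (a (n * N + j) (snd p) * (fst p ^ N) ^ n)) sums
       (\<Sum>j<N. fst p ^ j * H j (fst p ^ N, snd p))"
      using elim(1) by (intro sums_sum sums_mult) auto
    have "(\<lambda>n. a n (snd p) * fst p ^ n) sums F p" using a(6)[of "fst p" "snd p"] elim by (auto simp: mem_Times_iff)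
    from sums_group[OF this N]
    have "(\<lambda>n. \<Sum>i\<in>{n * N..<n * N + N}. a i (snd p) * fst p ^ i) sums F p" .
    also have "(\<lambda>n. \<Sum>i\<in>{n * N..<n * N + N}. a i (snd p) * fst p ^ i) =
       (\<lambda>n. \<Sum>j<N. fst p ^ j * (a (n * N + j) (snd p) * (fst p ^ N) ^ n))"
    proof
      fix n
      have "(\<Sum>i\<in>{n * N..<n * N + N}. a i (snd p) * fst p ^ i) = (\<Sum>j\<in>{0..<N}. a (j + n * N) (snd p) * fst p ^ (j + n * N))"
        using sum.shift_bounds_nat_ivl[of "\<lambda>i. a i (snd p) * fst p ^ i" 0 "n * N" N] by (simp add: add.commute)
      also have "\<dots> = (\<Sum>j<N. fst p ^ j * (a (n * N + j) (snd p) * (fst p ^ N) ^ n))"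
        by (rule sum.cong) (auto simp: power_add power_mult[symmetric] mult_ac add_ac)
      finally show "(\<Sum>i\<in>{n * N..<n * N + N}. a i (snd p) * fst p ^ i) =
        (\<Sum>j<N. fst p ^ j * (a (n * N + j) (snd p) * (fst p ^ N) ^ n))" .
    qed
    finally show ?case using * sums_unique2 by blast
  qed
  moreover have "represents (\<lambda>p. \<Sum>j<N. fst p ^ j * H j (fst p ^ N, snd p))
     (\<Sum>j<N. germ_X ^ j * base_change N (abs_germ (H j)))"
    using N by (intro represents_sum represents_intros(8) represents_power represents_subst represents_intros(4,5)
      represents_abs_germ H) auto
  ultimately show ?thesis using represents_eqI[OF F] by (intro exI[of _ "\<lambda>j. abs_germ (H j)"]) auto
qed

text \<open>The map \<open>x \<mapsto> x^N\<close> sends the disc of radius \<open>d\<close> onto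
  the disc of radius \<open>d ^ N\<close>, so if \<open>h(x^N, y)\<close> vanishes near the origin,
  \<open>h\<close> does.\<close>

lemma gsubst_X_power_inj:
  assumes N: "N > 0" and 0: "base_change N h = 0"
  shows "h = 0"
proof -
  define F where "F = rep_germ h"
  have F: "represents F h" unfolding F_def by (rule represents_rep_germ)
  have rX: "represents (\<lambda>p. fst p ^ N) (germ_X ^ N)" by (intro represents_power represents_intros)
  have "\<forall>\<^sub>F p in nhds 0. F (fst p ^ N, snd p) = 0"
    using represents_eq_iff[OF represents_subst[OF rX represents_intros(5) F] represents_intros(1)] 0 N
    by auto
  then obtain P Q where PQ: "\<forall>\<^sub>F x in nhds 0. P x" "\<forall>\<^sub>F y in nhds 0. Q y"
      "\<And>x y. P x \<Longrightarrow> Q y \<Longrightarrow> F (x ^ N, y) = 0"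
    unfolding nhds_0_prod eventually_prod_filter by auto
  then obtain d where d: "d > 0" "\<And>x. norm x < d \<Longrightarrow> P x" by (auto simp: eventually_nhds_metric)
  have "F (z, y) = 0" if z: "norm z < d ^ N" and y: "Q y" for z y
  proof -
    obtain x where x: "x ^ N = z"
    proof (cases "z = 0")
      case True then show ?thesis using that[of 0] N by simp
    next
      case False
      then show ?thesis using that[of "exp (Ln z / of_nat N)"] N by (simp flip: exp_of_nat_mult)
    qed
    then have "norm x ^ N < d ^ N" using z by (simp flip: norm_power)
    then have "norm x < d" using d by (meson less_imp_le power_less_imp_less_base)
    then show ?thesis using PQ(3)[OF d(2) y] x by auto
  qed
  moreover have "\<forall>\<^sub>F z in nhds (0::complex). norm z < d ^ N"
    using d by (auto simp: eventually_nhds_metric intro!: exI[of _ "d ^ N"])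
  ultimately have "\<forall>\<^sub>F p in nhds 0. F p = 0"
    using PQ(2) unfolding nhds_0_prod eventually_prod_filter by blast
  then show ?thesis by (intro represents_eqI[OF F represents_intros(1)])
qed

lemma germ_X_mult_eq_0:
  assumes 0: "germ_X * h = 0" shows "h = 0"
proof -
  define F where "F = rep_germ h"
  have F: "represents F h" unfolding F_def by (rule represents_rep_germ)
  have "\<forall>\<^sub>F p in nhds 0. fst p * F p = 0"
    using represents_eq_iff[OF represents_intros(8)[OF represents_intros(4) F] represents_intros(1)] 0
    by auto
  then obtain P Q where PQ: "\<forall>\<^sub>F x in nhds 0. P x" "\<forall>\<^sub>F y in nhds 0. Q y"
      "\<And>x y. P x \<Longrightarrow> Q y \<Longrightarrow> x = 0 \<or> F (x, y) = 0"
    unfolding nhds_0_prod eventually_prod_filter by auto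
  obtain R where R: "R > 0" "sep_holo R F" using holo_near0_imp_sep_holo[OF represents_holo[OF F]] .
  have "F (x, y) = 0" if P: "P x" and Q: "Q y" and y: "y \<in> ball 0 R" for x y
  proof (cases "x = 0")
    case True
    have "continuous_on (ball 0 R) (\<lambda>x. F (x, y))"
      using R y by (auto simp: sep_holo_def intro: holomorphic_on_imp_continuous_on)
    then have "isCont (\<lambda>x. F (x, y)) 0" using R by (simp add: continuous_on_eq_continuous_at)
    then have "((\<lambda>x. F (x, y)) \<longlongrightarrow> F (0, y)) (at 0)" by (simp add: isCont_def)
    moreover have "\<forall>\<^sub>F x in at 0. F (x, y) = 0"
      using PQ(1) PQ(3)[OF _ Q] unfolding eventually_at_filter by (auto elim!: eventually_mono)
    then have "((\<lambda>x. F (x, y)) \<longlongrightarrow> 0) (at 0)" by (rule tendsto_eventually)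
    ultimately show ?thesis using True tendsto_unique by (metis trivial_limit_at)
  qed (use PQ(3)[OF P Q] in auto)
  moreover have "\<forall>\<^sub>F y in nhds 0. Q y \<and> y \<in> ball 0 R"
    using PQ(2) eventually_nhds_in_open[of "ball 0 R" "0::complex"] R(1)
    by (intro eventually_conj) auto
  ultimately have "\<forall>\<^sub>F p in nhds 0. F p = 0"
    using PQ(1) unfolding nhds_0_prod eventually_prod_filter by blast
  then show ?thesis by (intro represents_eqI[OF F represents_intros(1)])
qed

lemma root_of_unity_exists:
  assumes "N > 0"
  obtains \<zeta> :: complex where "\<zeta> ^ N = 1" "\<And>m. \<zeta> ^ m = 1 \<longleftrightarrow> N dvd m"
proof -
  define \<zeta> where "\<zeta> = exp (2 * of_real pi * \<i> * of_nat 1 / of_nat N)"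
  have pow: "\<zeta> ^ m = exp (2 * of_real pi * \<i> * of_nat m / of_nat N)" for m
    unfolding \<zeta>_def by (simp add: exp_of_nat_mult[symmetric] mult_ac)
  have 1: "\<zeta> ^ m = 1 \<longleftrightarrow> N dvd m" for m
    unfolding pow by (rule complex_root_unity_eq_1) (use assms in auto)
  have "\<zeta> ^ N = 1" using 1[of N] by simp
  then show ?thesis by (rule that) (rule 1)
qed

lemma sum_root_of_unity:
  fixes z :: complex
  assumes "z ^ N = 1"
  shows "(\<Sum>k<N. z ^ k) = (if z = 1 then of_nat N else 0)"
  using assms by (simp add: sum_gp_strict)

lemma germ_const_mult_cancel: "c \<noteq> 0 \<Longrightarrow> germ_const c * f = 0 \<Longrightarrow> f = 0"
proof -
  assume "c \<noteq> 0" "germ_const c * f = 0"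
  then have "germ_const (inverse c * c) * f = 0" by (simp only: germ_const_simps mult.assoc mult_zero_right)
  then show "f = 0" using \<open>c \<noteq> 0\<close> by (simp add: germ_const_simps)
qed

lemma germ_const_sum: "germ_const (sum f A) = (\<Sum>i\<in>A. germ_const (f i))"
  by (induction A rule: infinite_finite_induct) (auto simp: germ_const_simps)

lemma germ_X_power_mult_eq_0: "germ_X ^ n * h = 0 \<Longrightarrow> h = 0"
  by (induction n) (auto simp: mult.assoc dest: germ_X_mult_eq_0)

lemma germ_X_power_mult_cancel: "germ_X ^ n * f = germ_X ^ n * g \<Longrightarrow> f = g"
  using germ_X_power_mult_eq_0[of n "f - g"] by (simp add: algebra_simps)

text \<open>The rotation \<open>x \<mapsto> \<zeta>^k x\<close> multiplies the \<open>j\<close>-th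
  summand by \<open>\<zeta>^(j k)\<close>. Summing over \<open>k\<close> with suitable weights, as
  in a discrete Fourier transform, isolates \<open>N\<close> times one summand.\<close>

lemma germ_split_unique:
  assumes N: "N > 0" and 0: "(\<Sum>j<N. germ_X ^ j * base_change N (h j)) = 0"
    and i: "i < N"
  shows "h i = 0"
proof -
  obtain \<zeta> :: complex where \<zeta>: "\<zeta> ^ N = 1" "\<And>m. \<zeta> ^ m = 1 \<longleftrightarrow> N dvd m"
    using root_of_unity_exists[OF N] by blast
  define t where "t j = germ_X ^ j * base_change N (h j)" for j
  have rot: "gsubst (germ_const (\<zeta> ^ k) * germ_X) germ_Y (t j) = germ_const ((\<zeta> ^ j) ^ k) * t j" for k j
  proof -
    have "(germ_const (\<zeta> ^ k) * germ_X) ^ N = germ_X ^ N"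
      using \<zeta>(1) by (simp add: power_mult_distrib germ_const_power[symmetric] power_mult[symmetric] mult.commute[of k] )
         (simp add: power_mult germ_const_simps)
    moreover have "(germ_const (\<zeta> ^ k) * germ_X) ^ j = germ_const ((\<zeta> ^ j) ^ k) * germ_X ^ j"
      by (simp add: power_mult_distrib germ_const_power[symmetric] power_mult[symmetric] mult.commute)
    ultimately show ?thesis using N by (simp add: t_def gsubst_simps mult.assoc)
  qed
  have sum0: "(\<Sum>j<N. germ_const ((\<zeta> ^ j) ^ k) * t j) = 0" for k
  proof -
    have "gsubst (germ_const (\<zeta> ^ k) * germ_X) germ_Y (\<Sum>j<N. t j) = 0"
      using 0 by (simp add: t_def gsubst_simps)
    then show ?thesis by (simp add: gsubst_sum rot)
  qed
  \<comment> \<open>The weight \<open>\<zeta> ^ (N - i)\<close> is the inverse of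
    \<open>\<zeta> ^ i\<close>, written with a natural exponent.\<close>
  have "0 = (\<Sum>k<N. germ_const ((\<zeta> ^ (N - i)) ^ k) * (\<Sum>j<N. germ_const ((\<zeta> ^ j) ^ k) * t j))"
    by (simp add: sum0)
  also have "\<dots> = (\<Sum>j<N. germ_const (\<Sum>k<N. (\<zeta> ^ (N - i + j)) ^ k) * t j)"
    unfolding sum_distrib_left germ_const_sum sum_distrib_right
    by (subst sum.swap) (simp add: power_add power_mult_distrib germ_const_simps mult.assoc)
  also have "\<dots> = (\<Sum>j<N. if j = i then of_nat N * t i else 0)"
  proof (rule sum.cong)
    fix j assume "j \<in> {..<N}"
    then have j: "j < N" by simp
    have "(\<zeta> ^ (N - i + j)) ^ N = 1" using \<zeta>(1) by (metis power_commutes power_mult power_one mult.commute)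
    moreover have "\<zeta> ^ (N - i + j) = 1 \<longleftrightarrow> j = i"
    proof
      assume "\<zeta> ^ (N - i + j) = 1"
      then have "N dvd N - i + j" using \<zeta>(2) by simp
      then obtain q where q: "N - i + j = N * q" by auto
      then have "q = 1"
      proof -
        have "0 < N * q" "N * q < N * 2" using q i j by linarith+
        then show ?thesis using N by (cases q) auto
      qed
      then show "j = i" using q i by simp
    qed (use i \<zeta> in simp)
    ultimately show "germ_const (\<Sum>k<N. (\<zeta> ^ (N - i + j)) ^ k) * t j = (if j = i then of_nat N * t i else 0)"
      using sum_root_of_unity by (auto simp: germ_const_of_nat germ_const_simps)
  qed simp
  also have "\<dots> = of_nat N * t i" using i by simp
  finally have "germ_const (of_nat N) * t i = 0" by (simp add: germ_const_of_nat)
  then have "t i = 0" using N germ_const_mult_cancel[of "of_nat N" "t i"] by simp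
  then have "base_change N (h i) = 0" unfolding t_def by (rule germ_X_power_mult_eq_0)
  then show ?thesis by (rule gsubst_X_power_inj[OF N])
qed

lemma germ_swap_swap: "germ_swap (germ_swap f) = f"
  by (simp add: gsubst_simps)

lemma germ_Y_mult_eq_0: assumes "germ_Y * h = 0" shows "h = 0"
proof -
  have "germ_swap (germ_Y * h) = 0" using assms by (simp add: gsubst_simps)
  then have "germ_swap h = 0" by (simp add: gsubst_simps germ_X_mult_eq_0)
  then have "germ_swap (germ_swap h) = 0" by (simp add: gsubst_simps)
  then show ?thesis by (simp add: germ_swap_swap)
qed

lemma germ_Y_power_mult_cancel: "germ_Y ^ n * f = germ_Y ^ n * g \<Longrightarrow> f = g"
proof -
  have *: "germ_Y ^ n * h = 0 \<Longrightarrow> h = 0" for h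
    by (induction n) (auto simp: mult.assoc dest: germ_Y_mult_eq_0)
  assume "germ_Y ^ n * f = germ_Y ^ n * g"
  then show "f = g" using *[of "f - g"] by (simp add: algebra_simps)
qed

lemma germ_Y_dvd: assumes "gsubst germ_X 0 f = 0" shows "germ_Y dvd f"
proof -
  have "gsubst 0 germ_Y (germ_swap f) = gsubst germ_Y 0 f"
    by (simp add: gsubst_simps)
  also have "\<dots> = germ_swap (gsubst germ_X 0 f)" by (simp add: gsubst_simps)
  finally have "gsubst 0 germ_Y (germ_swap f) = 0" using assms by (simp add: gsubst_simps)
  then obtain h where "germ_swap f = germ_X * h" using germ_X_dvd by (auto simp: dvd_def)
  then have "germ_swap (germ_swap f) = germ_swap (germ_X * h)" by simp
  then have "f = germ_Y * germ_swap h" unfolding germ_swap_swap by (simp add: gsubst_simps)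
  then show ?thesis by simp
qed

section \<open>Germs in one variable and their order\<close>

lemma univariate_intros:
  "univariate 0" "univariate 1" "univariate (germ_const c)" "univariate germ_X"
  "univariate f \<Longrightarrow> univariate g \<Longrightarrow> univariate (f + g)"
  "univariate f \<Longrightarrow> univariate g \<Longrightarrow> univariate (f - g)"
  "univariate f \<Longrightarrow> univariate g \<Longrightarrow> univariate (f * g)"
  "univariate f \<Longrightarrow> univariate (f ^ n)"
  by (simp_all add: univariate_def gsubst_simps)

lemma univariate_subst:
  "univariate u \<Longrightarrow> univariate v \<Longrightarrow> germ_at0 u = 0 \<Longrightarrow> germ_at0 v = 0 \<Longrightarrow> univariate (gsubst u v h)"
  unfolding univariate_def by (simp add: gsubst_simps)

lemma subst_univariate:
  assumes "univariate h" "germ_at0 u = 0" "germ_at0 v = 0"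
  shows "gsubst u v h = gsubst u 0 h"
proof -
  have "gsubst u v h = gsubst u v (gsubst germ_X 0 h)" using assms by (simp add: univariate_def)
  then show ?thesis using assms by (simp add: gsubst_simps)
qed

lemma subst_X_univariate: "univariate h \<Longrightarrow> germ_at0 v = 0 \<Longrightarrow> gsubst germ_X v h = h"
  using subst_univariate[of h germ_X v] by (simp add: univariate_def)

lemma gsubst_0_0: "gsubst 0 0 h = germ_const (germ_at0 h)"
  by transfer (auto simp: germ_eq_def zero_prod_def)

lemma subst_0_univariate:
  "univariate h \<Longrightarrow> germ_at0 v = 0 \<Longrightarrow> gsubst 0 v h = germ_const (germ_at0 h)"
  using subst_univariate[of h 0 v] by (simp add: gsubst_0_0)

lemma germ_dy_univariate: assumes "univariate h" shows "germ_dy h = 0"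
proof -
  have "germ_dy h = germ_dy (gsubst germ_X 0 h)" using assms by (simp add: univariate_def)
  then show ?thesis by (simp add: germ_dx_subst germ_dy_X)
qed

lemma germ_dx_univariate: assumes "univariate h" shows "univariate (germ_dx h)"
proof -
  have "germ_dx h = germ_dx (gsubst germ_X 0 h)" using assms by (simp add: univariate_def)
  then show ?thesis by (simp add: germ_dx_subst germ_dx_X univariate_def)
qed

lemma univariate_factor:
  assumes h: "univariate h" and nz: "h \<noteq> 0"
  obtains m u where "univariate u" "germ_at0 u \<noteq> 0" "h = germ_X ^ m * u"
proof -
  define F where "F = rep_germ h"
  have F: "represents F h" unfolding F_def by (rule represents_rep_germ)
  obtain R where R: "R > 0" "sep_holo R F" using holo_near0_imp_sep_holo[OF represents_holo[OF F]] .
  define f where "f x = F (x, 0)" for x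
  have f: "f holomorphic_on ball 0 R" unfolding f_def using R by (auto simp: sep_holo_def)
  have "represents (\<lambda>p. F (fst p, 0)) (gsubst germ_X 0 h)"
    by (rule represents_subst[OF represents_intros(4,1) F]) auto
  then have rf: "represents (\<lambda>p. f (fst p)) h" using h by (simp add: f_def univariate_def)
  have nz': "\<exists>w\<in>ball 0 R. f w \<noteq> 0"
  proof (rule ccontr)
    assume "\<not> (\<exists>w\<in>ball 0 R. f w \<noteq> 0)"
    moreover have "\<forall>\<^sub>F w in nhds 0. w \<in> ball (0::complex) R"
      by (rule eventually_nhds_in_open) (use R in auto)
    ultimately have "\<forall>\<^sub>F w in nhds 0. f w = 0" by (auto elim: eventually_mono)
    then show False using nz represents_eqI[OF rf represents_intros(1) eventually_nhds_0_fst] by blast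
  qed
  have "0 \<in> ball 0 R" using R(1) by simp
  from zorder_exist_zero[OF f open_ball connected_ball this nz', THEN conjunct2]
  obtain r where r: "r > 0" "zor_poly f 0 holomorphic_on cball 0 r"
    "\<And>w. w \<in> cball 0 r \<Longrightarrow> f w = zor_poly f 0 w * (w - 0) ^ nat (zorder f 0) \<and> zor_poly f 0 w \<noteq> 0"
    by blast
  have an: "zor_poly f 0 analytic_on {0}"
    using r(1,2) unfolding analytic_on_def by (auto intro!: exI[of _ r] elim!: holomorphic_on_subset)
  define u where "u = abs_germ (\<lambda>p. zor_poly f 0 (fst p))"
  have ru: "represents (\<lambda>p. zor_poly f 0 (fst p)) u" unfolding u_def by (rule represents_analytic[OF an])
  have "\<forall>\<^sub>F w in nhds 0. w \<in> ball (0::complex) r" by (rule eventually_nhds_in_open) (use r in auto)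
  then have "\<forall>\<^sub>F w in nhds 0. f w = w ^ nat (zorder f 0) * zor_poly f 0 w"
    by eventually_elim (use r(3) in \<open>auto simp: mult.commute\<close>)
  from represents_eqI[OF rf represents_intros(8)[OF represents_power[OF represents_intros(4)] ru] eventually_nhds_0_fst[OF this]]
  have "h = germ_X ^ nat (zorder f 0) * u" .
  then show ?thesis
    by (intro that[of u]) (use r(1) r(3)[of 0] represents_at0[OF ru] univariate_abs_germ[OF an] in \<open>auto simp: u_def\<close>)
qed

text \<open>The order of vanishing at \<open>x = 0\<close>. For a nonzero \<open>univariate\<close>
  germ the exponent exists by \<open>univariate_factor\<close> and is unique by
  \<open>X_power_unit_unique\<close>; the value for 0 makes orders additive in all products.\<close>

definition uord :: "germ \<Rightarrow> enat" where
  "uord h = (if h = 0 then \<infinity> else enat (THE m. \<exists>u. germ_at0 u \<noteq> 0 \<and> h = germ_X ^ m * u))"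

lemma uord_0 [simp]: "uord 0 = \<infinity>"
  by (simp add: uord_def)

lemma X_power_unit_unique:
  assumes "germ_X ^ m * u = germ_X ^ n * w" "germ_at0 u \<noteq> 0" "germ_at0 w \<noteq> 0"
  shows "m = n"
proof -
  have *: False if "germ_X ^ m * u = germ_X ^ n * w" "m < n" "germ_at0 u \<noteq> 0" for m n u w
  proof -
    have "germ_X ^ m * u = germ_X ^ m * (germ_X ^ (n - m) * w)"
      using that by (simp add: power_add[symmetric] mult.assoc[symmetric])
    then have "germ_at0 u = germ_at0 (germ_X ^ (n - m) * w)" using germ_X_power_mult_cancel by blast
    then show False using that by simp
  qed
  show ?thesis using *[OF assms(1)] *[OF assms(1)[symmetric]] assms by (metis linorder_neqE_nat)
qed

lemma uord_X_power_mult: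
  assumes "germ_at0 u \<noteq> 0" shows "uord (germ_X ^ m * u) = enat m"
proof -
  have "germ_X ^ m * u \<noteq> 0" using assms germ_X_power_mult_eq_0 by fastforce
  moreover have "(THE k. \<exists>w. germ_at0 w \<noteq> 0 \<and> germ_X ^ m * u = germ_X ^ k * w) = m"
    by (rule the_equality) (use assms X_power_unit_unique in blast)+
  ultimately show ?thesis by (simp add: uord_def)
qed

lemma uord_unit: "germ_at0 u \<noteq> 0 \<Longrightarrow> uord u = 0"
  using uord_X_power_mult[of u 0] by (simp add: zero_enat_def)

lemma uord_cases:
  assumes "univariate h"
  obtains "h = 0" | m u where "univariate u" "germ_at0 u \<noteq> 0" "h = germ_X ^ m * u" "uord h = enat m"
proof (cases "h = 0")
  case False
  then obtain m u where "univariate u" "germ_at0 u \<noteq> 0" "h = germ_X ^ m * u"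
    using univariate_factor[OF assms] by blast
  then show ?thesis using uord_X_power_mult that(2) by blast
qed (rule that(1))

lemma uord_eq_infinity: "univariate h \<Longrightarrow> uord h = \<infinity> \<longleftrightarrow> h = 0"
  by (erule uord_cases) auto

lemma uord_mult:
  assumes "univariate f" "univariate g" shows "uord (f * g) = uord f + uord g"
proof (cases rule: uord_cases[OF assms(1)])
  case (2 m u)
  show ?thesis
  proof (cases rule: uord_cases[OF assms(2)])
    case (2 n w)
    have "f * g = germ_X ^ (m + n) * (u * w)" using 2 \<open>f = _\<close> by (simp add: power_add mult_ac)
    then show ?thesis using 2 \<open>germ_at0 u \<noteq> 0\<close> \<open>uord f = _\<close> uord_X_power_mult[of "u * w" "m + n"] by simp
  qed auto
qed auto

lemma univariate_mult_eq_0: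
  assumes "univariate f" "univariate g" "f * g = 0" shows "f = 0 \<or> g = 0"
  using uord_mult[OF assms(1,2)] assms uord_eq_infinity by (cases "uord f"; cases "uord g") auto

lemma uord_subst:
  assumes h: "univariate h" and \<tau>: "univariate \<tau>" "germ_at0 \<tau> = 0" "\<tau> \<noteq> 0"
  shows "uord (gsubst \<tau> 0 h) = uord \<tau> * uord h"
proof (cases rule: uord_cases[OF \<tau>(1)])
  case (2 k w)
  \<comment> \<open>Since \<open>0 * \<infinity> = 0\<close> in \<open>enat\<close>, the case
    \<open>h = 0\<close> depends on \<open>\<tau>\<close> having positive order.\<close>
  have "k \<noteq> 0" using 2 \<tau>(2) by (cases k) auto
  show ?thesis
  proof (cases rule: uord_cases[OF h])
    case 1 then show ?thesis using \<tau> \<open>k \<noteq> 0\<close> \<open>uord \<tau> = _\<close> by (simp add: gsubst_simps imult_is_infinity zero_enat_def)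
  next
    case (2 m u)
    have "gsubst \<tau> 0 h = germ_X ^ (k * m) * (w ^ m * gsubst \<tau> 0 u)"
      using 2 \<open>\<tau> = _\<close> \<tau>(2) by (simp add: gsubst_simps power_mult_distrib power_mult[symmetric] mult_ac)
    moreover have "germ_at0 (w ^ m * gsubst \<tau> 0 u) \<noteq> 0" using 2 \<open>germ_at0 w \<noteq> 0\<close> \<tau>(2) by simp
    ultimately show ?thesis using 2 \<open>uord \<tau> = _\<close> uord_X_power_mult by simp
  qed
qed (use \<tau> in auto)

text \<open>Differentiation multiplies the leading coefficient by the positive integer
  \<open>m\<close>, so it stays nonzero. The 1 stands on the right to avoid a truncated
  subtraction.\<close>

lemma uord_deriv:
  assumes h: "univariate h" "germ_at0 h = 0"
  shows "uord h = uord (germ_dx h) + 1"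
proof (cases rule: uord_cases[OF h(1)])
  case (2 m u)
  then obtain k where k: "m = Suc k" using h(2) by (cases m) auto
  have "germ_dx h = germ_X ^ k * (of_nat (Suc k) * u + germ_X * germ_dx u)"
    unfolding 2(3) k germ_dx_mult germ_dx_power germ_dx_X by (simp add: algebra_simps)
  moreover have "germ_at0 (of_nat (Suc k) * u + germ_X * germ_dx u) \<noteq> 0"
    using 2(2) germ_at0_simps(9)[of "of_nat (Suc k)"] unfolding germ_const_of_nat[symmetric]
    by (simp only: germ_at0_simps mult_zero_left add_0_right mult_eq_0_iff of_nat_eq_0_iff) simp
  ultimately show ?thesis using 2 k uord_X_power_mult by (simp add: one_enat_def)
qed auto

section \<open>Divisibility by \<open>y - \<alpha>(x)\<close>\<close>

text \<open>The shear \<open>y \<mapsto> y + \<alpha>(x)\<close> is invertible and carries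
  \<open>y - \<alpha>(x)\<close> to \<open>y\<close>, which reduces the claim to
  \<open>germ_Y_dvd\<close>.\<close>

lemma Y_minus_dvd_iff:
  assumes \<alpha>: "univariate \<alpha>" "germ_at0 \<alpha> = 0"
  shows "(germ_Y - \<alpha>) dvd f \<longleftrightarrow> gsubst germ_X \<alpha> f = 0"
proof
  assume "(germ_Y - \<alpha>) dvd f"
  then show "gsubst germ_X \<alpha> f = 0" using \<alpha> by (auto simp: dvd_def gsubst_simps subst_X_univariate)
next
  assume 0: "gsubst germ_X \<alpha> f = 0"
  have "gsubst germ_X 0 (gsubst germ_X (germ_Y + \<alpha>) f) = 0"
    using 0 \<alpha> by (simp add: gsubst_simps subst_X_univariate)
  then obtain h where h: "gsubst germ_X (germ_Y + \<alpha>) f = germ_Y * h" using germ_Y_dvd by (auto simp: dvd_def)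
  have "f = gsubst germ_X (germ_Y - \<alpha>) (gsubst germ_X (germ_Y + \<alpha>) f)"
    using \<alpha> by (simp add: gsubst_simps subst_X_univariate)
  also have "\<dots> = (germ_Y - \<alpha>) * gsubst germ_X (germ_Y - \<alpha>) h"
    using \<alpha> by (simp add: h gsubst_simps)
  finally show "(germ_Y - \<alpha>) dvd f" by simp
qed

lemma Y_minus_dvd_diff:
  assumes \<alpha>: "univariate \<alpha>" "germ_at0 \<alpha> = 0"
  shows "(germ_Y - \<alpha>) dvd f - gsubst germ_X \<alpha> f"
  using \<alpha> by (simp add: Y_minus_dvd_iff gsubst_simps subst_X_univariate)

lemma Y_minus_mult_eq_0:
  assumes \<alpha>: "univariate \<alpha>" "germ_at0 \<alpha> = 0" and 0: "(germ_Y - \<alpha>) * h = 0"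
  shows "h = 0"
proof -
  have "gsubst germ_X (germ_Y + \<alpha>) ((germ_Y - \<alpha>) * h) = 0" using \<alpha> 0 by (simp add: gsubst_simps)
  then have "germ_Y * gsubst germ_X (germ_Y + \<alpha>) h = 0"
    using \<alpha> by (simp add: gsubst_simps subst_X_univariate)
  then have "gsubst germ_X (germ_Y + \<alpha>) h = 0" by (rule germ_Y_mult_eq_0)
  then have "gsubst germ_X (germ_Y - \<alpha>) (gsubst germ_X (germ_Y + \<alpha>) h) = 0"
    using \<alpha> by (simp add: gsubst_simps)
  then show ?thesis using \<alpha> by (simp add: gsubst_simps subst_X_univariate)
qed

lemma Y_minus_mult_cancel:
  assumes \<alpha>: "univariate \<alpha>" "germ_at0 \<alpha> = 0" and "(germ_Y - \<alpha>) * f = (germ_Y - \<alpha>) * g"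
  shows "f = g"
  using Y_minus_mult_eq_0[OF \<alpha>, of "f - g"] assms by (simp add: algebra_simps)

lemma Y_minus_prime:
  assumes \<alpha>: "univariate \<alpha>" "germ_at0 \<alpha> = 0" and "(germ_Y - \<alpha>) dvd f * g"
  shows "(germ_Y - \<alpha>) dvd f \<or> (germ_Y - \<alpha>) dvd g"
  using assms univariate_mult_eq_0[of "gsubst germ_X \<alpha> f" "gsubst germ_X \<alpha> g"]
  by (simp add: Y_minus_dvd_iff gsubst_simps univariate_subst univariate_intros)

section \<open>Colength of ideals with two generators\<close>

interpretation germ: chain_dimension "\<lambda>c f. germ_const c * f"
  by unfold_locales (simp_all add: germ_const_simps algebra_simps)

definition gideal :: "germ \<Rightarrow> germ \<Rightarrow> germ set" where
  "gideal f g = {a * f + b * g | a b. True}"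

definition colength :: "germ \<Rightarrow> germ \<Rightarrow> enat" where
  "colength f g = germ.rdim (gideal f g) UNIV"

lemma gidealI: "x = a * f + b * g \<Longrightarrow> x \<in> gideal f g"
  and gidealE: "x \<in> gideal f g \<Longrightarrow> (\<And>a b. x = a * f + b * g \<Longrightarrow> P) \<Longrightarrow> P"
  unfolding gideal_def by blast+

lemma gideal_closed: "x \<in> gideal f g \<Longrightarrow> y \<in> gideal f g \<Longrightarrow> c * x + d * y \<in> gideal f g"
proof (elim gidealE)
  fix a b a' b' assume "x = a * f + b * g" "y = a' * f + b' * g"
  then have "c * x + d * y = (c * a + d * a') * f + (c * b + d * b') * g" by (simp add: algebra_simps)
  then show ?thesis by (rule gidealI)
qed

lemma gideal_add: "x \<in> gideal f g \<Longrightarrow> y \<in> gideal f g \<Longrightarrow> x + y \<in> gideal f g"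
  using gideal_closed[of x f g y 1 1] by simp

lemma gideal_mult: "x \<in> gideal f g \<Longrightarrow> c * x \<in> gideal f g"
  using gideal_closed[of x f g x c 0] by simp

lemma gideal_gen: "f \<in> gideal f g" "g \<in> gideal f g"
  by (rule gidealI[of _ 1 _ 0], simp) (rule gidealI[of _ 0 _ 1], simp)

lemma gideal_least: "f \<in> gideal f' g' \<Longrightarrow> g \<in> gideal f' g' \<Longrightarrow> gideal f g \<subseteq> gideal f' g'"
  by (auto elim!: gidealE[of _ f g] intro: gideal_closed)

lemma gideal_eqI:
  "f \<in> gideal f' g' \<Longrightarrow> g \<in> gideal f' g' \<Longrightarrow> f' \<in> gideal f g \<Longrightarrow> g' \<in> gideal f g \<Longrightarrow> gideal f g = gideal f' g'"
  using gideal_least by blast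

lemma subspace_gideal: "germ.subspace (gideal f g)"
proof (rule germ.subspaceI)
  show "0 \<in> gideal f g" by (rule gidealI[of _ 0 _ 0]) simp
qed (auto intro: gideal_add gideal_mult)

lemma gideal_commute: "gideal f g = gideal g f"
  by (intro gideal_eqI gideal_gen)

lemma colength_commute: "colength f g = colength g f"
  by (simp add: colength_def gideal_commute)

lemma colength_unit: assumes "germ_at0 f \<noteq> 0" shows "colength f g = 0"
proof -
  obtain h where "f * h = 1" using germ_unit_iff[of f] assms by (metis dvd_def)
  then have "x = (x * h) * f + 0 * g" for x by (simp add: mult.assoc mult.commute[of h])
  then have "x \<in> gideal f g" for x by (rule gidealI)
  then have "gideal f g = UNIV" by blast
  then show ?thesis using subspace_gideal[of f g] by (simp add: colength_def)
qed

lemma colength_unit_mult: assumes "germ_at0 u \<noteq> 0" shows "colength (u * f) g = colength f g"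
proof -
  obtain h where h: "u * h = 1" using germ_unit_iff[of u] assms by (metis dvd_def)
  have "f = h * (u * f)" using h by (metis mult.assoc mult.commute mult_1)
  then have "f \<in> gideal (u * f) g" using gideal_mult gideal_gen by metis
  then have "gideal (u * f) g = gideal f g" by (intro gideal_eqI gideal_mult gideal_gen)
  then show ?thesis by (simp add: colength_def)
qed

lemma colength_add_multiple: "colength f (g + c * f) = colength f g"
proof -
  have "g = (- c) * f + 1 * (g + c * f)" by (simp add: algebra_simps)
  then have "g \<in> gideal f (g + c * f)" by (rule gidealI)
  moreover have "g + c * f = c * f + 1 * g" by (simp add: algebra_simps)
  then have "g + c * f \<in> gideal f g" by (rule gidealI)
  ultimately have "gideal f (g + c * f) = gideal f g" by (intro gideal_eqI gideal_gen)
  then show ?thesis by (simp add: colength_def)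
qed

section \<open>Additivity of the colength, and its value on one smooth branch\<close>

lemma linear_mult: "Vector_Spaces.linear (\<lambda>c f. germ_const c * f) (\<lambda>c f. germ_const c * f) (\<lambda>h. k * h)"
  by unfold_locales (simp_all add: germ_const_simps algebra_simps)

lemma linear_subst:
  assumes "germ_at0 u = 0" "germ_at0 v = 0"
  shows "Vector_Spaces.linear (\<lambda>c f. germ_const c * f) (\<lambda>c f. germ_const c * f) (\<lambda>h. k * gsubst u v h)"
  using assms by unfold_locales (simp_all add: germ_const_simps gsubst_simps algebra_simps)

text \<open>This is the exact sequence \<open>0 \<rightarrow> O/(f1, g) \<rightarrow> O/(f1 f2, g)
  \<rightarrow> O/(f2, g) \<rightarrow> 0\<close>, whose first map is multiplication by
  \<open>f2\<close>. The first assumption says that \<open>g\<close> is a nonzerodivisor modulo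
  \<open>f2\<close>; together with cancellation of \<open>f2\<close> it yields injectivity.\<close>

lemma colength_mult:
  assumes f2: "\<And>b. f2 dvd b * g \<Longrightarrow> f2 dvd b" and nz: "\<And>h. f2 * h = 0 \<Longrightarrow> h = 0"
  shows "colength (f1 * f2) g = colength f1 g + colength f2 g"
proof -
  let ?I = "gideal (f1 * f2) g" and ?J = "gideal f2 g"
  have vim: "(\<lambda>h. f2 * h) -` ?I = gideal f1 g"
  proof (intro equalityI subsetI)
    fix h assume "h \<in> (\<lambda>h. f2 * h) -` ?I"
    then obtain a b where ab: "f2 * h = a * (f1 * f2) + b * g" by (auto elim: gidealE)
    then have "b * g = f2 * (h - a * f1)" by (simp add: algebra_simps)
    then have "f2 dvd b * g" by simp
    then have "f2 dvd b" by (rule f2)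
    then obtain b' where "b = f2 * b'" by (auto simp: dvd_def)
    then have "f2 * (h - a * f1 - b' * g) = 0" using ab by (simp add: algebra_simps)
    then have "h - a * f1 - b' * g = 0" by (rule nz)
    then have "h = a * f1 + b' * g" by (simp add: algebra_simps)
    then show "h \<in> gideal f1 g" by (rule gidealI)
  next
    fix h assume "h \<in> gideal f1 g"
    then obtain a b where "h = a * f1 + b * g" by (rule gidealE)
    then have "f2 * h = a * (f1 * f2) + (f2 * b) * g" by (simp add: algebra_simps)
    then show "h \<in> (\<lambda>h. f2 * h) -` ?I" by (simp add: gidealI)
  qed
  have im: "{f2 * h + i | h i. i \<in> ?I} = ?J"
  proof (intro equalityI subsetI)
    fix x assume "x \<in> {f2 * h + i | h i. i \<in> ?I}"
    then obtain h a b where "x = f2 * h + (a * (f1 * f2) + b * g)" by (auto elim: gidealE)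
    then have "x = (h + a * f1) * f2 + b * g" by (simp add: algebra_simps)
    then show "x \<in> ?J" by (rule gidealI)
  next
    fix x assume "x \<in> ?J"
    then obtain a b where "x = a * f2 + b * g" by (rule gidealE)
    then have "x = f2 * a + b * g" "b * g \<in> ?I" by (simp_all add: algebra_simps gideal_gen gideal_mult)
    then show "x \<in> {f2 * h + i | h i. i \<in> ?I}" by blast
  qed
  have "?I \<subseteq> ?J" by (intro gideal_least gideal_mult gideal_gen)
  then have "colength (f1 * f2) g = germ.rdim ?I ?J + germ.rdim ?J UNIV"
    unfolding colength_def by (intro germ.rdim_add subspace_gideal) auto
  also have "germ.rdim ?I ?J = germ.rdim ((\<lambda>h. f2 * h) -` ?I) UNIV"
    using germ.rdim_transport[OF linear_mult[of f2] subspace_gideal[of "f1 * f2" g]] im by simp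
  finally show ?thesis unfolding vim colength_def .
qed

lemma colength_swap:
  "colength (germ_swap f) (germ_swap g) = colength f g"
proof -
  let ?T = "\<lambda>h. 1 * germ_swap h"
  have "?T -` gideal f g = gideal (germ_swap f) (germ_swap g)"
  proof (intro equalityI subsetI)
    fix h assume "h \<in> ?T -` gideal f g"
    then obtain a b where "germ_swap h = a * f + b * g" by (auto elim: gidealE)
    then have "germ_swap (germ_swap h) =
      germ_swap a * germ_swap f + germ_swap b * germ_swap g"
      by (simp add: gsubst_simps)
    then show "h \<in> gideal (germ_swap f) (germ_swap g)"
      unfolding germ_swap_swap by (rule gidealI)
  next
    fix h assume "h \<in> gideal (germ_swap f) (germ_swap g)"
    then obtain a b where "h = a * germ_swap f + b * germ_swap g" by (rule gidealE)
    then have "germ_swap h = germ_swap a * f + germ_swap b * g"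
      by (simp add: gsubst_add gsubst_mult germ_swap_swap)
    then show "h \<in> ?T -` gideal f g" by (simp add: gidealI)
  qed
  moreover have "{?T h + i | h i. i \<in> gideal f g} = UNIV"
  proof -
    have "x = ?T (germ_swap x) + 0" for x by (simp add: germ_swap_swap)
    then show ?thesis using germ.subspace_0[OF subspace_gideal] by blast
  qed
  ultimately show ?thesis
    using germ.rdim_transport[OF linear_subst[of germ_Y germ_X 1] subspace_gideal[of f g]]
    by (simp add: colength_def)
qed

text \<open>Modulo \<open>y - \<alpha>(x)\<close> only \<open>f(x, \<alpha>(x))\<close> is left of a
  germ \<open>f\<close>, and membership in the ideal becomes divisibility by \<open>x^m\<close>. The
  ideal for \<open>m\<close> exceeds the one for \<open>m + 1\<close> by exactly the line through
  \<open>x^m\<close>.\<close>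

lemma colength_Y_minus_X_power:
  assumes \<alpha>: "univariate \<alpha>" "germ_at0 \<alpha> = 0"
  shows "colength (germ_Y - \<alpha>) (germ_X ^ m) = enat m"
proof (induction m)
  case 0
  then show ?case using colength_unit[of 1 "germ_Y - \<alpha>"] by (simp add: colength_commute zero_enat_def)
next
  case (Suc m)
  let ?J = "\<lambda>m. gideal (germ_Y - \<alpha>) (germ_X ^ m)"
  have mem: "f \<in> ?J m \<longleftrightarrow> (\<exists>b. gsubst germ_X \<alpha> f = germ_X ^ m * b)" for f m
  proof
    assume "f \<in> ?J m"
    then obtain a b where "f = a * (germ_Y - \<alpha>) + b * germ_X ^ m" by (rule gidealE)
    then have "gsubst germ_X \<alpha> f = germ_X ^ m * gsubst germ_X \<alpha> b"
      using \<alpha> by (simp add: gsubst_simps subst_X_univariate mult.commute)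
    then show "\<exists>b. gsubst germ_X \<alpha> f = germ_X ^ m * b" by blast
  next
    assume "\<exists>b. gsubst germ_X \<alpha> f = germ_X ^ m * b"
    then obtain b where b: "gsubst germ_X \<alpha> f = germ_X ^ m * b" by blast
    obtain a where "f - gsubst germ_X \<alpha> f = (germ_Y - \<alpha>) * a" using Y_minus_dvd_diff[OF \<alpha>, of f] by (auto simp: dvd_def)
    then have "f = a * (germ_Y - \<alpha>) + b * germ_X ^ m" using b by (simp add: algebra_simps)
    then show "f \<in> ?J m" by (rule gidealI)
  qed
  have sub: "?J (Suc m) \<subseteq> ?J m"
    by (intro gideal_least gideal_gen, unfold power_Suc) (intro gideal_mult gideal_gen)
  have "?J m = germ.adjoin (?J (Suc m)) (germ_X ^ m)"
  proof (intro equalityI subsetI)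
    fix f assume "f \<in> ?J m"
    then obtain b where b: "gsubst germ_X \<alpha> f = germ_X ^ m * b" using mem by blast
    \<comment> \<open>The cofactor \<open>b\<close> may depend on \<open>y\<close>; substituting
      \<open>y = \<alpha>\<close> once more replaces it by a germ in \<open>x\<close>.\<close>
    define d where "d = gsubst germ_X \<alpha> b"
    have d: "univariate d" unfolding d_def using \<alpha> by (intro univariate_subst univariate_intros) auto
    have "gsubst germ_X \<alpha> (gsubst germ_X \<alpha> f) = germ_X ^ m * d"
      using b \<alpha> by (simp add: gsubst_simps d_def)
    then have fd: "gsubst germ_X \<alpha> f = germ_X ^ m * d" using \<alpha> by (simp add: gsubst_simps subst_X_univariate)
    have "gsubst 0 germ_Y (d - germ_const (germ_at0 d)) = 0"
      using d by (simp add: gsubst_simps subst_0_univariate)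
    then obtain e where "d - germ_const (germ_at0 d) = germ_X * e" using germ_X_dvd by (auto simp: dvd_def)
    then have e: "d = germ_const (germ_at0 d) + germ_X * e" by (simp add: algebra_simps)
    have "gsubst germ_X \<alpha> (f - germ_const (germ_at0 d) * germ_X ^ m) = germ_X ^ m * d - germ_const (germ_at0 d) * germ_X ^ m"
      using \<alpha> by (simp add: gsubst_simps fd)
    also have "\<dots> = germ_X ^ Suc m * e" using arg_cong[OF e, of "\<lambda>z. germ_X ^ m * z"] by (simp add: algebra_simps)
    finally have "f - germ_const (germ_at0 d) * germ_X ^ m \<in> ?J (Suc m)" using mem by blast
    then show "f \<in> germ.adjoin (?J (Suc m)) (germ_X ^ m)"
      by (rule germ.adjoinI[rotated, where c = "germ_at0 d"]) simp
  next
    fix f assume "f \<in> germ.adjoin (?J (Suc m)) (germ_X ^ m)"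
    then obtain u c where u: "f = u + germ_const c * germ_X ^ m" "u \<in> ?J (Suc m)" by (rule germ.adjoinE)
    then show "f \<in> ?J m" using sub by (auto intro!: gideal_add gideal_mult gideal_gen)
  qed
  moreover have "germ_X ^ m \<notin> ?J (Suc m)"
  proof
    assume "germ_X ^ m \<in> ?J (Suc m)"
    then obtain b where "gsubst germ_X \<alpha> (germ_X ^ m) = germ_X ^ Suc m * b" using mem by blast
    then have "germ_X ^ m * 1 = germ_X ^ m * (germ_X * b)" using \<alpha> by (simp add: gsubst_simps mult_ac)
    then have "germ_at0 1 = germ_at0 (germ_X * b)" using germ_X_power_mult_cancel by metis
    then show False by simp
  qed
  ultimately have "germ.qdim (?J (Suc m)) (Suc 0) (?J m)" using germ.qdim_Suc[OF germ.qdim_0] by metis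
  then have 1: "germ.rdim (?J (Suc m)) (?J m) = enat 1" by (simp add: germ.rdim_eq_enat subspace_gideal)
  have "germ.rdim (?J (Suc m)) UNIV = germ.rdim (?J (Suc m)) (?J m) + germ.rdim (?J m) UNIV"
    by (intro germ.rdim_add subspace_gideal sub) auto
  then show ?case using Suc.IH 1 by (simp add: colength_def)
qed

lemma colength_Y_minus:
  assumes \<alpha>: "univariate \<alpha>" "germ_at0 \<alpha> = 0"
  shows "colength (germ_Y - \<alpha>) g = uord (gsubst germ_X \<alpha> g)"
proof -
  define d where "d = gsubst germ_X \<alpha> g"
  have d: "univariate d" unfolding d_def using \<alpha> by (intro univariate_subst univariate_intros) auto
  obtain a where "g - d = (germ_Y - \<alpha>) * a" unfolding d_def using Y_minus_dvd_diff[OF \<alpha>, of g] by (auto simp: dvd_def)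
  then have g: "g = d + a * (germ_Y - \<alpha>)" by (simp add: algebra_simps)
  have gd: "colength (germ_Y - \<alpha>) g = colength (germ_Y - \<alpha>) d" by (subst g) (rule colength_add_multiple)
  show ?thesis
  proof (cases rule: uord_cases[OF d])
    case 1
    \<comment> \<open>If \<open>g\<close> vanishes on the branch, the ideal is generated by
      \<open>y - \<alpha>\<close> and lies in \<open>(y - \<alpha>, x^(k+1))\<close> for every
      \<open>k\<close>, so its colength exceeds every \<open>k\<close>.\<close>
    have "colength (germ_Y - \<alpha>) 0 \<noteq> enat k" for k
    proof
      assume k: "colength (germ_Y - \<alpha>) 0 = enat k"
      let ?I = "gideal (germ_Y - \<alpha>) 0" and ?J = "gideal (germ_Y - \<alpha>) (germ_X ^ Suc k)"
      have "0 \<in> ?J" by (rule gidealI[of _ 0 _ 0]) simp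
      then have "?I \<subseteq> ?J" by (intro gideal_least gideal_gen)
      then have "germ.rdim ?I UNIV = germ.rdim ?I ?J + germ.rdim ?J UNIV"
        by (intro germ.rdim_add subspace_gideal) auto
      then have "enat k = germ.rdim ?I ?J + enat (Suc k)"
        using k colength_Y_minus_X_power[OF \<alpha>, of "Suc k"] by (simp add: colength_def)
      then show False by (cases "germ.rdim ?I ?J") auto
    qed
    then have "colength (germ_Y - \<alpha>) 0 = \<infinity>" by (cases "colength (germ_Y - \<alpha>) 0") auto
    then show ?thesis using gd 1 by (simp add: d_def)
  next
    case (2 m u)
    have "colength (germ_Y - \<alpha>) (germ_X ^ m * u) = enat m"
      using colength_unit_mult[OF 2(2), of "germ_X ^ m" "germ_Y - \<alpha>"] colength_Y_minus_X_power[OF \<alpha>, of m]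
      by (simp add: colength_commute mult.commute)
    then show ?thesis using gd 2 by (simp add: d_def)
  qed
qed

section \<open>Colength of products of branches and under base change\<close>

abbreviation branch_prod :: "germ list \<Rightarrow> germ" where
  "branch_prod as \<equiv> prod_list (map (\<lambda>\<alpha>. germ_Y - \<alpha>) as)"

lemma colength_prod_Y_minus:
  assumes "\<forall>\<alpha>\<in>set as. univariate \<alpha> \<and> germ_at0 \<alpha> = 0" and "germ_at0 u \<noteq> 0"
  shows "colength (u * branch_prod as) g = sum_list (map (\<lambda>\<alpha>. uord (gsubst germ_X \<alpha> g)) as)"
  using assms(1)
proof (induction as)
  case Nil then show ?case using colength_unit[OF assms(2)] by simp
next
  case (Cons \<alpha> as)
  define P where "P = u * branch_prod as"
  have \<alpha>: "univariate \<alpha>" "germ_at0 \<alpha> = 0" using Cons.prems by auto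
  have "colength (P * (germ_Y - \<alpha>)) g = colength P g + colength (germ_Y - \<alpha>) g"
  proof (cases "gsubst germ_X \<alpha> g = 0")
    case False
    show ?thesis
    proof (rule colength_mult)
      fix b assume "(germ_Y - \<alpha>) dvd b * g"
      then show "(germ_Y - \<alpha>) dvd b" using Y_minus_prime[OF \<alpha>] Y_minus_dvd_iff[OF \<alpha>] False by blast
    qed (rule Y_minus_mult_eq_0[OF \<alpha>])
  next
    \<comment> \<open>Here \<open>g\<close> vanishes on the branch, so \<open>colength_mult\<close>
      does not apply. The larger ideal \<open>(y - \<alpha>, g)\<close> already has infinite
      colength, and both sides are infinite.\<close>
    case True
    have inf: "colength (germ_Y - \<alpha>) g = \<infinity>" using True by (simp add: colength_Y_minus[OF \<alpha>])
    have "gideal (P * (germ_Y - \<alpha>)) g \<subseteq> gideal (germ_Y - \<alpha>) g" by (intro gideal_least gideal_mult gideal_gen)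
    then have "colength (P * (germ_Y - \<alpha>)) g = germ.rdim (gideal (P * (germ_Y - \<alpha>)) g) (gideal (germ_Y - \<alpha>) g) + colength (germ_Y - \<alpha>) g"
      unfolding colength_def by (intro germ.rdim_add subspace_gideal) auto
    then show ?thesis using inf by simp
  qed
  then show ?case using Cons colength_Y_minus[OF \<alpha>] by (simp add: P_def mult_ac add.commute)
qed

text \<open>By freeness an element is its family of \<open>N\<close> components. The ideal
  \<open>?I'\<close> demands that all of them lie in \<open>(f, g)\<close>; the filtration
  \<open>W\<close> releases one component after the other until the whole ring is reached, and each
  step contributes one copy of \<open>O/(f, g)\<close>.\<close>

lemma colength_base_change:
  assumes N: "N > 0"
  shows "colength (base_change N f) (base_change N g) = of_nat N * colength f g"
proof -
  define \<beta> where "\<beta> = base_change N"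
  have \<beta>0: "germ_at0 (germ_X ^ N) = 0" "germ_at0 germ_Y = 0" using N by auto
  note \<beta>_simps = gsubst_simps[OF \<beta>0, folded \<beta>_def]
  have \<beta>_sum: "\<beta> (sum h A) = (\<Sum>i\<in>A. \<beta> (h i))" for h :: "nat \<Rightarrow> germ" and A unfolding \<beta>_def by (rule gsubst_sum[OF \<beta>0])
  let ?S = "\<lambda>h. \<Sum>i<N. germ_X ^ i * \<beta> (h i)"
  let ?I' = "gideal (\<beta> f) (\<beta> g)" and ?I = "gideal f g"
  have memI': "?S h \<in> ?I' \<longleftrightarrow> (\<forall>i<N. h i \<in> ?I)" for h
  proof
    assume "?S h \<in> ?I'"
    then obtain a b where ab: "?S h = a * \<beta> f + b * \<beta> g" by (rule gidealE)
    obtain a' b' where "a = (\<Sum>i<N. germ_X ^ i * \<beta> (a' i))" "b = (\<Sum>i<N. germ_X ^ i * \<beta> (b' i))"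
      using germ_split_exists[OF N] unfolding \<beta>_def by metis
    then have "(\<Sum>i<N. germ_X ^ i * \<beta> (h i - (a' i * f + b' i * g))) = 0"
      using ab by (simp add: \<beta>_simps algebra_simps sum.distrib sum_subtractf sum_distrib_left sum_distrib_right)
    then have "h i - (a' i * f + b' i * g) = 0" if "i < N" for i
      using germ_split_unique[OF N _ that, of "\<lambda>i. h i - (a' i * f + b' i * g)"] unfolding \<beta>_def by simp
    then have "h i = a' i * f + b' i * g" if "i < N" for i using that by simp
    then show "\<forall>i<N. h i \<in> ?I" by (auto intro: gidealI)
  next
    assume h: "\<forall>i<N. h i \<in> ?I"
    have "\<beta> (h i) \<in> ?I'" if "i < N" for i
    proof -
      have "h i \<in> ?I" using h that by simp
      then obtain a b where "h i = a * f + b * g" by (rule gidealE)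
      then have "\<beta> (h i) = \<beta> a * \<beta> f + \<beta> b * \<beta> g" by (simp add: \<beta>_simps)
      then show ?thesis by (rule gidealI)
    qed
    then show "?S h \<in> ?I'"
      by (intro germ.subspace_sum[OF subspace_gideal] gideal_mult) auto
  qed
  define W where "W j = {?S h |h. \<forall>i<N. j \<le> i \<longrightarrow> h i \<in> ?I}" for j
  have memW: "?S h \<in> W j \<longleftrightarrow> (\<forall>i<N. j \<le> i \<longrightarrow> h i \<in> ?I)" for h j
  proof
    assume "?S h \<in> W j"
    then obtain k where k: "?S h = ?S k" "\<forall>i<N. j \<le> i \<longrightarrow> k i \<in> ?I"
      unfolding W_def by blast
    then have "(\<Sum>i<N. germ_X ^ i * \<beta> (h i - k i)) = 0" by (simp add: \<beta>_simps algebra_simps sum_subtractf)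
    then have "h i = k i" if "i < N" for i
      using germ_split_unique[OF N _ that, of "\<lambda>i. h i - k i"] unfolding \<beta>_def by simp
    then show "\<forall>i<N. j \<le> i \<longrightarrow> h i \<in> ?I" using k by simp
  qed (unfold W_def, blast)
  have split: "\<exists>h. x = ?S h" for x
    using germ_split_exists[OF N] unfolding \<beta>_def by blast
  have subW: "germ.subspace (W j)" for j
  proof (rule germ.subspaceI)
    show "0 \<in> W j" using memW[of "\<lambda>_. 0" j] germ.subspace_0[OF subspace_gideal] by (simp add: \<beta>_simps)
  next
    fix x y assume "x \<in> W j" "y \<in> W j"
    moreover obtain h k where "x = ?S h" "y = ?S k"
      using split[of x] split[of y] by blast
    ultimately show "x + y \<in> W j" using memW[of h j] memW[of k j] memW[of "\<lambda>i. h i + k i" j]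
      by (auto simp: \<beta>_simps algebra_simps sum.distrib intro: gideal_add)
  next
    fix c x assume "x \<in> W j"
    moreover obtain h where "x = ?S h" using split[of x] by blast
    ultimately show "germ_const c * x \<in> W j" using memW[of h j] memW[of "\<lambda>i. germ_const c * h i" j]
      by (auto simp: \<beta>_simps mult_ac sum_distrib_left intro: gideal_mult)
  qed
  have W0: "W 0 = ?I'"
  proof (intro equalityI subsetI)
    fix x assume x: "x \<in> W 0"
    obtain h where "x = ?S h" using split[of x] by blast
    then show "x \<in> ?I'" using x memW[of h 0] memI'[of h] by simp
  next
    fix x assume x: "x \<in> ?I'"
    obtain h where "x = ?S h" using split[of x] by blast
    then show "x \<in> W 0" using x memW[of h 0] memI'[of h] by simp
  qed
  have WN: "W N = UNIV"
  proof -
    have "x \<in> W N" for x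
    proof -
      obtain h where "x = ?S h" using split[of x] by blast
      then show ?thesis using memW[of h N] by simp
    qed
    then show ?thesis by blast
  qed
  have mono: "W j \<subseteq> W (Suc j)" for j unfolding W_def by (blast intro: Suc_leD)
  have mono0: "W 0 \<subseteq> W j" for j unfolding W_def by blast
  have step: "germ.rdim (W j) (W (Suc j)) = colength f g" if j: "j < N" for j
  proof -
    \<comment> \<open>This map fills the \<open>j\<close>-th component and nothing else, so it
      identifies \<open>O/(f, g)\<close> with \<open>W (Suc j)\<close> modulo
      \<open>W j\<close>.\<close>
    let ?T = "\<lambda>h. germ_X ^ j * base_change N h"
    have single: "?T h = (\<Sum>i<N. germ_X ^ i * \<beta> (if i = j then h else 0))" for h
      using j by (subst sum.remove[of _ j]) (auto simp: \<beta>_def[symmetric] \<beta>_simps intro!: sum.neutral)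
    have vim: "?T -` W j = ?I"
    proof -
      have "?T h \<in> W j \<longleftrightarrow> h \<in> ?I" for h
        unfolding single memW using j germ.subspace_0[OF subspace_gideal, of f g] by auto
      then show ?thesis by auto
    qed
    have im: "{?T h + i | h i. i \<in> W j} = W (Suc j)"
    proof (intro equalityI subsetI)
      fix x assume "x \<in> {?T h + i | h i. i \<in> W j}"
      then obtain h i where x: "x = ?T h + i" "i \<in> W j" by blast
      have "?T h \<in> W (Suc j)" unfolding single memW using germ.subspace_0[OF subspace_gideal, of f g] by auto
      then show "x \<in> W (Suc j)" using x mono germ.subspace_add[OF subW] by blast
    next
      fix x assume x: "x \<in> W (Suc j)"
      obtain h where h: "x = ?S h" using split[of x] by blast
      then have hi: "\<forall>i<N. Suc j \<le> i \<longrightarrow> h i \<in> ?I" using x memW by simp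
      define k where "k i = (if i = j then 0 else h i)" for i
      have "x = ?T (h j) + ?S k"
        unfolding h single sum.distrib[symmetric] k_def
        by (rule sum.cong) (auto simp: \<beta>_simps)
      moreover have "?S k \<in> W j"
        unfolding memW k_def using hi germ.subspace_0[OF subspace_gideal, of f g] by auto
      ultimately show "x \<in> {?T h + i | h i. i \<in> W j}" by blast
    qed
    show ?thesis
      using germ.rdim_transport[OF linear_subst[OF \<beta>0, of "germ_X ^ j"] subW[of j]] vim im by (simp add: colength_def)
  qed
  have "germ.rdim ?I' (W j) = of_nat j * colength f g" if "j \<le> N" for j
    using that
  proof (induction j)
    case 0 then show ?case using subspace_gideal[of "\<beta> f" "\<beta> g"] by (simp add: W0)
  next
    case (Suc j)
    have "germ.rdim ?I' (W (Suc j)) = germ.rdim ?I' (W j) + germ.rdim (W j) (W (Suc j))"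
      by (rule germ.rdim_add[OF subspace_gideal subW]) (use mono mono0[of j] W0 in auto)
    then show ?case using Suc step[of j] by (simp add: algebra_simps)
  qed
  from this[of N] show ?thesis unfolding WN by (simp add: colength_def \<beta>_def)
qed

lemma colength_branches:
  assumes N: "N > 0" and f: "base_change N f = u * branch_prod as"
    and as: "\<forall>\<alpha>\<in>set as. univariate \<alpha> \<and> germ_at0 \<alpha> = 0" and u: "germ_at0 u \<noteq> 0"
  shows "of_nat N * colength f g = sum_list (map (\<lambda>\<alpha>. uord (gsubst (germ_X ^ N) \<alpha> g)) as)"
proof -
  have "of_nat N * colength f g = sum_list (map (\<lambda>\<alpha>. uord (gsubst germ_X \<alpha> (base_change N g))) as)"
    unfolding colength_base_change[OF N, symmetric] f by (rule colength_prod_Y_minus[OF as u])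
  also have "\<dots> = sum_list (map (\<lambda>\<alpha>. uord (gsubst (germ_X ^ N) \<alpha> g)) as)"
    by (intro arg_cong[where f = sum_list] map_cong refl) (use N as in \<open>simp add: gsubst_simps\<close>)
  finally show ?thesis .
qed

section \<open>Puiseux's theorem\<close>

text \<open>In geometric terms, the curve \<open>f = 0\<close> meets the line \<open>x = 0\<close>
  at the origin with multiplicity exactly \<open>n\<close>.\<close>

definition y_regular :: "nat \<Rightarrow> germ \<Rightarrow> bool" where
  "y_regular n f \<longleftrightarrow> (\<exists>u. germ_at0 u \<noteq> 0 \<and> gsubst 0 germ_Y f = germ_Y ^ n * u)"

lemma y_regular_at0: "y_regular (Suc n) f \<Longrightarrow> germ_at0 f = 0"
proof -
  assume "y_regular (Suc n) f"
  then obtain u where "gsubst 0 germ_Y f = germ_Y ^ Suc n * u" by (auto simp: y_regular_def)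
  then have "germ_at0 (gsubst 0 germ_Y f) = 0" by simp
  then show ?thesis by simp
qed

lemma taylor_y:
  "\<exists>a h. (\<forall>j. univariate (a j)) \<and> f = (\<Sum>j<n. a j * germ_Y ^ j) + germ_Y ^ n * h"
proof (induction n)
  case 0 then show ?case by (intro exI[of _ "\<lambda>_. 0"] exI[of _ f]) (simp add: univariate_intros)
next
  case (Suc n)
  then obtain a h where ah: "\<And>j. univariate (a j)" "f = (\<Sum>j<n. a j * germ_Y ^ j) + germ_Y ^ n * h" by blast
  define b where "b = gsubst germ_X 0 h"
  have b: "univariate b" by (simp add: b_def univariate_def gsubst_simps)
  have "gsubst germ_X 0 (h - b) = 0" by (simp add: b_def gsubst_simps)
  then obtain k where "h - b = germ_Y * k" using germ_Y_dvd by (auto simp: dvd_def)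
  then have "h = b + germ_Y * k" by (simp add: algebra_simps)
  then have "f = (\<Sum>j<Suc n. (a(n := b)) j * germ_Y ^ j) + germ_Y ^ Suc n * k"
    using ah(2) by (simp add: algebra_simps)
  moreover have "\<forall>j. univariate ((a(n := b)) j)" using ah(1) b by simp
  ultimately show ?case by blast
qed

section \<open>Iterated derivatives in \<open>y\<close>\<close>

lemma dy_pow_zero: "(germ_dy ^^ m) 0 = 0"
  by (induction m) auto

lemma dy_pow_add: "(germ_dy ^^ m) (f + g) = (germ_dy ^^ m) f + (germ_dy ^^ m) g"
  by (induction m) (auto simp: germ_dy_add)

lemma dy_pow_sum: "(germ_dy ^^ m) (sum f A) = (\<Sum>i\<in>A. (germ_dy ^^ m) (f i))"
  by (induction A rule: infinite_finite_induct) (auto simp: dy_pow_zero dy_pow_add)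

lemma dy_pow_shear:
  assumes "univariate c" "germ_at0 c = 0"
  shows "(germ_dy ^^ m) (gsubst germ_X (germ_Y + c) f) = gsubst germ_X (germ_Y + c) ((germ_dy ^^ m) f)"
  by (induction m) (use assms in \<open>auto simp: germ_dx_subst germ_dy_X germ_dy_Y germ_dy_add germ_dy_univariate\<close>)

lemma dy_pow_subst_0:
  "(germ_dy ^^ m) (gsubst 0 germ_Y f) = gsubst 0 germ_Y ((germ_dy ^^ m) f)"
  by (induction m) (auto simp: germ_dx_subst germ_dy_Y)

lemma germ_dy_Y_power_mult:
  "germ_dy (germ_Y ^ Suc k * h) = germ_Y ^ k * (of_nat (Suc k) * h + germ_Y * germ_dy h)"
  unfolding germ_dy_mult germ_dy_power germ_dy_Y by (simp add: algebra_simps)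

lemma gsubst_of_nat: "germ_at0 u = 0 \<Longrightarrow> germ_at0 v = 0 \<Longrightarrow> gsubst u v (of_nat n) = of_nat n"
  unfolding germ_const_of_nat[symmetric] by (rule gsubst_const)

lemma germ_at0_of_nat [simp]: "germ_at0 (of_nat n) = of_nat n"
  unfolding germ_const_of_nat[symmetric] by simp

text \<open>The factor \<open>d\<close> is \<open>(k + 1) ... (k + m)\<close>; only its positivity
  matters, so it stays existential. The inner \<open>m\<close> derivatives are handled by the
  induction hypothesis with \<open>k + 1\<close> in place of \<open>k\<close>, which leaves one
  power of \<open>y\<close> for the last derivative.\<close>

lemma dy_pow_Y_power_mult:
  "\<exists>h'. (germ_dy ^^ m) (germ_Y ^ (k + m) * h) = germ_Y ^ k * h' \<and>
        (\<exists>d>0. gsubst germ_X 0 h' = of_nat d * gsubst germ_X 0 h)"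
proof (induction m arbitrary: k)
  case 0 then show ?case by (intro exI[of _ h]) (auto intro!: exI[of _ 1])
next
  case (Suc m)
  obtain h' d where h': "(germ_dy ^^ m) (germ_Y ^ (Suc k + m) * h) = germ_Y ^ Suc k * h'"
    "d > 0" "gsubst germ_X 0 h' = of_nat d * gsubst germ_X 0 h"
    using Suc.IH[of "Suc k"] by blast
  have "(germ_dy ^^ Suc m) (germ_Y ^ (k + Suc m) * h) = germ_Y ^ k * (of_nat (Suc k) * h' + germ_Y * germ_dy h')"
    using h'(1) germ_dy_Y_power_mult[of k h'] by simp
  moreover have "gsubst germ_X 0 (of_nat (Suc k) * h' + germ_Y * germ_dy h') = of_nat (Suc k * d) * gsubst germ_X 0 h"
    using h'(3) by (simp add: gsubst_simps gsubst_of_nat mult.assoc del: of_nat_Suc mult_Suc)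
  moreover have "Suc k * d > 0" using h'(2) by simp
  ultimately show ?case by blast
qed

lemma dy_pow_Y_power_mult_univariate:
  "univariate h \<Longrightarrow> j < m \<Longrightarrow> (germ_dy ^^ m) (germ_Y ^ j * h) = 0"
proof (induction j arbitrary: h m)
  case 0
  then obtain m' where "m = Suc m'" by (cases m) auto
  then show ?case using 0 by (simp add: funpow_Suc_right germ_dy_univariate dy_pow_zero del: funpow.simps)
next
  case (Suc j)
  then obtain m' where m': "m = Suc m'" "j < m'" by (cases m) auto
  have "univariate (of_nat (Suc j) * h)"
    unfolding germ_const_of_nat[symmetric] using Suc.prems by (intro univariate_intros)
  then show ?case using Suc.IH[of "of_nat (Suc j) * h" m'] m' germ_dy_Y_power_mult[of j h] Suc.prems
    by (simp add: funpow_Suc_right germ_dy_univariate del: funpow.simps)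
qed

lemma polynomial_coeffs_eq_0:
  "(\<Sum>j<n. germ_const (c j) * germ_Y ^ j) = germ_Y ^ n * w \<Longrightarrow> j < n \<Longrightarrow> c j = 0"
proof (induction n arbitrary: c j)
  case (Suc n)
  have eq: "germ_const (c 0) + germ_Y * (\<Sum>j<n. germ_const (c (Suc j)) * germ_Y ^ j) = germ_Y * (germ_Y ^ n * w)"
    using Suc.prems(1) by (simp add: sum.lessThan_Suc_shift sum_distrib_left mult_ac del: sum.lessThan_Suc)
  then have "germ_at0 (germ_const (c 0) + germ_Y * (\<Sum>j<n. germ_const (c (Suc j)) * germ_Y ^ j)) = germ_at0 (germ_Y * (germ_Y ^ n * w))"
    by simp
  then have c0: "c 0 = 0" by simp
  then have "germ_Y ^ 1 * (\<Sum>j<n. germ_const (c (Suc j)) * germ_Y ^ j) = germ_Y ^ 1 * (germ_Y ^ n * w)"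
    using eq by (simp add: germ_const_simps)
  then have "(\<Sum>j<n. germ_const (c (Suc j)) * germ_Y ^ j) = germ_Y ^ n * w"
    by (rule germ_Y_power_mult_cancel)
  then show ?case using Suc.IH[of "\<lambda>j. c (Suc j)" "j - 1"] c0 Suc.prems(2) by (cases j) auto
qed simp

section \<open>The Newton polygon step\<close>

abbreviation germ_poly :: "complex poly \<Rightarrow> germ" where
  "germ_poly P \<equiv> \<Sum>i\<le>Polynomial.degree P. germ_const (Polynomial.coeff P i) * germ_Y ^ i"

lemma represents_poly_Y:
  "represents (\<lambda>p. poly P (snd p)) (germ_poly P)"
  unfolding poly_altdef by (intro represents_sum represents_intros represents_power)

text \<open>After killing the coefficient of \<open>y ^ (n - 1)\<close>, the edge polynomial of the Newton polygon is
  not the \<open>n\<close>-th power of a linear polynomial, so all of its roots have multiplicity less than \<open>n\<close>.\<close>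

lemma edge_polynomial_root:
  fixes c :: "nat \<Rightarrow> complex"
  assumes n: "c (n - 1) = 0" "c n \<noteq> 0" and j0: "j0 < n" "c j0 \<noteq> 0"
  obtains a m Q where "0 < m" "m < n" "poly Q a \<noteq> 0"
    "\<And>z. (\<Sum>j\<le>n. c j * z ^ j) = (z - a) ^ m * poly Q z"
proof -
  define G where "G = (\<Sum>j\<le>n. Polynomial.monom (c j) j)"
  have coeff: "Polynomial.coeff G i = (if i \<le> n then c i else 0)" for i
    by (simp add: G_def coeff_sum)
  have G0: "G \<noteq> 0" using coeff[of n] n by auto
  have deg: "Polynomial.degree G = n"
    by (rule antisym) (use coeff n in \<open>auto intro!: degree_le le_degree\<close>)
  then have "\<not> constant (poly G)" using j0 by (simp add: constant_degree)
  then obtain a where a: "poly G a = 0" using Fundamental_Theorem_Algebra.fundamental_theorem_of_algebra by blast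
  define m where "m = Polynomial.order a G"
  obtain Q where Q: "G = [:- a, 1:] ^ m * Q" "\<not> [:- a, 1:] dvd Q"
    using order_decomp[OF G0, of a] by (auto simp: m_def)
  have Qa: "poly Q a \<noteq> 0" using Q(2) by (simp add: poly_eq_0_iff_dvd)
  have m0: "m > 0" using a G0 by (simp add: m_def order_root)
  have "Q \<noteq> 0" using Q(1) G0 by auto
  then have dm: "Polynomial.degree G = m + Polynomial.degree Q" using Q(1) by (simp add: degree_mult_eq degree_power_eq)
  \<comment> \<open>For \<open>m = n\<close> the polynomial would be \<open>q (z - a)^n\<close>. Its
    vanishing coefficient at \<open>n - 1\<close> forces \<open>a = 0\<close>, and
    \<open>q z^n\<close> has no lower term such as \<open>c j0\<close>.\<close>
  have "m \<noteq> n"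
  proof
    assume "m = n"
    then have "Polynomial.degree Q = 0" using dm deg by simp
    then obtain q where q: "Q = [:q:]" by (metis degree_eq_zeroE)
    have co: "Polynomial.coeff G i = q * (of_nat (n choose i) * (- a) ^ (n - i))" if "i \<le> n" for i
      using Q(1) q \<open>m = n\<close> that by (simp add: coeff_linear_poly_power)
    have "q \<noteq> 0" using \<open>Q \<noteq> 0\<close> q by simp
    have "n > 0" using j0 by simp
    have "n - (n - 1) = 1" "n choose (n - 1) = n" using \<open>n > 0\<close> by (cases n; simp)+
    then have "q * (of_nat n * - a) = 0" using co[of "n - 1"] coeff[of "n - 1"] n(1) by simp
    then have "a = 0" using \<open>q \<noteq> 0\<close> \<open>n > 0\<close> by simp
    then have "Polynomial.coeff G j0 = 0" using co[of j0] j0 by simp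
    then show False using coeff[of j0] j0 by simp
  qed
  then have "m < n" using dm deg by simp
  moreover have "(\<Sum>j\<le>n. c j * z ^ j) = (z - a) ^ m * poly Q z" for z
  proof -
    have "(\<Sum>j\<le>n. c j * z ^ j) = poly G z" by (simp add: G_def poly_sum poly_monom)
    then show ?thesis by (simp add: Q(1))
  qed
  ultimately show ?thesis using that m0 Qa by blast
qed

text \<open>Let \<open>v_j\<close> be the order of \<open>a j\<close>, and \<open>p / q\<close> the
  minimum of \<open>v_j / (n - j)\<close>. Replacing \<open>x\<close> by \<open>x^q\<close> and
  \<open>y\<close> by \<open>x^p (y + b)\<close> makes every term divisible by
  \<open>x^(p n)\<close>, and at \<open>x = 0\<close> the quotient is the edge polynomial at
  \<open>y + b\<close>. A root \<open>b\<close> of multiplicity \<open>m < n\<close> thus lowers the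
  order of regularity to \<open>m\<close>.\<close>

lemma newton_step:
  assumes f: "f = (\<Sum>j<n. a j * germ_Y ^ j) + germ_Y ^ n * h"
    and a: "\<And>j. univariate (a j)" "\<And>j. j < n \<Longrightarrow> germ_at0 (a j) = 0" "a (n - 1) = 0"
    and h: "germ_at0 h \<noteq> 0" and nz: "\<exists>j<n. a j \<noteq> 0"
  obtains p q b m g where "p > 0" "q > 0" "0 < m" "m < n" "y_regular m g"
    "gsubst (germ_X ^ q) (germ_X ^ p * (germ_Y + germ_const b)) f = germ_X ^ (p * n) * g"
proof -
  define J where "J = {j. j < n \<and> a j \<noteq> 0}"
  have "\<forall>j. \<exists>v u. a j \<noteq> 0 \<longrightarrow> univariate u \<and> germ_at0 u \<noteq> 0 \<and> a j = germ_X ^ v * u"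
    using univariate_factor a(1) by metis
  then obtain v u where vu: "\<And>j. a j \<noteq> 0 \<Longrightarrow> univariate (u j) \<and> germ_at0 (u j) \<noteq> 0 \<and> a j = germ_X ^ v j * u j"
    by metis
  have J: "finite J" "J \<noteq> {}" using nz by (auto simp: J_def)
  obtain j0 where j0: "j0 \<in> J" and min: "\<forall>j\<in>J. real (v j0) / real (n - j0) \<le> real (v j) / real (n - j)"
    using ex_is_arg_min_if_finite[OF J, of "\<lambda>j. real (v j) / real (n - j)"]
    by (auto simp: is_arg_min_linorder)
  define p where "p = v j0"
  define q where "q = n - j0"
  have j0n: "j0 < n" "a j0 \<noteq> 0" using j0 by (auto simp: J_def)
  have q: "q > 0" using j0n by (simp add: q_def)
  have p: "p > 0"
  proof (rule ccontr)
    assume "\<not> p > 0"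
    then have "germ_at0 (a j0) = germ_at0 (u j0)" using vu[OF j0n(2)] by (simp add: p_def)
    then show False using a(2)[OF j0n(1)] vu[OF j0n(2)] by simp
  qed
  have le: "p * (n - j) \<le> q * v j" if "j \<in> J" for j
  proof -
    have cross: "x * d \<le> y * z" if "x / y \<le> z / d" "y > 0" "d > 0" for x y z d :: real
      using that by (simp add: field_simps)
    have "j < n" using that by (simp add: J_def)
    then have "real p * real (n - j) \<le> real q * real (v j)"
      unfolding p_def q_def by (intro cross min[rule_format, OF that]) (use j0n in simp_all)
    then show ?thesis by (simp flip: of_nat_mult)
  qed
  \<comment> \<open>\<open>e j\<close> is \<open>a j\<close> at \<open>x^q\<close>, divided by
    \<open>x^(p (n - j))\<close>; by \<open>le\<close> the truncated subtraction is exact. The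
    remaining exponent is 0 exactly for the points on the edge, in particular for \<open>j0\<close>,
    so that \<open>c j0\<close> is nonzero.\<close>
  define e where "e j = (if j \<in> J then germ_X ^ (q * v j - p * (n - j)) * gsubst (germ_X ^ q) 0 (u j) else 0)" for j
  define c where "c j = (if j < n then germ_at0 (e j) else germ_at0 h)" for j
  have Xq: "germ_at0 (germ_X ^ q) = 0" using q by simp
  have "n - 1 \<notin> J" using a(3) by (simp add: J_def)
  moreover have "0 < n" using j0n by simp
  ultimately have c1: "c (n - 1) = 0" by (simp add: c_def e_def)
  have c2: "c n \<noteq> 0" using h by (simp add: c_def)
  have c3: "c j0 \<noteq> 0" using j0 j0n vu[OF j0n(2)] Xq by (simp add: c_def e_def p_def q_def mult.commute)
  obtain b m Q where m: "0 < m" "m < n" "poly Q b \<noteq> 0"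
    and root: "\<And>z. (\<Sum>j\<le>n. c j * z ^ j) = (z - b) ^ m * poly Q z"
    by (rule edge_polynomial_root[OF c1 c2 j0n(1) c3]) (rule that)
  define Z where "Z = germ_Y + germ_const b"
  have XZ: "germ_at0 (germ_X ^ p * Z) = 0" using p by simp
  define g where "g = (\<Sum>j<n. e j * Z ^ j) + Z ^ n * gsubst (germ_X ^ q) (germ_X ^ p * Z) h"
  have subst_a: "gsubst (germ_X ^ q) (germ_X ^ p * Z) (a j * germ_Y ^ j) = germ_X ^ (p * n) * (e j * Z ^ j)"
    if "j < n" for j
  proof (cases "j \<in> J")
    case True
    then have aj: "a j \<noteq> 0" by (simp add: J_def)
    have "gsubst (germ_X ^ q) (germ_X ^ p * Z) (a j * germ_Y ^ j) =
      ((germ_X ^ q) ^ v j * gsubst (germ_X ^ q) (germ_X ^ p * Z) (u j)) * (germ_X ^ p * Z) ^ j"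
      by (subst vu[OF aj, THEN conjunct2, THEN conjunct2]) (simp only: gsubst_simps[OF Xq XZ])
    also have "\<dots> = germ_X ^ (q * v j + p * j) * (gsubst (germ_X ^ q) 0 (u j) * Z ^ j)"
      using subst_univariate[OF _ Xq XZ] vu[OF aj]
      by (simp add: power_mult_distrib power_mult[symmetric] power_add mult_ac)
    also have "q * v j + p * j = p * n + (q * v j - p * (n - j))"
    proof -
      have "p * n = p * (n - j) + p * j" using that by (simp flip: distrib_left)
      then show ?thesis using le[OF True] by simp
    qed
    finally show ?thesis using True by (simp add: e_def power_add mult_ac)
  next
    case False
    then have "a j = 0" using that by (simp add: J_def)
    then show ?thesis using False by (simp add: e_def gsubst_zero[OF Xq XZ])
  qed
  have sf: "gsubst (germ_X ^ q) (germ_X ^ p * Z) f = germ_X ^ (p * n) * g"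
  proof -
    have "gsubst (germ_X ^ q) (germ_X ^ p * Z) f =
      (\<Sum>j<n. germ_X ^ (p * n) * (e j * Z ^ j)) + (germ_X ^ p * Z) ^ n * gsubst (germ_X ^ q) (germ_X ^ p * Z) h"
      unfolding f gsubst_add[OF Xq XZ] gsubst_sum[OF Xq XZ] gsubst_mult[OF Xq XZ, of "germ_Y ^ n"]
        gsubst_power[OF Xq XZ] gsubst_Y[OF Xq XZ]
      by (intro arg_cong2[where f = "(+)"] sum.cong refl subst_a) simp
    then show ?thesis unfolding g_def
      by (simp add: sum_distrib_left distrib_left power_mult_distrib power_mult mult.assoc)
  qed
  have e0: "gsubst 0 germ_Y (e j) = germ_const (germ_at0 (e j))" for j
  proof (rule subst_0_univariate)
    show "univariate (e j)" unfolding e_def using vu[of j] Xq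
      by (auto simp: J_def intro!: univariate_intros univariate_subst)
  qed simp
  have "gsubst 0 germ_Y g = (\<Sum>j<n. germ_const (germ_at0 (e j)) * Z ^ j) + Z ^ n * germ_const (germ_at0 h)"
    unfolding g_def using p q
    by (simp add: gsubst_simps gsubst_sum e0 Z_def gsubst_0_0 power_0_left)
  also have "\<dots> = (\<Sum>j\<le>n. germ_const (c j) * Z ^ j)"
    by (simp add: lessThan_Suc_atMost[symmetric] c_def mult.commute)
  also have "\<dots> = germ_Y ^ m * germ_poly (pcompose Q [:b, 1:])"
  proof (rule represents_eqI)
    show "represents (\<lambda>p. \<Sum>j\<le>n. c j * (snd p + b) ^ j) (\<Sum>j\<le>n. germ_const (c j) * Z ^ j)"
      unfolding Z_def by (intro represents_sum represents_intros represents_power)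
    show "represents (\<lambda>p. snd p ^ m * poly (pcompose Q [:b, 1:]) (snd p))
       (germ_Y ^ m * germ_poly (pcompose Q [:b, 1:]))"
      by (intro represents_intros represents_power represents_poly_Y)
    show "\<forall>\<^sub>F p in nhds (0 :: complex \<times> complex). (\<Sum>j\<le>n. c j * (snd p + b) ^ j) = snd p ^ m * poly (pcompose Q [:b, 1:]) (snd p)"
      by (simp add: root poly_pcompose add.commute)
  qed
  finally have g0: "gsubst 0 germ_Y g =
    germ_Y ^ m * germ_poly (pcompose Q [:b, 1:])" .
  have "germ_at0 (germ_poly (pcompose Q [:b, 1:])) \<noteq> 0"
    unfolding represents_at0[OF represents_poly_Y] using m(3) by (simp add: poly_pcompose)
  with g0 have "y_regular m g" unfolding y_regular_def by blast
  then show ?thesis using that[OF p q m(1,2) _ sf[unfolded Z_def]] by blast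
qed

text \<open>Induction on the order of regularity. The derivative of order \<open>n - 1\<close> in
  \<open>y\<close> has a simple zero in \<open>y\<close>, so the implicit function theorem gives its
  zero \<open>c(x)\<close>. The shear by \<open>c\<close> removes the coefficient of
  \<open>y^(n-1)\<close> (a Tschirnhaus transformation), and this is what makes the Newton step
  lower the order.\<close>

lemma puiseux_root:
  assumes "y_regular n f" "n > 0"
  shows "\<exists>N>0. \<exists>\<alpha>. univariate \<alpha> \<and> germ_at0 \<alpha> = 0 \<and> gsubst (germ_X ^ N) \<alpha> f = 0"
  using assms
proof (induction n arbitrary: f rule: less_induct)
  case (less n)
  obtain k where k: "n = Suc k" using less.prems by (cases n) auto
  obtain u where u: "germ_at0 u \<noteq> 0" "gsubst 0 germ_Y f = germ_Y ^ n * u"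
    using less.prems by (auto simp: y_regular_def)
  define D where "D = (germ_dy ^^ k) f"
  have "germ_at0 D = 0"
  proof -
    obtain h' where "(germ_dy ^^ k) (germ_Y ^ (1 + k) * u) = germ_Y ^ 1 * h'" using dy_pow_Y_power_mult by blast
    then have "gsubst 0 germ_Y D = germ_Y * h'" unfolding D_def dy_pow_subst_0[symmetric] u(2) k by simp
    then have "germ_at0 (gsubst 0 germ_Y D) = 0" by simp
    then show ?thesis by simp
  qed
  moreover have "germ_at0 (germ_dy D) \<noteq> 0"
  proof -
    obtain h' d where h': "(germ_dy ^^ n) (germ_Y ^ (0 + n) * u) = germ_Y ^ 0 * h'"
      "d > 0" "gsubst germ_X 0 h' = of_nat d * gsubst germ_X 0 u" using dy_pow_Y_power_mult by blast
    have "gsubst 0 germ_Y ((germ_dy ^^ n) f) = h'" unfolding dy_pow_subst_0[symmetric] u(2) using h'(1) by simp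
    then have "germ_at0 (gsubst 0 germ_Y (germ_dy D)) = germ_at0 (gsubst germ_X 0 h')" by (simp add: D_def k)
    then show ?thesis using h' u by simp
  qed
  ultimately obtain c where c: "univariate c" "germ_at0 c = 0" "gsubst germ_X c D = 0"
    using germ_implicit by blast
  define f1 where "f1 = gsubst germ_X (germ_Y + c) f"
  have f1_0: "gsubst 0 germ_Y f1 = germ_Y ^ n * u"
    unfolding f1_def using c u by (simp add: gsubst_simps subst_0_univariate germ_const_simps)
  obtain a h1 where a1: "\<And>j. univariate (a j)" and f1: "f1 = (\<Sum>j<k. a j * germ_Y ^ j) + germ_Y ^ k * h1"
    using taylor_y[of f1 k] by blast
  have "gsubst germ_X 0 ((germ_dy ^^ k) f1) = 0"
    unfolding f1_def dy_pow_shear[OF c(1,2)] D_def[symmetric]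
    using c by (simp add: gsubst_simps subst_X_univariate)
  moreover have "(germ_dy ^^ k) f1 = (germ_dy ^^ k) (germ_Y ^ k * h1)"
    unfolding f1 dy_pow_add dy_pow_sum using a1
    by (simp add: dy_pow_Y_power_mult_univariate mult.commute[of _ "germ_Y ^ _"])
  moreover obtain h' d where "(germ_dy ^^ k) (germ_Y ^ (0 + k) * h1) = germ_Y ^ 0 * h'" "d > 0"
    "gsubst germ_X 0 h' = of_nat d * gsubst germ_X 0 h1" using dy_pow_Y_power_mult by blast
  ultimately have "germ_const (of_nat d) * gsubst germ_X 0 h1 = 0" "d > 0"
    by (simp_all add: germ_const_of_nat)
  then have "gsubst germ_X 0 h1 = 0" using germ_const_mult_cancel[of "of_nat d"] by simp
  then obtain h where "h1 = germ_Y * h" using germ_Y_dvd by (auto simp: dvd_def)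
  define a' where "a' = a(k := 0)"
  have f1': "f1 = (\<Sum>j<n. a' j * germ_Y ^ j) + germ_Y ^ n * h"
    using f1 \<open>h1 = germ_Y * h\<close> by (simp add: k a'_def mult_ac)
  have a': "univariate (a' j)" for j using a1 by (simp add: a'_def univariate_intros)
  \<comment> \<open>At \<open>x = 0\<close> the expansion has to equal \<open>y^n u\<close>. This
    forces the coefficients below \<open>n\<close> to vanish at the origin and
    \<open>h(0, y)\<close> to be the unit \<open>u\<close>.\<close>
  have eq0: "(\<Sum>j<n. germ_const (germ_at0 (a' j)) * germ_Y ^ j) + germ_Y ^ n * gsubst 0 germ_Y h = germ_Y ^ n * u"
    unfolding f1_0[symmetric] f1' by (simp add: gsubst_simps gsubst_sum subst_0_univariate[OF a'])
  then have "(\<Sum>j<n. germ_const (germ_at0 (a' j)) * germ_Y ^ j) = germ_Y ^ n * (u - gsubst 0 germ_Y h)"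
    by (simp add: algebra_simps)
  from polynomial_coeffs_eq_0[OF this] have a'0: "germ_at0 (a' j) = 0" if "j < n" for j using that by blast
  then have "germ_Y ^ n * gsubst 0 germ_Y h = germ_Y ^ n * u" using eq0 by (simp add: germ_const_simps)
  then have "gsubst 0 germ_Y h = u" by (rule germ_Y_power_mult_cancel)
  then have h0: "germ_at0 h \<noteq> 0" using u by (metis germ_at0_subst germ_at0_simps(1,4))
  have "\<exists>N>0. \<exists>\<alpha>. univariate \<alpha> \<and> germ_at0 \<alpha> = 0 \<and> gsubst (germ_X ^ N) \<alpha> f1 = 0"
  proof (cases "\<exists>j<n. a' j \<noteq> 0")
    case False
    then have "f1 = germ_Y ^ n * h" using f1' by simp
    then have "gsubst (germ_X ^ 1) 0 f1 = 0" using less.prems by (simp add: gsubst_simps power_0_left)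
    then show ?thesis using univariate_intros(1) germ_at0_simps(1) zero_less_one by blast
  next
    case True
    have a'n: "a' (n - 1) = 0" by (simp add: a'_def k)
    obtain p q b m g
      where *: "p > 0" "q > 0" "0 < m" "m < n" "y_regular m g"
      "gsubst (germ_X ^ q) (germ_X ^ p * (germ_Y + germ_const b)) f1 = germ_X ^ (p * n) * g"
      by (rule newton_step[OF f1' a' _ a'n h0 True]) (rule a'0, assumption, rule that)
    obtain N \<alpha> where N: "N > 0" "univariate \<alpha>" "germ_at0 \<alpha> = 0" "gsubst (germ_X ^ N) \<alpha> g = 0"
      using less.IH[OF *(4,5,3)] by blast
    \<comment> \<open>The root \<open>\<alpha>\<close> of \<open>g\<close> is carried back through
      the Newton substitution; the ramification indices \<open>N\<close> and \<open>q\<close>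
      multiply.\<close>
    define \<beta> where "\<beta> = germ_X ^ (N * p) * (\<alpha> + germ_const b)"
    have "gsubst (germ_X ^ (N * q)) \<beta> f1 = gsubst (germ_X ^ N) \<alpha>
       (gsubst (germ_X ^ q) (germ_X ^ p * (germ_Y + germ_const b)) f1)"
      unfolding \<beta>_def using N *(1,2) by (simp add: gsubst_simps power_mult)
    also have "\<dots> = 0" unfolding *(6) using N by (simp add: gsubst_simps)
    finally have "gsubst (germ_X ^ (N * q)) \<beta> f1 = 0" .
    moreover have "univariate \<beta>" "germ_at0 \<beta> = 0" unfolding \<beta>_def using N *(1) by (auto intro!: univariate_intros)
    ultimately show ?thesis using N(1) *(2) by (intro exI[of _ "N * q"] conjI exI[of _ \<beta>]) auto
  qed
  then obtain N \<alpha> where N: "N > 0" "univariate \<alpha>" "germ_at0 \<alpha> = 0" "gsubst (germ_X ^ N) \<alpha> f1 = 0" by blast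
  have XN: "germ_at0 (germ_X ^ N) = 0" using N(1) by simp
  have "gsubst (germ_X ^ N) (\<alpha> + gsubst (germ_X ^ N) 0 c) f = 0"
    using N(4) N c XN unfolding f1_def by (simp add: gsubst_simps subst_univariate[OF c(1) XN N(3)])
  moreover have "univariate (\<alpha> + gsubst (germ_X ^ N) 0 c)"
    using N XN by (intro univariate_intros univariate_subst) auto
  moreover have "germ_at0 (\<alpha> + gsubst (germ_X ^ N) 0 c) = 0" using N XN c by simp
  ultimately show ?case using N(1) by blast
qed

text \<open>Split off one root and divide; the order of regularity drops by one. The quotient needs
  a further ramification \<open>M\<close>, along which the root found before is pulled back as
  \<open>\<beta>\<close>.\<close>

theorem puiseux_factorization:
  assumes "y_regular n f"
  shows "\<exists>N>0. \<exists>as u. length as = n \<and> (\<forall>\<alpha>\<in>set as. univariate \<alpha> \<and> germ_at0 \<alpha> = 0) \<and> germ_at0 u \<noteq> 0 \<and>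
     base_change N f = u * branch_prod as"
  using assms
proof (induction n arbitrary: f)
  case 0
  then have "germ_at0 (gsubst 0 germ_Y f) \<noteq> 0" by (auto simp: y_regular_def)
  then have "germ_at0 f \<noteq> 0" by simp
  then show ?case by (intro exI[of _ 1] conjI exI[of _ "[]"] exI[of _ f]) auto
next
  case (Suc n)
  obtain N \<alpha> where N: "N > 0" "univariate \<alpha>" "germ_at0 \<alpha> = 0" "gsubst (germ_X ^ N) \<alpha> f = 0"
    using puiseux_root[OF Suc.prems] by blast
  define F where "F = base_change N f"
  have "gsubst germ_X \<alpha> F = 0" unfolding F_def using N by (simp add: gsubst_simps)
  then obtain f1 where f1: "F = (germ_Y - \<alpha>) * f1" using Y_minus_dvd_iff[OF N(2,3)] by (auto simp: dvd_def)
  obtain u where u: "germ_at0 u \<noteq> 0" "gsubst 0 germ_Y f = germ_Y ^ Suc n * u"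
    using Suc.prems by (auto simp: y_regular_def)
  have "gsubst 0 germ_Y F = gsubst 0 germ_Y f" unfolding F_def using N by (simp add: gsubst_simps power_0_left)
  moreover have "gsubst 0 germ_Y F = germ_Y * gsubst 0 germ_Y f1"
    unfolding f1 using N by (simp add: gsubst_simps subst_0_univariate germ_const_simps)
  ultimately have "germ_Y ^ 1 * gsubst 0 germ_Y f1 = germ_Y ^ 1 * (germ_Y ^ n * u)" using u by (simp add: mult.assoc)
  then have "gsubst 0 germ_Y f1 = germ_Y ^ n * u" by (rule germ_Y_power_mult_cancel)
  then have "y_regular n f1" using u by (auto simp: y_regular_def)
  then obtain M as w where M: "M > 0" "length as = n" "\<forall>\<alpha>\<in>set as. univariate \<alpha> \<and> germ_at0 \<alpha> = 0" "germ_at0 w \<noteq> 0"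
     "base_change M f1 = w * branch_prod as" using Suc.IH by blast
  define \<beta> where "\<beta> = gsubst (germ_X ^ M) 0 \<alpha>"
  have XM: "germ_at0 (germ_X ^ M) = 0" using M by simp
  have "gsubst (germ_X ^ (M * N)) germ_Y f = base_change M F"
    unfolding F_def using N M by (simp add: gsubst_simps power_mult)
  also have "\<dots> = (germ_Y - \<beta>) * base_change M f1"
    unfolding f1 \<beta>_def using XM N by (simp add: gsubst_simps subst_univariate[OF N(2) XM germ_at0_simps(4)])
  also have "\<dots> = w * branch_prod (\<beta> # as)" unfolding M(5) by (simp add: mult_ac)
  finally have "gsubst (germ_X ^ (M * N)) germ_Y f = w * branch_prod (\<beta> # as)" .
  moreover have "univariate \<beta>" "germ_at0 \<beta> = 0" unfolding \<beta>_def using XM N by (auto intro!: univariate_intros univariate_subst)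
  moreover have "length (\<beta> # as) = Suc n" using M by simp
  ultimately show ?case using M N by (intro exI[of _ "M * N"] conjI exI[of _ "\<beta> # as"] exI[of _ w]) auto
qed

section \<open>The polar curve\<close>

lemma y_regular_germ_dy:
  assumes "y_regular (Suc n) f" shows "y_regular n (germ_dy f)"
proof -
  obtain u where u: "germ_at0 u \<noteq> 0" "gsubst 0 germ_Y f = germ_Y ^ Suc n * u"
    using assms by (auto simp: y_regular_def)
  have "gsubst 0 germ_Y (germ_dy f) = germ_Y ^ n * (of_nat (Suc n) * u + germ_Y * germ_dy u)"
    using dy_pow_subst_0[of 1 f] u(2) germ_dy_Y_power_mult[of n u] by simp
  moreover have "germ_at0 (of_nat (Suc n) * u + germ_Y * germ_dy u) \<noteq> 0"
    using u(1) by (simp del: of_nat_Suc)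
  ultimately show ?thesis unfolding y_regular_def by blast
qed

lemma enat_mult_cancel: "N > 0 \<Longrightarrow> of_nat N * a = of_nat N * b \<Longrightarrow> a = (b :: enat)"
  by (cases a; cases b) (auto simp: of_nat_eq_enat zero_enat_def imult_is_infinity)

text \<open>Along a branch \<open>\<alpha>\<close> of the polar curve \<open>\<phi>\<^sub>y = 0\<close> the chain rule loses the term \<open>\<phi>\<^sub>y\<close>, so
  the orders of \<open>\<phi>\<close> and \<open>\<phi>\<^sub>x\<close> on it differ by the order of \<open>x\<close>.\<close>

lemma colength_polar:
  assumes "y_regular (Suc n) \<phi>"
  shows "colength (germ_dy \<phi>) \<phi> = colength (germ_dy \<phi>) (germ_dx \<phi>) + of_nat n"
proof -
  obtain N as u where N: "N > 0" "length as = n" and as: "\<forall>\<alpha>\<in>set as. univariate \<alpha> \<and> germ_at0 \<alpha> = 0"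
    and u: "germ_at0 u \<noteq> 0"
    and fac: "base_change N (germ_dy \<phi>) = u * branch_prod as"
    using puiseux_factorization[OF y_regular_germ_dy[OF assms]] by blast
  have XN: "germ_at0 (germ_X ^ N) = 0" using N by simp
  have branch: "uord (gsubst (germ_X ^ N) \<alpha> \<phi>) = uord (gsubst (germ_X ^ N) \<alpha> (germ_dx \<phi>)) + of_nat N"
    if "\<alpha> \<in> set as" for \<alpha>
  proof -
    have \<alpha>: "univariate \<alpha>" "germ_at0 \<alpha> = 0" using as that by auto
    define F where "F = gsubst (germ_X ^ N) \<alpha> \<phi>"
    define G where "G = gsubst (germ_X ^ N) \<alpha> (germ_dx \<phi>)"
    have F: "univariate F" "germ_at0 F = 0" and G: "univariate G"
      unfolding F_def G_def using XN \<alpha> y_regular_at0[OF assms] by (auto intro!: univariate_subst univariate_intros)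
    have "gsubst (germ_X ^ N) \<alpha> (germ_dy \<phi>) = gsubst germ_X \<alpha> (base_change N (germ_dy \<phi>))"
      using \<alpha> N by (simp add: gsubst_simps)
    also have "\<dots> = 0"
    proof -
      have "(germ_Y - \<alpha>) dvd branch_prod as"
        using that by (intro prod_list_dvd) auto
      then have "(germ_Y - \<alpha>) dvd u * branch_prod as" by (rule dvd_mult)
      then show ?thesis unfolding fac using Y_minus_dvd_iff[OF \<alpha>] by blast
    qed
    finally have "germ_dx F = G * (of_nat N * germ_X ^ (N - 1))"
      unfolding F_def G_def germ_dx_subst[OF XN \<alpha>(2)] using germ_dx_power[of germ_X "N - 1"] N
      by (simp add: germ_dx_X)
    then have "uord (germ_dx F) = uord G + uord (of_nat N * germ_X ^ (N - 1))"
      using uord_mult[OF G] by (simp add: univariate_intros germ_const_of_nat[symmetric])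
    also have "uord (of_nat N * germ_X ^ (N - 1)) = enat (N - 1)"
      using uord_X_power_mult[of "of_nat N" "N - 1"] N by (simp add: mult.commute)
    \<comment> \<open>\<open>N - 1\<close> comes from the derivative of \<open>x^N\<close> and the
      last 1 from differentiating \<open>F\<close>. Together they give \<open>N\<close> on each of
      the \<open>n\<close> branches, hence the summand \<open>n\<close> once \<open>N\<close> is
      cancelled.\<close>
    finally have "uord F = uord G + enat (N - 1) + 1" using uord_deriv[OF F] by simp
    then show ?thesis using N by (simp add: F_def G_def add.assoc one_enat_def of_nat_eq_enat)
  qed
  have "of_nat N * colength (germ_dy \<phi>) \<phi> = sum_list (map (\<lambda>\<alpha>. uord (gsubst (germ_X ^ N) \<alpha> \<phi>)) as)"
    by (rule colength_branches[OF N(1) fac as u])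
  also have "\<dots> = sum_list (map (\<lambda>\<alpha>. uord (gsubst (germ_X ^ N) \<alpha> (germ_dx \<phi>)) + of_nat N) as)"
    using branch by (intro arg_cong[where f = sum_list] map_cong) auto
  also have "\<dots> = sum_list (map (\<lambda>\<alpha>. uord (gsubst (germ_X ^ N) \<alpha> (germ_dx \<phi>))) as) + of_nat n * of_nat N"
    by (simp add: sum_list_addf sum_list_triv N(2))
  also have "\<dots> = of_nat N * (colength (germ_dy \<phi>) (germ_dx \<phi>) + of_nat n)"
    unfolding colength_branches[OF N(1) fac as u, symmetric] by (simp add: distrib_left mult.commute)
  finally show ?thesis by (rule enat_mult_cancel[OF N(1)])
qed

section \<open>Parametrized curves\<close>

lemma represents_univariate:
  assumes h: "univariate h"
  obtains f where "f analytic_on {0}" "represents (\<lambda>p. f (fst p)) h"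
proof -
  define F where "F = rep_germ h"
  have F: "represents F h" unfolding F_def by (rule represents_rep_germ)
  obtain R where R: "R > 0" "sep_holo R F" using holo_near0_imp_sep_holo[OF represents_holo[OF F]] .
  have "(\<lambda>x. F (x, 0)) holomorphic_on ball 0 R" using R by (auto simp: sep_holo_def)
  then have "(\<lambda>x. F (x, 0)) analytic_on {0}" using R(1) by (auto simp: analytic_on_def)
  moreover have "represents (\<lambda>p. F (fst p, 0)) (gsubst germ_X 0 h)"
    by (rule represents_subst[OF represents_intros(4,1) F]) auto
  ultimately show ?thesis using that h by (simp add: univariate_def)
qed

section \<open>Roots and compositional inverses in one variable\<close>

lemma germ_root_exists:
  assumes w: "univariate w" "germ_at0 w \<noteq> 0" and k: "k > 0"
  obtains r where "univariate r" "germ_at0 r \<noteq> 0" "r ^ k = w"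
proof -
  obtain f where f: "f analytic_on {0}" "represents (\<lambda>p. f (fst p)) w" using represents_univariate[OF w(1)] .
  have f0: "f 0 \<noteq> 0" using represents_at0[OF f(2)] w(2) by simp
  \<comment> \<open>Division by \<open>f 0\<close> keeps the argument of the first logarithm near 1,
    away from the branch cut; \<open>Ln (f 0)\<close> restores the factor.\<close>
  define g where "g x = exp ((Ln (f x / f 0) + Ln (f 0)) / of_nat k)" for x
  have g: "g analytic_on {0}" unfolding g_def
    by (intro analytic_intros f) (use f0 k in \<open>auto simp: complex_nonpos_Reals_iff\<close>)
  have rg: "represents (\<lambda>p. g (fst p)) (abs_germ (\<lambda>p. g (fst p)))" by (rule represents_analytic[OF g])
  have "isCont f 0" using f(1) by (intro analytic_at_imp_isCont) simp
  then have "(f \<longlongrightarrow> f 0) (nhds 0)" by (simp add: isCont_def tendsto_at_iff_tendsto_nhds)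
  then have "\<forall>\<^sub>F x in nhds 0. f x \<noteq> 0" using f0 tendsto_imp_eventually_ne by blast
  then have "\<forall>\<^sub>F x in nhds 0. g x ^ k = f x"
  proof eventually_elim
    case (elim x)
    have "g x ^ k = exp (Ln (f x / f 0) + Ln (f 0))" using k by (simp add: g_def exp_of_nat_mult[symmetric])
    also have "\<dots> = f x" using elim f0 by (simp add: exp_add)
    finally show ?case .
  qed
  then have "abs_germ (\<lambda>p. g (fst p)) ^ k = w"
    by (intro represents_eqI[OF represents_power[OF rg] f(2)] eventually_nhds_0_fst)
  moreover have "germ_at0 (abs_germ (\<lambda>p. g (fst p))) \<noteq> 0" using represents_at0[OF rg] by (simp add: g_def)
  ultimately show ?thesis using that univariate_abs_germ[OF g] by blast
qed

lemma germ_right_inverse: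
  assumes \<sigma>: "univariate \<sigma>" "germ_at0 \<sigma> = 0" "germ_at0 (germ_dx \<sigma>) \<noteq> 0"
  obtains \<tau> where "univariate \<tau>" "germ_at0 \<tau> = 0" "germ_at0 (germ_dx \<tau>) \<noteq> 0" "gsubst \<tau> 0 \<sigma> = germ_X"
proof -
  \<comment> \<open>Solving \<open>\<sigma>(y) - x = 0\<close> for \<open>y\<close> yields the
    inverse.\<close>
  define F where "F = gsubst germ_Y 0 \<sigma> - germ_X"
  have F: "gsubst germ_Y 0 \<sigma> = F + germ_X" by (simp add: F_def)
  have "germ_dy (gsubst germ_Y 0 \<sigma>) = germ_dy F" unfolding F germ_dy_add germ_dy_X by simp
  then have "germ_dy F = gsubst germ_Y 0 (germ_dx \<sigma>)" by (simp add: germ_dx_subst germ_dy_Y)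
  then have "germ_at0 (germ_dy F) \<noteq> 0" using \<sigma> by simp
  moreover have "germ_at0 F = 0" using \<sigma> by (simp add: F_def)
  ultimately obtain \<tau> where \<tau>: "univariate \<tau>" "germ_at0 \<tau> = 0" "gsubst germ_X \<tau> F = 0"
    using germ_implicit by blast
  have inv: "gsubst \<tau> 0 \<sigma> = germ_X" using \<tau> unfolding F_def by (simp add: gsubst_simps)
  then have "germ_dx (gsubst \<tau> 0 \<sigma>) = 1" by (simp add: germ_dx_X)
  then have "gsubst \<tau> 0 (germ_dx \<sigma>) * germ_dx \<tau> = 1" using \<tau> by (simp add: germ_dx_subst)
  then have "germ_at0 (gsubst \<tau> 0 (germ_dx \<sigma>) * germ_dx \<tau>) = 1" by simp
  then have "germ_at0 (germ_dx \<tau>) \<noteq> 0" by auto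
  then show ?thesis using that \<tau> inv by blast
qed

lemma germ_inverse:
  assumes \<sigma>: "univariate \<sigma>" "germ_at0 \<sigma> = 0" "germ_at0 (germ_dx \<sigma>) \<noteq> 0"
  obtains \<tau> where "univariate \<tau>" "germ_at0 \<tau> = 0" "germ_at0 (germ_dx \<tau>) \<noteq> 0"
    "gsubst \<tau> 0 \<sigma> = germ_X" "gsubst \<sigma> 0 \<tau> = germ_X"
proof -
  obtain \<tau> where \<tau>: "univariate \<tau>" "germ_at0 \<tau> = 0" "germ_at0 (germ_dx \<tau>) \<noteq> 0" "gsubst \<tau> 0 \<sigma> = germ_X"
    by (rule germ_right_inverse[OF \<sigma>])
  obtain \<rho> where \<rho>: "germ_at0 \<rho> = 0" "gsubst \<rho> 0 \<tau> = germ_X"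
    by (rule germ_right_inverse[OF \<tau>(1-3)])
  have "\<rho> = gsubst \<rho> 0 (gsubst \<tau> 0 \<sigma>)" unfolding \<tau>(4) using \<rho> by (simp add: gsubst_simps)
  also have "\<dots> = \<sigma>" using \<rho> \<tau>(2) \<sigma>(1) by (simp add: gsubst_simps univariate_def)
  finally show ?thesis using that \<tau> \<rho> by blast
qed

lemma uord_dx_ne_0: "univariate \<tau> \<Longrightarrow> germ_at0 \<tau> = 0 \<Longrightarrow> germ_at0 (germ_dx \<tau>) \<noteq> 0 \<Longrightarrow> uord \<tau> = 1"
  by (simp add: uord_deriv uord_unit)

text \<open>The rotation multiplies the \<open>m\<close>-th component by \<open>\<omega>^m\<close>,
  so by uniqueness of the components invariance kills all those with
  \<open>\<omega>^m \<noteq> 1\<close>.\<close>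

lemma germ_rotation_split:
  assumes k: "k > 0" and \<omega>: "\<omega> ^ k = 1" and W: "gsubst (germ_const \<omega> * germ_X) germ_Y W = W"
  obtains h where "W = (\<Sum>m<k. germ_X ^ m * base_change k (h m))"
    "\<And>m. m < k \<Longrightarrow> \<omega> ^ m \<noteq> 1 \<Longrightarrow> h m = 0"
proof -
  obtain h where h: "W = (\<Sum>m<k. germ_X ^ m * base_change k (h m))"
    using germ_split_exists[OF k] by blast
  have Xk: "(germ_const \<omega> * germ_X) ^ k = germ_X ^ k"
    using \<omega> by (simp add: power_mult_distrib germ_const_power[symmetric] germ_const_simps)
  have "gsubst (germ_const \<omega> * germ_X) germ_Y W =
      (\<Sum>m<k. germ_X ^ m * base_change k (germ_const (\<omega> ^ m) * h m))"
  proof -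
    have "gsubst (germ_const \<omega> * germ_X) germ_Y (germ_X ^ m * base_change k (h m)) =
      germ_X ^ m * base_change k (germ_const (\<omega> ^ m) * h m)" for m
      using k by (simp add: gsubst_simps Xk) (simp add: power_mult_distrib germ_const_power mult_ac)
    then show ?thesis unfolding h by (simp add: gsubst_sum)
  qed
  then have "(\<Sum>m<k. germ_X ^ m * base_change k (germ_const (\<omega> ^ m) * h m)) -
     (\<Sum>m<k. germ_X ^ m * base_change k (h m)) = 0" using W h by simp
  then have "(\<Sum>m<k. germ_X ^ m * base_change k (germ_const (\<omega> ^ m - 1) * h m)) = 0"
    using k by (simp add: sum_subtractf[symmetric] gsubst_simps germ_const_simps algebra_simps)
  then have z: "germ_const (\<omega> ^ m - 1) * h m = 0" if "m < k" for m
    using germ_split_unique[OF k _ that, of "\<lambda>m. germ_const (\<omega> ^ m - 1) * h m"] by blast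
  have "h m = 0" if "m < k" "\<omega> ^ m \<noteq> 1" for m
    by (rule germ_const_mult_cancel[OF _ z[OF that(1)]]) (use that in simp)
  then show ?thesis using that h by blast
qed

lemma germ_rotation_descent:
  assumes k: "k > 0" and \<zeta>: "\<zeta> ^ k = 1" "\<And>m. \<zeta> ^ m = 1 \<longleftrightarrow> k dvd m"
    and W: "gsubst (germ_const \<zeta> * germ_X) germ_Y W = W"
  obtains w where "W = base_change k w"
proof -
  obtain h where h: "W = (\<Sum>m<k. germ_X ^ m * base_change k (h m))"
    "\<And>m. m < k \<Longrightarrow> \<zeta> ^ m \<noteq> 1 \<Longrightarrow> h m = 0" by (rule germ_rotation_split[OF k \<zeta>(1) W]) (rule that)
  have h0: "h m = 0" if "m < k" "m \<noteq> 0" for m using h(2)[OF that(1)] \<zeta>(2)[of m] that by (auto dest: dvd_imp_le)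
  have "W = base_change k (h 0)"
    unfolding h(1) using k h0 by (subst sum.remove[of _ 0]) (auto intro!: sum.neutral simp: gsubst_zero)
  then show ?thesis by (rule that)
qed

text \<open>After division by \<open>y - \<alpha>\<close>, a further root \<open>\<beta>\<close> is
  still a root of the quotient: \<open>\<beta> - \<alpha>\<close> is nonzero and germs in
  \<open>x\<close> have no zero divisors.\<close>

lemma prod_Y_minus_dvd:
  assumes "distinct as" "\<forall>\<alpha>\<in>set as. univariate \<alpha> \<and> germ_at0 \<alpha> = 0 \<and> gsubst germ_X \<alpha> F = 0"
  shows "branch_prod as dvd F"
  using assms
proof (induction as arbitrary: F)
  case (Cons \<alpha> as)
  have \<alpha>: "univariate \<alpha>" "germ_at0 \<alpha> = 0" using Cons.prems by auto
  obtain F1 where F1: "F = (germ_Y - \<alpha>) * F1" using Y_minus_dvd_iff[OF \<alpha>, of F] Cons.prems by (auto simp: dvd_def)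
  have "gsubst germ_X \<beta> F1 = 0" if "\<beta> \<in> set as" for \<beta>
  proof -
    have \<beta>: "univariate \<beta>" "germ_at0 \<beta> = 0" "gsubst germ_X \<beta> F = 0" "\<beta> \<noteq> \<alpha>" using Cons.prems that by auto
    have "(\<beta> - \<alpha>) * gsubst germ_X \<beta> F1 = 0"
      using \<beta> unfolding F1 by (simp add: gsubst_simps subst_X_univariate[OF \<alpha>(1)])
    then show ?thesis using univariate_mult_eq_0[of "\<beta> - \<alpha>" "gsubst germ_X \<beta> F1"] \<alpha> \<beta>
      by (simp add: univariate_intros univariate_subst)
  qed
  then have "branch_prod as dvd F1" using Cons by auto
  then show ?case unfolding F1 by (simp add: mult_dvd_mono)
qed simp

lemma prod_Y_minus_cancel:
  assumes "\<forall>\<alpha>\<in>set as. univariate \<alpha> \<and> germ_at0 \<alpha> = 0"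
    and "branch_prod as * f = branch_prod as * g"
  shows "f = g"
  using assms
proof (induction as)
  case (Cons \<alpha> as)
  let ?P = "branch_prod as"
  have \<alpha>: "univariate \<alpha>" "germ_at0 \<alpha> = 0" and as: "\<forall>\<alpha>\<in>set as. univariate \<alpha> \<and> germ_at0 \<alpha> = 0"
    using Cons.prems(1) by auto
  have "(germ_Y - \<alpha>) * (?P * f) = (germ_Y - \<alpha>) * (?P * g)"
    using Cons.prems(2) by (simp add: mult.assoc)
  then have "?P * f = ?P * g" by (rule Y_minus_mult_cancel[OF \<alpha>])
  then show ?case by (rule Cons.IH[OF as])
qed simp

text \<open>The last conjunct of \<open>puiseux_parametrization\<close>, transcribed from functions
  to germs.\<close>

definition primitive_curve :: "germ \<Rightarrow> germ \<Rightarrow> bool" where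
  "primitive_curve u v \<longleftrightarrow> (\<nexists>a b \<tau>. univariate \<tau> \<and> germ_at0 \<tau> = 0 \<and> germ_at0 (germ_dx \<tau>) = 0 \<and>
      univariate a \<and> univariate b \<and> u = gsubst \<tau> 0 a \<and> v = gsubst \<tau> 0 b)"

text \<open>Invariance under \<open>\<zeta>^d\<close> leaves only exponents divisible by its order
  \<open>e = k / gcd(d, k)\<close>, and \<open>e\<close> is at least 2 as \<open>0 < d < k\<close>.
  Then both \<open>x^k\<close> and \<open>\<eta>\<close> are germs in \<open>x^e\<close>, so the
  curve \<open>(x^k, \<eta>(x))\<close> is not primitive.\<close>

lemma rotation_invariant_imp_power:
  assumes k: "k > 0" and \<zeta>: "\<zeta> ^ k = 1" "\<And>m. \<zeta> ^ m = 1 \<longleftrightarrow> k dvd m"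
    and d: "0 < d" "d < k" and \<eta>: "univariate \<eta>" "gsubst (germ_const (\<zeta> ^ d) * germ_X) 0 \<eta> = \<eta>"
  obtains e l b where "k = e * l" "e \<ge> 2" "univariate b" "\<eta> = gsubst (germ_X ^ e) 0 b"
proof -
  define l where "l = gcd d k"
  define e where "e = k div l"
  have l: "l > 0" "l dvd k" "l dvd d" "l < k" using d k by (auto simp: l_def gcd_pos_nat intro: le_less_trans[OF gcd_le1_nat])
  have kel: "k = e * l" using l by (simp add: e_def)
  have "e \<noteq> 0" "e \<noteq> 1" using kel k l by (auto intro!: Nat.gr0I)
  then have e2: "e \<ge> 2" by simp
  have "(\<zeta> ^ d) ^ k = 1" using \<zeta>(2)[of "d * k"] by (simp add: power_mult)
  moreover have "gsubst (germ_const (\<zeta> ^ d) * germ_X) germ_Y \<eta> = \<eta>"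
    using \<eta> subst_univariate[OF \<eta>(1), of "germ_const (\<zeta> ^ d) * germ_X" germ_Y] by simp
  ultimately obtain h where h: "\<eta> = (\<Sum>m<k. germ_X ^ m * base_change k (h m))"
    "\<And>m. m < k \<Longrightarrow> (\<zeta> ^ d) ^ m \<noteq> 1 \<Longrightarrow> h m = 0" by (rule germ_rotation_split[OF k]) (rule that)
  have h0: "h m = 0" if "m < k" "\<not> e dvd m" for m
  proof (rule h(2)[OF that(1)])
    show "(\<zeta> ^ d) ^ m \<noteq> 1"
    proof
      assume "(\<zeta> ^ d) ^ m = 1"
      then have "k dvd d * m" using \<zeta>(2)[of "d * m"] by (simp add: power_mult)
      moreover have "d = (d div l) * l" using l(3) by simp
      ultimately have "e * l dvd ((d div l) * m) * l" using kel by (metis mult.assoc mult.commute)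
      then have "e dvd (d div l) * m" using l by simp
      moreover have "coprime e (d div l)"
        unfolding e_def l_def using div_gcd_coprime[of d k] d by (simp add: coprime_commute)
      ultimately have "e dvd m" using coprime_dvd_mult_right_iff by blast
      then show False using that by simp
    qed
  qed
  \<comment> \<open>As \<open>x^k = (x^e)^l\<close>, each surviving term
    \<open>x^m h(x^k, 0)\<close> is \<open>x^(m div e) h(x^l, 0)\<close> with \<open>x^e\<close> put
    for \<open>x\<close>.\<close>
  define b where "b = (\<Sum>m<k. if e dvd m then germ_X ^ (m div e) * gsubst (germ_X ^ l) 0 (h m) else 0)"
  have "univariate b" unfolding univariate_def b_def using l
    by (auto simp: gsubst_sum gsubst_simps intro!: sum.cong)
  moreover have "\<eta> = gsubst (germ_X ^ e) 0 b"
  proof -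
    have "\<eta> = gsubst germ_X 0 \<eta>" using \<eta> by (simp add: univariate_def)
    also have "\<dots> = (\<Sum>m<k. germ_X ^ m * gsubst (germ_X ^ k) 0 (h m))"
      by (subst h(1)) (use k in \<open>simp add: gsubst_sum gsubst_simps\<close>)
    also have "\<dots> = (\<Sum>m<k. gsubst (germ_X ^ e) 0 (if e dvd m then germ_X ^ (m div e) * gsubst (germ_X ^ l) 0 (h m) else 0))"
    proof (rule sum.cong)
      fix m assume "m \<in> {..<k}"
      then show "germ_X ^ m * gsubst (germ_X ^ k) 0 (h m) =
        gsubst (germ_X ^ e) 0 (if e dvd m then germ_X ^ (m div e) * gsubst (germ_X ^ l) 0 (h m) else 0)"
        using h0[of m] e2 l k by (auto simp: gsubst_simps power_mult[symmetric] kel)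
    qed simp
    also have "\<dots> = gsubst (germ_X ^ e) 0 b" unfolding b_def using e2 by (simp add: gsubst_sum)
    finally show ?thesis .
  qed
  ultimately show ?thesis using that kel e2 by blast
qed

section \<open>The conjugates \<open>\<eta>(\<zeta>^i x)\<close> of a primitive branch
  \<open>(x^k, \<eta>(x))\<close>\<close>

context
  fixes k :: nat and \<eta> \<phi> :: germ and \<zeta> :: complex
  assumes k: "k > 0" and \<zeta>: "\<zeta> ^ k = 1" "\<And>m. \<zeta> ^ m = 1 \<longleftrightarrow> k dvd m"
    and \<eta>: "univariate \<eta>" "germ_at0 \<eta> = 0"
    and prim: "\<And>e l b. k = e * l \<Longrightarrow> e \<ge> 2 \<Longrightarrow> univariate b \<Longrightarrow> \<eta> \<noteq> gsubst (germ_X ^ e) 0 b"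
    and \<phi>: "gsubst (germ_X ^ k) \<eta> \<phi> = 0" "Factorial_Ring.irreducible \<phi>"
begin

definition conj_branch :: "nat \<Rightarrow> germ" where
  "conj_branch i = gsubst (germ_const (\<zeta> ^ i) * germ_X) 0 \<eta>"

lemma conj_branch_univariate: "univariate (conj_branch i)" "germ_at0 (conj_branch i) = 0"
  unfolding conj_branch_def using \<eta> by (auto intro!: univariate_subst univariate_intros)

lemma conj_branch_period: "conj_branch (i + k) = conj_branch i"
  unfolding conj_branch_def using \<zeta>(1) by (simp add: power_add)

lemma conj_branch_0: "conj_branch 0 = \<eta>"
  unfolding conj_branch_def using \<eta> by (simp add: germ_const_simps univariate_def)

lemma conj_branch_rotate:
  "gsubst (germ_const (\<zeta> ^ j) * germ_X) v (conj_branch i) = conj_branch (i + j)" if "germ_at0 v = 0"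
proof -
  have "gsubst (germ_const (\<zeta> ^ j) * germ_X) v (conj_branch i) =
    gsubst (germ_const (\<zeta> ^ i) * (germ_const (\<zeta> ^ j) * germ_X)) 0 \<eta>"
  proof -
    have 0: "germ_at0 (germ_const (\<zeta> ^ j) * germ_X) = 0" "germ_at0 (germ_const (\<zeta> ^ i) * germ_X) = 0" "germ_at0 0 = 0"
      by simp_all
    show ?thesis unfolding conj_branch_def gsubst_subst[OF 0(1) that 0(2,3)] gsubst_zero[OF 0(1) that]
        gsubst_mult[OF 0(1) that] gsubst_const[OF 0(1) that] gsubst_X[OF 0(1) that] ..
  qed
  also have "germ_const (\<zeta> ^ i) * (germ_const (\<zeta> ^ j) * germ_X) = germ_const (\<zeta> ^ (i + j)) * germ_X"
    unfolding power_add germ_const_simps(5) mult.assoc ..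
  finally show ?thesis unfolding conj_branch_def .
qed

lemma conj_branch_subst:
  "gsubst (germ_X ^ k) (conj_branch i) f = gsubst (germ_const (\<zeta> ^ i) * germ_X) 0 (gsubst (germ_X ^ k) \<eta> f)"
proof -
  have "(germ_const (\<zeta> ^ i) * germ_X) ^ k = germ_X ^ k"
    using \<zeta>(2)[of "i * k"] by (simp add: power_mult_distrib germ_const_power[symmetric] power_mult[symmetric] germ_const_simps)
  then show ?thesis using \<eta> k by (simp add: gsubst_simps conj_branch_def)
qed

lemma conj_branch_inj: "inj_on conj_branch {..<k}"
proof -
  have False if "i < j" "j < k" "conj_branch i = conj_branch j" for i j
  proof -
    have 0: "germ_at0 0 = 0" by simp
    \<comment> \<open>Shifting both indices by \<open>k - i\<close> moves the first one to a full
      period and keeps the difference \<open>j - i\<close>, without negative exponents.\<close>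
    have "conj_branch (i + (k - i)) = conj_branch (j + (k - i))"
      unfolding conj_branch_rotate[OF 0, symmetric] that(3) ..
    moreover have "i + (k - i) = 0 + k" "j + (k - i) = (j - i) + k" using that by simp_all
    ultimately have "conj_branch 0 = conj_branch (j - i)" by (simp only: conj_branch_period)
    then have rot: "gsubst (germ_const (\<zeta> ^ (j - i)) * germ_X) 0 \<eta> = \<eta>"
      by (simp add: conj_branch_0) (simp add: conj_branch_def)
    have "0 < j - i" "j - i < k" using that by simp_all
    then obtain e l b where "k = e * l" "e \<ge> 2" "univariate b" "\<eta> = gsubst (germ_X ^ e) 0 b"
      by (rule rotation_invariant_imp_power[OF k \<zeta> _ _ \<eta>(1) rot])
    then show False using prim by blast
  qed
  then show ?thesis by (metis inj_onI lessThan_iff linorder_neqE_nat)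
qed

text \<open>The product \<open>P\<close> of the distinct conjugates divides
  \<open>\<phi>(x^k, y)\<close>. Both are invariant under \<open>x \<mapsto> \<zeta> x\<close>,
  hence so is the quotient, and everything descends to a factorization \<open>\<phi> = w q\<close>.
  Since \<open>w\<close> vanishes at the origin, irreducibility makes \<open>q\<close> a
  unit.\<close>

lemma conj_branch_factorization:
  obtains Q where "germ_at0 Q \<noteq> 0"
    "base_change k \<phi> = Q * branch_prod (map conj_branch [0..<k])"
proof -
  define as where "as = map conj_branch [0..<k]"
  define P where "P = branch_prod as"
  define F where "F = base_change k \<phi>"
  have as: "\<forall>\<alpha>\<in>set as. univariate \<alpha> \<and> germ_at0 \<alpha> = 0" by (auto simp: as_def conj_branch_univariate)
  have "distinct as" unfolding as_def using conj_branch_inj by (simp add: distinct_map atLeast0LessThan)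
  moreover have "\<forall>\<alpha>\<in>set as. gsubst germ_X \<alpha> F = 0"
  proof
    fix \<alpha> assume "\<alpha> \<in> set as"
    then obtain i where i: "\<alpha> = conj_branch i" by (auto simp: as_def)
    have "gsubst germ_X \<alpha> F = gsubst (germ_X ^ k) (conj_branch i) \<phi>"
      unfolding F_def i using k conj_branch_univariate by (simp add: gsubst_simps)
    then show "gsubst germ_X \<alpha> F = 0" unfolding conj_branch_subst \<phi>(1) by (simp add: gsubst_zero)
  qed
  ultimately have "P dvd F" unfolding P_def using as by (intro prod_Y_minus_dvd) auto
  then obtain Q where Q: "F = P * Q" by (auto simp: dvd_def)
  let ?R = "gsubst (germ_const \<zeta> * germ_X) germ_Y"
  have R0: "germ_at0 (germ_const \<zeta> * germ_X) = 0" "germ_at0 germ_Y = 0" by simp_all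
  have P_prod: "P = (\<Prod>i<k. germ_Y - conj_branch i)"
    unfolding P_def as_def by (simp add: prod.distinct_set_conv_list[symmetric] o_def lessThan_atLeast0 flip: prod.distinct_set_conv_list)
  have RP: "?R P = P"
  proof -
    have "?R P = (\<Prod>i<k. germ_Y - conj_branch (Suc i))"
      unfolding P_prod gsubst_prod[OF R0] using conj_branch_rotate[OF R0(2), of 1] by (simp add: gsubst_simps)
    \<comment> \<open>The rotation has raised all indices by one. Multiplication by the factor of
      index 0 allows a comparison of the two products, because the conjugate of index
      \<open>k\<close> is that of index 0.\<close>
    moreover have "(germ_Y - conj_branch 0) * (\<Prod>i<k. germ_Y - conj_branch (Suc i)) = (germ_Y - conj_branch 0) * P"
      unfolding P_prod using conj_branch_period[of 0] prod.lessThan_Suc_shift[of "\<lambda>i. germ_Y - conj_branch i" k]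
      by (simp add: mult.commute)
    ultimately show ?thesis using Y_minus_mult_cancel[OF conj_branch_univariate] by metis
  qed
  have "(germ_const \<zeta> * germ_X) ^ k = germ_X ^ k"
    using \<zeta>(1) by (simp add: power_mult_distrib germ_const_power[symmetric] germ_const_simps)
  then have "?R F = F" unfolding F_def using k by (simp add: gsubst_simps)
  then have "P * ?R Q = P * Q" unfolding Q using RP by (simp add: gsubst_mult[OF R0])
  then have RQ: "?R Q = Q" unfolding P_def by (rule prod_Y_minus_cancel[OF as])
  obtain w where w: "P = base_change k w" by (rule germ_rotation_descent[OF k \<zeta> RP])
  obtain q where q: "Q = base_change k q" by (rule germ_rotation_descent[OF k \<zeta> RQ])
  have Xk: "germ_at0 (germ_X ^ k) = 0" using k by simp
  have "base_change k (\<phi> - w * q) = 0"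
    using Q unfolding F_def w q using Xk by (simp add: gsubst_simps)
  then have "\<phi> - w * q = 0" by (rule gsubst_X_power_inj[OF k])
  then have "\<phi> = w * q" by simp
  then have "w dvd 1 \<or> q dvd 1" using \<phi>(2) by (simp add: Factorial_Ring.irreducible_def)
  moreover have "\<not> w dvd 1"
  proof -
    have "germ_at0 P = 0"
      unfolding P_prod using k conj_branch_univariate
      by (simp add: prod.remove[of _ 0])
    then show ?thesis using Xk by (simp add: germ_unit_iff w)
  qed
  ultimately have "germ_at0 Q \<noteq> 0" using Xk by (simp add: germ_unit_iff q)
  then show ?thesis using that Q by (simp add: F_def P_def as_def mult.commute)
qed

lemma conj_branch_y_regular: "y_regular k \<phi>"
proof -
  obtain Q where Q: "germ_at0 Q \<noteq> 0"
    "base_change k \<phi> = Q * branch_prod (map conj_branch [0..<k])"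
    by (rule conj_branch_factorization)
  have "gsubst 0 germ_Y (branch_prod (map conj_branch js)) = germ_Y ^ length js" for js
    by (induction js) (auto simp: gsubst_simps subst_0_univariate conj_branch_univariate germ_const_simps)
  note * = this[of "[0..<k]"]
  have "gsubst 0 germ_Y \<phi> = gsubst 0 germ_Y (base_change k \<phi>)"
    using k by (simp add: gsubst_simps power_0_left)
  also have "\<dots> = germ_Y ^ k * gsubst 0 germ_Y Q"
    unfolding Q(2) using * by (simp add: gsubst_simps mult.commute)
  finally show ?thesis unfolding y_regular_def using Q(1) by (intro exI[of _ "gsubst 0 germ_Y Q"]) simp
qed

text \<open>A rotation does not change orders in \<open>x\<close>, so the \<open>k\<close>
  conjugates contribute equally and the factor \<open>k\<close> from the base change
  cancels.\<close>

lemma colength_conj_branch: "colength \<phi> g = uord (gsubst (germ_X ^ k) \<eta> g)"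
proof -
  obtain Q where Q: "germ_at0 Q \<noteq> 0"
    "base_change k \<phi> = Q * branch_prod (map conj_branch [0..<k])"
    by (rule conj_branch_factorization)
  have Xk: "germ_at0 (germ_X ^ k) = 0" using k by simp
  define G where "G = gsubst (germ_X ^ k) \<eta> g"
  have G: "univariate G" unfolding G_def using \<eta> Xk by (intro univariate_subst univariate_intros) auto
  have \<zeta>0: "\<zeta> ^ i \<noteq> 0" for i using \<zeta>(1) k by (auto simp: power_0_left)
  have ord: "uord (gsubst (germ_X ^ k) (conj_branch i) g) = uord G" for i
  proof -
    have o1: "uord (germ_const (\<zeta> ^ i) * germ_X) = 1"
      using uord_X_power_mult[of "germ_const (\<zeta> ^ i)" 1] \<zeta>0 by (simp add: mult.commute one_enat_def)
    have "germ_const (\<zeta> ^ i) * germ_X \<noteq> 0"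
    proof
      assume "germ_const (\<zeta> ^ i) * germ_X = 0"
      with o1 have "uord 0 = 1" by (simp only:)
      then show False by simp
    qed
    then show ?thesis unfolding conj_branch_subst G_def[symmetric]
      by (subst uord_subst[OF G]) (auto simp: o1 intro!: univariate_intros)
  qed
  have "of_nat k * colength \<phi> g = sum_list (map (\<lambda>\<alpha>. uord (gsubst (germ_X ^ k) \<alpha> g)) (map conj_branch [0..<k]))"
    by (rule colength_branches[OF k Q(2) _ Q(1)]) (auto simp: conj_branch_univariate)
  also have "\<dots> = of_nat k * uord G" by (simp add: o_def ord sum_list_triv)
  finally show ?thesis unfolding G_def by (rule enat_mult_cancel[OF k])
qed

end

text \<open>A change of parameter, which preserves orders, turns the first coordinate into
  \<open>t^k\<close>, and the conjugates become available. The same number \<open>k = n + 1\<close>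
  is the order of \<open>u\<close> and the order of regularity of \<open>\<phi>\<close>; this links
  the parametrization to the polar curve.\<close>

theorem irreducible_curve_colength:
  assumes \<phi>: "Factorial_Ring.irreducible \<phi>" "gsubst u v \<phi> = 0"
    and u: "univariate u" "germ_at0 u = 0" "u \<noteq> 0" and v: "univariate v" "germ_at0 v = 0"
    and prim: "primitive_curve u v"
  obtains n where "uord u = enat (Suc n)" "y_regular (Suc n) \<phi>" "\<And>g. colength \<phi> g = uord (gsubst u v g)"
proof -
  obtain k w where w: "univariate w" "germ_at0 w \<noteq> 0" "u = germ_X ^ k * w" "uord u = enat k"
    by (rule uord_cases[OF u(1)]) (use u(3) in auto)
  have k: "k > 0" using u(2) w by (cases k) auto
  obtain r where r: "univariate r" "germ_at0 r \<noteq> 0" "r ^ k = w" by (rule germ_root_exists[OF w(1,2) k])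
  define \<sigma> where "\<sigma> = germ_X * r"
  have \<sigma>: "univariate \<sigma>" "germ_at0 \<sigma> = 0" "germ_at0 (germ_dx \<sigma>) \<noteq> 0"
    using r by (auto simp: \<sigma>_def germ_dx_mult germ_dx_X intro!: univariate_intros)
  have u\<sigma>: "u = \<sigma> ^ k" using w r by (simp add: \<sigma>_def power_mult_distrib)
  obtain \<tau> where \<tau>: "univariate \<tau>" "germ_at0 \<tau> = 0" "germ_at0 (germ_dx \<tau>) \<noteq> 0"
    "gsubst \<tau> 0 \<sigma> = germ_X" "gsubst \<sigma> 0 \<tau> = germ_X" by (rule germ_inverse[OF \<sigma>])
  define \<eta> where "\<eta> = gsubst \<tau> 0 v"
  have \<eta>: "univariate \<eta>" "germ_at0 \<eta> = 0" unfolding \<eta>_def using \<tau> v by (auto intro!: univariate_subst univariate_intros)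
  have \<tau>u: "gsubst \<tau> 0 u = germ_X ^ k" unfolding u\<sigma> using \<tau> by (simp add: gsubst_simps)
  have repar: "gsubst (germ_X ^ k) \<eta> g = gsubst \<tau> 0 (gsubst u v g)" for g
    using u v \<tau> by (simp add: gsubst_simps \<tau>u \<eta>_def)
  obtain \<zeta> :: complex where \<zeta>: "\<zeta> ^ k = 1" "\<And>m. \<zeta> ^ m = 1 \<longleftrightarrow> k dvd m" by (rule root_of_unity_exists[OF k]) (rule that)
  \<comment> \<open>If \<open>\<eta>\<close> were a germ in \<open>x^e\<close> with \<open>e\<close>
    dividing \<open>k\<close>, the original curve would factor through \<open>\<sigma>^e\<close>,
    whose derivative at 0 vanishes because \<open>e\<close> is at least 2.\<close>
  have prim': "\<eta> \<noteq> gsubst (germ_X ^ e) 0 b" if e: "k = e * l" "e \<ge> 2" "univariate b" for e l b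
  proof
    assume "\<eta> = gsubst (germ_X ^ e) 0 b"
    moreover have "gsubst \<sigma> 0 \<eta> = v" unfolding \<eta>_def using \<sigma> \<tau> v by (simp add: gsubst_simps univariate_def)
    ultimately have "v = gsubst (\<sigma> ^ e) 0 b" using \<sigma> e by (simp add: gsubst_simps)
    moreover have "u = gsubst (\<sigma> ^ e) 0 (germ_X ^ l)" unfolding u\<sigma> using \<sigma> e by (simp add: gsubst_simps power_mult)
    moreover have "univariate (\<sigma> ^ e)" "univariate (germ_X ^ l)" using \<sigma> by (auto intro!: univariate_intros)
    moreover have "germ_at0 (\<sigma> ^ e) = 0" "germ_at0 (germ_dx (\<sigma> ^ e)) = 0"
    proof -
      show "germ_at0 (\<sigma> ^ e) = 0" using e \<sigma> by simp
      obtain e' where e': "e = Suc (Suc e')" using e(2) by (metis add_2_eq_Suc le_Suc_ex)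
      show "germ_at0 (germ_dx (\<sigma> ^ e)) = 0" unfolding e' germ_dx_power using \<sigma> by simp
    qed
    ultimately show False using prim e(3) unfolding primitive_curve_def by blast
  qed
  have \<phi>': "gsubst (germ_X ^ k) \<eta> \<phi> = 0" unfolding repar \<phi>(2) using \<tau> by (simp add: gsubst_zero)
  note ctx = k \<zeta> \<eta> prim' \<phi>' \<phi>(1)
  have "colength \<phi> g = uord (gsubst u v g)" for g
  proof -
    have "\<tau> \<noteq> 0" using \<tau>(3) by auto
    have "colength \<phi> g = uord (gsubst \<tau> 0 (gsubst u v g))"
      using colength_conj_branch[OF ctx] unfolding repar by simp
    also have "\<dots> = uord (gsubst u v g)"
      by (subst uord_subst[OF univariate_subst[OF u(1) v(1) u(2) v(2)] \<tau>(1,2) \<open>\<tau> \<noteq> 0\<close>]) (simp add: uord_dx_ne_0[OF \<tau>(1-3)])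
    finally show ?thesis .
  qed
  moreover have "y_regular k \<phi>" by (rule conj_branch_y_regular[OF ctx])
  ultimately show ?thesis using that[of "k - 1"] k w by simp
qed

section \<open>The dimension of the quotient ring\<close>

lemma germ_ring_simps:
  "carrier germ_ring = UNIV" "x \<otimes>\<^bsub>germ_ring\<^esub> y = x * y" "x \<oplus>\<^bsub>germ_ring\<^esub> y = x + y"
  "\<zero>\<^bsub>germ_ring\<^esub> = 0" "\<one>\<^bsub>germ_ring\<^esub> = 1"
  by (simp_all add: ring_of_type_algebra_def)

lemma ideal_gideal: "ideal (gideal f g) germ_ring"
proof -
  interpret R: cring germ_ring by (rule cring_from_type_algebra)
  show ?thesis
  proof (rule idealI)
    show "ring germ_ring" by (rule ring_from_type_algebra)
    show "subgroup (gideal f g) (add_monoid germ_ring)"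
    proof (rule R.add.subgroupI)
      show "gideal f g \<noteq> {}" using gideal_gen by blast
    next
      fix a assume a: "a \<in> gideal f g"
      have "\<ominus>\<^bsub>germ_ring\<^esub> a = (- 1) * a" by (rule R.minus_equality) (simp_all add: germ_ring_simps)
      then show "\<ominus>\<^bsub>germ_ring\<^esub> a \<in> gideal f g" using gideal_mult[OF a, of "- 1"] by simp
    qed (auto simp: germ_ring_simps intro: gideal_add)
  next
    fix a x assume "a \<in> gideal f g"
    then show "x \<otimes>\<^bsub>germ_ring\<^esub> a \<in> gideal f g" "a \<otimes>\<^bsub>germ_ring\<^esub> x \<in> gideal f g"
      using gideal_mult[of a f g x] by (simp_all add: germ_ring_simps mult.commute)
  qed
qed

lemma genideal_eq_gideal: "genideal germ_ring {f, g} = gideal f g"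
proof
  interpret R: cring germ_ring by (rule cring_from_type_algebra)
  show "genideal germ_ring {f, g} \<subseteq> gideal f g"
    by (rule R.genideal_minimal[OF ideal_gideal]) (simp add: gideal_gen)
  interpret I: ideal "genideal germ_ring {f, g}" germ_ring
    by (rule R.genideal_ideal) (simp add: germ_ring_simps)
  show "gideal f g \<subseteq> genideal germ_ring {f, g}"
  proof
    fix x assume "x \<in> gideal f g"
    then obtain a b where x: "x = a * f + b * g" by (rule gidealE)
    have fg: "f \<in> genideal germ_ring {f, g}" "g \<in> genideal germ_ring {f, g}"
      using R.genideal_self[of "{f, g}"] by (auto simp: germ_ring_simps)
    then show "x \<in> genideal germ_ring {f, g}"
      using I.a_closed[OF I.I_l_closed[OF fg(1), of a] I.I_l_closed[OF fg(2), of b]]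
      by (simp add: germ_ring_simps x)
  qed
qed

text \<open>Subspaces of the quotient correspond to the subspaces between \<open>I\<close> and the
  whole ring. Under this correspondence \<open>line_extension\<close> becomes \<open>adjoin\<close>,
  so chains translate step by step in both directions.\<close>

lemma quotient_dim_eq_colength: "quotient_dim f g = colength f g"
proof -
  define I where "I = gideal f g"
  interpret R: cring germ_ring by (rule cring_from_type_algebra)
  interpret I: ideal I germ_ring unfolding I_def by (rule ideal_gideal)
  define Q where "Q = germ_ring Quot I"
  interpret Q: ring Q unfolding Q_def by (rule I.quotient_is_ring)
  define cos where "cos x = a_r_coset germ_ring I x" for x
  define K where "K = range (\<lambda>c. cos (germ_const c))"
  have sub: "germ.subspace I" unfolding I_def by (rule subspace_gideal)
  have I0: "0 \<in> I" using germ.subspace_0[OF sub] .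
  have cos: "cos x = {i + x | i. i \<in> I}" for x
    unfolding cos_def a_r_coset_def' by (auto simp: germ_ring_simps)
  have cos_eq: "cos x = cos y \<longleftrightarrow> x - y \<in> I" for x y
  proof
    assume "cos x = cos y"
    moreover have "x \<in> cos x" unfolding cos using I0 by force
    ultimately obtain i where "x = i + y" "i \<in> I" unfolding cos by blast
    then show "x - y \<in> I" by simp
  next
    assume d: "x - y \<in> I"
    then have d': "y - x \<in> I" using germ.subspace_neg[OF sub d] by simp
    show "cos x = cos y"
    proof (intro equalityI subsetI)
      fix z assume "z \<in> cos x"
      then obtain i where "z = i + x" "i \<in> I" unfolding cos by blast
      then have "z = (i + (x - y)) + y" "i + (x - y) \<in> I" using germ.subspace_add[OF sub _ d] by auto
      then show "z \<in> cos y" unfolding cos by blast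
    next
      fix z assume "z \<in> cos y"
      then obtain i where "z = i + y" "i \<in> I" unfolding cos by blast
      then have "z = (i + (y - x)) + x" "i + (y - x) \<in> I" using germ.subspace_add[OF sub _ d'] by auto
      then show "z \<in> cos x" unfolding cos by blast
    qed
  qed
  have Q0: "\<zero>\<^bsub>Q\<^esub> = cos 0" unfolding Q_def FactRing_def cos by simp
  have Qadd: "cos x \<oplus>\<^bsub>Q\<^esub> cos y = cos (x + y)" for x y
    using I.a_rcos_sum[of x y] by (simp add: Q_def FactRing_def cos_def germ_ring_simps)
  have Qmult: "cos x \<otimes>\<^bsub>Q\<^esub> cos y = cos (x * y)" for x y
    using I.rcoset_mult_add[of x y] by (simp add: Q_def FactRing_def cos_def germ_ring_simps)
  have Qcarrier: "carrier Q = range cos"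
    unfolding Q_def FactRing_def A_RCOSETS_def' by (auto simp: cos_def germ_ring_simps)
  have to_Q: "Q.dimension n K (cos ` U)" if "germ.qdim I n U" for n U
    using that
  proof (induction rule: germ.qdim.induct)
    case qdim_0
    have "cos ` I = {\<zero>\<^bsub>Q\<^esub>}" using I0 cos_eq[of _ 0] by (auto simp: Q0)
    then show ?case using Q.zero_dim by simp
  next
    case (qdim_Suc n U v)
    have U: "germ.subspace U" "I \<subseteq> U" using germ.qdim_subspace[OF qdim_Suc.hyps(1) sub] germ.qdim_subset[OF qdim_Suc.hyps(1)] by auto
    have "cos v \<notin> cos ` U"
    proof
      assume "cos v \<in> cos ` U"
      then obtain u where "u \<in> U" "v - u \<in> U" using cos_eq U(2) by auto
      then have "u + (v - u) \<in> U" using germ.subspace_add[OF U(1)] by blast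
      then show False using qdim_Suc.hyps(2) by simp
    qed
    then have "Q.dimension (Suc n) K (Q.line_extension K (cos v) (cos ` U))"
      using qdim_Suc.IH by (intro Q.Suc_dim) (auto simp: Qcarrier)
    also have "Q.line_extension K (cos v) (cos ` U) = cos ` germ.adjoin U v"
    proof (intro equalityI subsetI)
      fix z assume "z \<in> Q.line_extension K (cos v) (cos ` U)"
      then obtain c u where "u \<in> U" "z = cos (germ_const c) \<otimes>\<^bsub>Q\<^esub> cos v \<oplus>\<^bsub>Q\<^esub> cos u"
        unfolding Q.line_extension_mem_iff K_def by blast
      then have "z = cos (u + germ_const c * v)" "u + germ_const c * v \<in> germ.adjoin U v"
        by (auto simp: Qadd Qmult add.commute intro: germ.adjoinI)
      then show "z \<in> cos ` germ.adjoin U v" by blast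
    next
      fix z assume "z \<in> cos ` germ.adjoin U v"
      then obtain u c where "u \<in> U" "z = cos (u + germ_const c * v)" by (auto elim: germ.adjoinE)
      then have "z = cos (germ_const c) \<otimes>\<^bsub>Q\<^esub> cos v \<oplus>\<^bsub>Q\<^esub> cos u" "cos u \<in> cos ` U" "cos (germ_const c) \<in> K"
        by (auto simp: Qadd Qmult add.commute K_def)
      then show "z \<in> Q.line_extension K (cos v) (cos ` U)" unfolding Q.line_extension_mem_iff by blast
    qed
    finally show ?case .
  qed
  \<comment> \<open>The inclusion in the carrier is carried through the induction: it makes every
    element of \<open>E\<close> the coset of a germ.\<close>
  have from_Q: "E \<subseteq> carrier Q \<and> germ.qdim I n {x. cos x \<in> E}" if "Q.dimension n K' E" "K' = K" for n K' E
    using that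
  proof (induction rule: Q.dimension.induct)
    case zero_dim
    have "{x. cos x \<in> {\<zero>\<^bsub>Q\<^esub>}} = I" using cos_eq[of _ 0] by (auto simp: Q0)
    then show ?case using germ.qdim_0 by simp
  next
    case (Suc_dim v E n K')
    note [simp] = Suc_dim.prems
    obtain w where w: "v = cos w" using Suc_dim.hyps(1) by (auto simp: Qcarrier)
    have E: "E \<subseteq> carrier Q" and qdim: "germ.qdim I n {x. cos x \<in> E}" using Suc_dim.IH Suc_dim.prems by auto
    have "w \<notin> {x. cos x \<in> E}" using Suc_dim.hyps(2) w by simp
    from germ.qdim_Suc[OF qdim this]
    have "germ.qdim I (Suc n) (germ.adjoin {x. cos x \<in> E} w)" .
    also have "germ.adjoin {x. cos x \<in> E} w = {x. cos x \<in> Q.line_extension K v E}"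
    proof (intro equalityI subsetI)
      fix x assume "x \<in> germ.adjoin {x. cos x \<in> E} w"
      then obtain u c where "x = u + germ_const c * w" "cos u \<in> E" by (auto elim: germ.adjoinE)
      then have "cos x = cos (germ_const c) \<otimes>\<^bsub>Q\<^esub> v \<oplus>\<^bsub>Q\<^esub> cos u" "cos (germ_const c) \<in> K"
        by (auto simp: Qadd Qmult add.commute K_def w)
      then show "x \<in> {x. cos x \<in> Q.line_extension K v E}"
        using \<open>cos u \<in> E\<close> unfolding mem_Collect_eq Q.line_extension_mem_iff by blast
    next
      fix x assume "x \<in> {x. cos x \<in> Q.line_extension K v E}"
      then obtain c e where e: "e \<in> E" "cos x = cos (germ_const c) \<otimes>\<^bsub>Q\<^esub> cos w \<oplus>\<^bsub>Q\<^esub> e"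
        unfolding mem_Collect_eq Q.line_extension_mem_iff K_def w by blast
      obtain u where u: "e = cos u" using e E by (auto simp: Qcarrier)
      have "x - (germ_const c * w + u) \<in> I" using e(2) unfolding u Qmult Qadd cos_eq .
      then have "cos (x - germ_const c * w) = e" unfolding u cos_eq by (simp add: algebra_simps)
      then show "x \<in> germ.adjoin {x. cos x \<in> E} w"
        using e(1) by (intro germ.adjoinI[of _ "x - germ_const c * w" c]) auto
    qed
    finally have "germ.qdim I (Suc n) {x. cos x \<in> Q.line_extension K v E}" .
    moreover have "Q.line_extension K v E \<subseteq> carrier Q"
    proof
      fix z assume "z \<in> Q.line_extension K v E"
      then obtain c e where e: "e \<in> E" "z = cos (germ_const c) \<otimes>\<^bsub>Q\<^esub> cos w \<oplus>\<^bsub>Q\<^esub> e"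
        unfolding Q.line_extension_mem_iff K_def w by blast
      then obtain u where "e = cos u" using E by (auto simp: Qcarrier)
      then show "z \<in> carrier Q" using e by (simp add: Qmult Qadd Qcarrier)
    qed
    ultimately show ?case by simp
  qed
  have dim_iff: "Q.dimension n K (carrier Q) \<longleftrightarrow> germ.qdim I n UNIV" for n
  proof
    assume "Q.dimension n K (carrier Q)"
    from from_Q[OF this refl] show "germ.qdim I n UNIV" by (simp add: Qcarrier)
  next
    assume "germ.qdim I n UNIV"
    from to_Q[OF this] show "Q.dimension n K (carrier Q)" by (simp add: Qcarrier)
  qed
  have "quotient_dim f g = edim Q K (carrier Q)"
    unfolding quotient_dim_def genideal_eq_gideal Let_def Q_def K_def cos_def I_def ..
  also have "\<dots> = germ.rdim I UNIV"
    unfolding edim_def germ.rdim_def Q.finite_dimension_def Q.dim_def dim_iff ..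
  finally show ?thesis unfolding colength_def I_def .
qed

section \<open>Tangency order, Milnor number and pull-back\<close>

lemma enat_add_cancel: "of_nat n + a = of_nat n + b \<Longrightarrow> a = (b :: enat)"
  by (cases a; cases b) (auto simp: of_nat_eq_enat)

lemma univariate_subst_eq_0:
  assumes h: "univariate h" and v: "univariate v" "germ_at0 v = 0" "v \<noteq> 0" and 0: "gsubst v 0 h = 0"
  shows "h = 0"
proof -
  have "uord v * uord h = \<infinity>" using uord_subst[OF h v] 0 by simp
  moreover have "uord v \<noteq> \<infinity>" using v uord_eq_infinity by simp
  ultimately have "uord h = \<infinity>" by (auto simp: imult_is_infinity)
  then show ?thesis using h uord_eq_infinity by simp
qed

lemma colength_X: "colength germ_X g = uord (gsubst 0 germ_X g)"
proof -
  have "colength germ_X g = colength (germ_swap germ_X) (germ_swap g)"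
    by (rule colength_swap[symmetric])
  also have "\<dots> = colength (germ_Y - 0) (germ_swap g)" by (simp add: gsubst_simps)
  also have "\<dots> = uord (gsubst germ_X 0 (germ_swap g))"
    by (rule colength_Y_minus) (simp_all add: univariate_intros)
  finally show ?thesis by (simp add: gsubst_simps)
qed

theorem tangency_formula:
  assumes \<phi>: "Factorial_Ring.irreducible \<phi>" "gsubst u v \<phi> = 0"
    and u: "univariate u" "germ_at0 u = 0" and v: "univariate v" "germ_at0 v = 0"
    and prim: "primitive_curve u v"
  shows "colength \<phi> (A * germ_dy \<phi> - B * germ_dx \<phi>) =
    uord (gsubst u v A * germ_dx u + gsubst u v B * germ_dx v) + colength (germ_dx \<phi>) (germ_dy \<phi>)"
proof -
  have chain: "gsubst u v (germ_dx \<phi>) * germ_dx u + gsubst u v (germ_dy \<phi>) * germ_dx v = 0"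
    using germ_dx_subst(1)[OF u(2) v(2), of \<phi>] \<phi>(2) by simp
  let ?pull = "gsubst u v A * germ_dx u + gsubst u v B * germ_dx v"
  have pull: "univariate ?pull" using u v by (intro univariate_intros univariate_subst germ_dx_univariate)
  show ?thesis
  proof (cases "u = 0")
    case False
    obtain n where n: "uord u = enat (Suc n)" "y_regular (Suc n) \<phi>" "\<And>g. colength \<phi> g = uord (gsubst u v g)"
      by (rule irreducible_curve_colength[OF \<phi> u False v prim]) (rule that)
    let ?G = "gsubst u v (A * germ_dy \<phi> - B * germ_dx \<phi>)"
    have "germ_dx u * ?G = gsubst u v (germ_dy \<phi>) * ?pull
       - gsubst u v B * (gsubst u v (germ_dx \<phi>) * germ_dx u + gsubst u v (germ_dy \<phi>) * germ_dx v)"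
      using u v by (simp add: gsubst_simps algebra_simps)
    then have "germ_dx u * ?G = gsubst u v (germ_dy \<phi>) * ?pull" unfolding chain by simp
    moreover have "uord (germ_dx u * ?G) = uord (germ_dx u) + uord ?G"
      using u v by (intro uord_mult univariate_subst germ_dx_univariate)
    moreover have "uord (gsubst u v (germ_dy \<phi>) * ?pull) = uord (gsubst u v (germ_dy \<phi>)) + uord ?pull"
      using u v pull by (intro uord_mult univariate_subst)
    ultimately have "uord (germ_dx u) + uord ?G = uord (gsubst u v (germ_dy \<phi>)) + uord ?pull" by simp
    moreover have "uord (germ_dx u) = enat n"
      using uord_deriv[OF u] n(1) by (cases "uord (germ_dx u)") (auto simp: one_enat_def)
    moreover have "uord (gsubst u v (germ_dy \<phi>)) = colength (germ_dy \<phi>) \<phi>"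
      unfolding colength_commute[of "germ_dy \<phi>"] n(3) ..
    \<comment> \<open>On the left \<open>n\<close> is the order of \<open>x'(t)\<close>, on the
      right the correction term of \<open>colength_polar\<close>. Being finite, it cancels.\<close>
    ultimately have "of_nat n + colength \<phi> (A * germ_dy \<phi> - B * germ_dx \<phi>) =
        of_nat n + (uord ?pull + colength (germ_dx \<phi>) (germ_dy \<phi>))"
      using n(3) colength_polar[OF n(2)] by (simp add: of_nat_eq_enat colength_commute[of "germ_dx \<phi>"] add_ac)
    then show ?thesis by (rule enat_add_cancel)
  next
    case True
    \<comment> \<open>For \<open>u = 0\<close> the parametrization is \<open>(0, x)\<close> composed
      with \<open>v\<close>, so primitivity excludes \<open>v'(0) = 0\<close>.\<close>
    have dv: "germ_at0 (germ_dx v) \<noteq> 0"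
    proof
      assume "germ_at0 (germ_dx v) = 0"
      moreover have "u = gsubst v 0 0" "v = gsubst v 0 germ_X" using True v by (simp_all add: gsubst_simps)
      ultimately show False using prim v univariate_intros(1,4) unfolding primitive_curve_def by blast
    qed
    then have "v \<noteq> 0" by auto
    \<comment> \<open>The curve is the line \<open>x = 0\<close>: \<open>\<phi>\<close> vanishes
      there, hence is \<open>x\<close> times a germ that irreducibility makes a unit. Then
      \<open>\<phi>_x\<close> is a unit, the Milnor number is 0, and the other two terms are both
      the order of \<open>B\<close> on the line.\<close>
    have "gsubst v 0 (gsubst 0 germ_X \<phi>) = 0" using \<phi>(2) True v by (simp add: gsubst_simps)
    then have "gsubst 0 germ_X \<phi> = 0"
      using univariate_subst_eq_0[OF _ v \<open>v \<noteq> 0\<close>] by (simp add: univariate_def gsubst_simps)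
    then have "gsubst germ_Y 0 (gsubst 0 germ_X \<phi>) = 0" by (simp add: gsubst_simps)
    then have "gsubst 0 germ_Y \<phi> = 0" by (simp add: gsubst_simps)
    then obtain q where q: "\<phi> = germ_X * q" using germ_X_dvd by (auto simp: dvd_def)
    then have "germ_X dvd 1 \<or> q dvd 1" using \<phi>(1) by (simp add: Factorial_Ring.irreducible_def)
    then have q0: "germ_at0 q \<noteq> 0" by (simp add: germ_unit_iff)
    have dx: "germ_dx \<phi> = q + germ_X * germ_dx q" and dy: "germ_dy \<phi> = germ_X * germ_dy q"
      unfolding q germ_dx_mult germ_dy_mult germ_dx_X germ_dy_X by simp_all
    have milnor: "colength (germ_dx \<phi>) (germ_dy \<phi>) = 0" by (rule colength_unit) (simp add: dx q0)
    let ?G = "A * germ_dy \<phi> - B * germ_dx \<phi>"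
    have uB: "univariate (gsubst 0 germ_X B)" and uq: "univariate (- gsubst 0 germ_X q)"
      by (simp_all add: univariate_def gsubst_simps)
    have "gsubst 0 germ_X ?G = (- gsubst 0 germ_X q) * gsubst 0 germ_X B"
      unfolding dx dy by (simp add: gsubst_simps)
    then have "uord (gsubst 0 germ_X ?G) = uord (- gsubst 0 germ_X q) + uord (gsubst 0 germ_X B)"
      using uord_mult[OF uq uB] by (simp only:)
    also have "uord (- gsubst 0 germ_X q) = 0" by (rule uord_unit) (simp add: q0)
    finally have "uord (gsubst 0 germ_X ?G) = uord (gsubst 0 germ_X B)" by simp
    then have "colength \<phi> ?G = uord (gsubst 0 germ_X B)"
      using colength_unit_mult[OF q0, of germ_X ?G] by (simp add: q mult.commute colength_X)
    moreover have "uord ?pull = uord (gsubst 0 germ_X B)"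
    proof -
      have "?pull = gsubst v 0 (gsubst 0 germ_X B) * germ_dx v" using True v by (simp add: gsubst_simps)
      then have "uord ?pull = uord (gsubst v 0 (gsubst 0 germ_X B)) + uord (germ_dx v)"
        using uord_mult[OF univariate_subst[OF v(1) univariate_intros(1) v(2)] germ_dx_univariate[OF v(1)]] by simp
      also have "\<dots> = uord (gsubst 0 germ_X B)"
        using uord_subst[OF uB v \<open>v \<noteq> 0\<close>] by (simp add: uord_dx_ne_0[OF v dv] uord_unit[OF dv])
      finally show ?thesis .
    qed
    ultimately show ?thesis using milnor by simp
  qed
qed

section \<open>From germs in one variable back to analytic functions\<close>

lemma eventually_nhds_0_fstD:
  assumes "\<forall>\<^sub>F p in nhds (0 :: complex \<times> complex). P (fst p)"
  shows "\<forall>\<^sub>F t in nhds (0 :: complex). P t"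
proof -
  have "((\<lambda>t. (t, 0)) \<longlongrightarrow> (0, 0)) (nhds (0 :: complex))"
    by (intro tendsto_intros) (auto simp: filterlim_ident)
  then have "filterlim (\<lambda>t. (t, 0)) (nhds 0) (nhds (0 :: complex))" by (simp add: zero_prod_def)
  from eventually_compose_filterlim[OF assms this] show ?thesis by simp
qed

lemma vanishing_order_eq_uord:
  assumes h: "univariate h" and H: "represents (\<lambda>p. H (fst p)) h"
  shows "vanishing_order H = uord h"
proof (cases rule: uord_cases[OF h])
  case 1
  then have "\<forall>\<^sub>F p in nhds (0 :: complex \<times> complex). H (fst p) = 0"
    using represents_eq_iff[OF H represents_intros(1)] by simp
  then have "\<forall>\<^sub>F t in nhds 0. H t = 0" by (intro eventually_nhds_0_fstD)
  then show ?thesis using 1 by (simp add: vanishing_order_def)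
next
  case (2 m w)
  obtain f where f: "f analytic_on {0}" "represents (\<lambda>p. f (fst p)) w" by (rule represents_univariate[OF 2(1)])
  have f0: "f 0 \<noteq> 0" using represents_at0[OF f(2)] 2(2) by simp
  have "\<forall>\<^sub>F p in nhds (0 :: complex \<times> complex). H (fst p) = fst p ^ m * f (fst p)"
    using represents_eq_iff[OF H represents_intros(8)[OF represents_power[OF represents_intros(4)] f(2)], of m] 2(3)
    by blast
  then have ev: "\<forall>\<^sub>F t in nhds 0. H t = t ^ m * f t" by (intro eventually_nhds_0_fstD)
  have "isCont f 0" using f(1) by (intro analytic_at_imp_isCont) simp
  then have "(f \<longlongrightarrow> f 0) (nhds 0)" by (simp add: isCont_def tendsto_at_iff_tendsto_nhds)
  then have fne: "\<forall>\<^sub>F t in nhds 0. f t \<noteq> 0" using f0 tendsto_imp_eventually_ne by blast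
  have "\<not> (\<forall>\<^sub>F t in nhds 0. H t = 0)"
  proof
    assume "\<forall>\<^sub>F t in nhds 0. H t = 0"
    with ev fne have "\<forall>\<^sub>F t in nhds 0. (t :: complex) ^ m = 0" by eventually_elim auto
    then have "\<forall>\<^sub>F t in at 0. (t :: complex) = 0"
      unfolding eventually_at_filter by (auto elim!: eventually_mono)
    then have "\<forall>\<^sub>F t in at (0 :: complex). False"
      by (simp add: eventually_at_filter)
    then show False by simp
  qed
  moreover have "zorder H 0 = int m"
  proof -
    obtain r where r: "r > 0" "f holomorphic_on ball 0 r" using f(1) by (auto simp: analytic_on_def)
    have "zorder H 0 = zorder (\<lambda>t. f t * (t - 0) powi int m) 0"
      by (rule zorder_cong)
        (use ev in \<open>auto simp: mult.commute eventually_at_filter elim!: eventually_mono\<close>)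
    also have "\<dots> = int m"
      by (rule zorder_eqI[of "ball 0 r" 0 f]) (use r f0 in auto)
    finally show ?thesis .
  qed
  ultimately show ?thesis using 2 by (simp add: vanishing_order_def)
qed

theorem proposition6p2:
  fixes \<omega> :: one_form and \<phi> :: germ and \<gamma> :: "complex \<Rightarrow> complex \<times> complex"
  assumes "foliation_form \<omega>" and "singular_at0 \<omega>"
    and "reduced_equation \<phi>"
    and "Factorial_Ring.irreducible \<phi>"
    and "\<not> invariant_curve \<omega> \<phi>"
    and "puiseux_parametrization \<phi> \<gamma>"
  shows "tang \<omega> \<phi> = vanishing_order (pullback_coeff \<gamma> \<omega>) + milnor_number \<phi>"
proof -
  obtain A B where \<omega>: "\<omega> = (A, B)" by (cases \<omega>)
  have an: "(fst \<circ> \<gamma>) analytic_on {0}" "(snd \<circ> \<gamma>) analytic_on {0}" and \<gamma>0: "\<gamma> 0 = 0"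
    and on_curve: "\<forall>\<^sub>F t in nhds 0. rep_germ \<phi> (\<gamma> t) = 0"
    and prim: "\<And>\<sigma> \<tau>. (fst \<circ> \<sigma>) analytic_on {0} \<Longrightarrow> (snd \<circ> \<sigma>) analytic_on {0} \<Longrightarrow>
      \<tau> analytic_on {0} \<Longrightarrow> \<tau> 0 = 0 \<Longrightarrow> deriv \<tau> 0 = 0 \<Longrightarrow> \<not> (\<forall>\<^sub>F t in nhds 0. \<gamma> t = \<sigma> (\<tau> t))"
    using assms(6) unfolding puiseux_parametrization_def by blast+
  define u where "u = abs_germ (\<lambda>p. (fst \<circ> \<gamma>) (fst p))"
  define v where "v = abs_germ (\<lambda>p. (snd \<circ> \<gamma>) (fst p))"
  have ru: "represents (\<lambda>p. (fst \<circ> \<gamma>) (fst p)) u" and rv: "represents (\<lambda>p. (snd \<circ> \<gamma>) (fst p)) v"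
    unfolding u_def v_def by (rule represents_analytic[OF an(1)], rule represents_analytic[OF an(2)])
  have u: "univariate u" "germ_at0 u = 0" and v: "univariate v" "germ_at0 v = 0"
    using univariate_abs_germ[OF an(1)] univariate_abs_germ[OF an(2)] represents_at0[OF ru] represents_at0[OF rv] \<gamma>0
    by (simp_all add: u_def v_def)
  \<comment> \<open>Because \<open>\<gamma>\<close> maps 0 to the origin, the compositions with
    \<open>rep_germ\<close> in the definitions represent substitutions of germs.\<close>
  have subst: "represents (\<lambda>p. rep_germ f (\<gamma> (fst p))) (gsubst u v f)" for f
    using represents_subst[OF ru rv represents_rep_germ[of f]] \<gamma>0 by simp
  have "gsubst u v \<phi> = 0"
    by (rule represents_eqI[OF subst represents_intros(1)]) (rule eventually_nhds_0_fst[OF on_curve])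
  \<comment> \<open>A factorization of the germs through \<open>\<tau>\<close> has analytic
    representatives, and these would factor \<open>\<gamma>\<close> in the way excluded by
    \<open>puiseux_parametrization\<close>.\<close>
  moreover have "primitive_curve u v"
    unfolding primitive_curve_def
  proof (intro notI, elim exE conjE)
    fix a b \<tau>
    assume \<tau>: "univariate \<tau>" "germ_at0 \<tau> = 0" "germ_at0 (germ_dx \<tau>) = 0"
      and ab: "univariate a" "univariate b" "u = gsubst \<tau> 0 a" "v = gsubst \<tau> 0 b"
    obtain T where T: "T analytic_on {0}" "represents (\<lambda>p. T (fst p)) \<tau>" by (rule represents_univariate[OF \<tau>(1)])
    obtain a' where a': "a' analytic_on {0}" "represents (\<lambda>p. a' (fst p)) a" by (rule represents_univariate[OF ab(1)])
    obtain b' where b': "b' analytic_on {0}" "represents (\<lambda>p. b' (fst p)) b" by (rule represents_univariate[OF ab(2)])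
    have T0: "T 0 = 0" using represents_at0[OF T(2)] \<tau> by simp
    have "deriv T 0 = 0"
      using represents_at0[OF represents_intros(10)[OF T(2)]] \<tau> by (simp add: partial_x_def zero_prod_def)
    moreover have "\<forall>\<^sub>F t in nhds 0. \<gamma> t = (a' (T t), b' (T t))"
    proof -
      have "represents (\<lambda>p. a' (T (fst p))) u" "represents (\<lambda>p. b' (T (fst p))) v"
        unfolding ab using represents_subst[OF T(2) represents_intros(1) a'(2)]
          represents_subst[OF T(2) represents_intros(1) b'(2)] T0 by simp_all
      then have "\<forall>\<^sub>F p in nhds (0 :: complex \<times> complex). fst (\<gamma> (fst p)) = a' (T (fst p))"
        "\<forall>\<^sub>F p in nhds (0 :: complex \<times> complex). snd (\<gamma> (fst p)) = b' (T (fst p))"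
        using represents_eq_iff[OF ru] represents_eq_iff[OF rv] by auto
      then have "\<forall>\<^sub>F p in nhds (0 :: complex \<times> complex). \<gamma> (fst p) = (a' (T (fst p)), b' (T (fst p)))"
        by eventually_elim (simp add: prod_eq_iff)
      then show ?thesis by (intro eventually_nhds_0_fstD)
    qed
    ultimately show False using prim[of "\<lambda>s. (a' s, b' s)" T] T a' b' T0 by (simp add: o_def)
  qed
  ultimately have formula: "colength \<phi> (A * germ_dy \<phi> - B * germ_dx \<phi>) =
    uord (gsubst u v A * germ_dx u + gsubst u v B * germ_dx v) + colength (germ_dx \<phi>) (germ_dy \<phi>)"
    using tangency_formula[OF assms(4) _ u v] by blast
  have "represents (\<lambda>p. pullback_coeff \<gamma> \<omega> (fst p)) (gsubst u v A * germ_dx u + gsubst u v B * germ_dx v)"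
  proof -
    have dx: "partial_x (\<lambda>p. c (fst p)) p = deriv c (fst p)" for c p
      by (cases p) (simp add: partial_x_def)
    show ?thesis unfolding pullback_coeff_def \<omega> fst_conv snd_conv
      using represents_intros(6)[OF represents_intros(8)[OF subst[of A] represents_intros(10)[OF ru]]
        represents_intros(8)[OF subst[of B] represents_intros(10)[OF rv]]] unfolding dx .
  qed
  moreover have "univariate (gsubst u v A * germ_dx u + gsubst u v B * germ_dx v)"
    using u v by (intro univariate_intros univariate_subst germ_dx_univariate)
  ultimately have "vanishing_order (pullback_coeff \<gamma> \<omega>) = uord (gsubst u v A * germ_dx u + gsubst u v B * germ_dx v)"
    by (intro vanishing_order_eq_uord)
  moreover have "tang \<omega> \<phi> = colength \<phi> (A * germ_dy \<phi> - B * germ_dx \<phi>)"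
    unfolding tang_def quotient_dim_eq_colength by (simp add: \<omega> apply_field_def dual_field_def)
  ultimately show ?thesis
    using formula by (simp add: milnor_number_def quotient_dim_eq_colength)
qed

end
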